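(* Let $b$ be prime, let $\alpha>1$, $s\ge1$, $m\ge1$ be integers, put $n=\alpha m$ and $N=b^m$, let $\gamma_1,\gamma_2,\ldots$ be positive weights, let $p(X)\in\mathbb F_b[X]$ be irreducible of degree $n$, and let $g(X)$ be a generator of the multiplicative group $(\mathbb F_b[X]/p(X))^\times$. Let $c_\omega$ be the cost of one evaluation of $\omega_\alpha$ at a point $v/b^n$, $0\le v<b^n$, and let $\tilde c_v$ be the cost of one multiplication by $g(X)$ modulo $p(X)$ together with one evaluation of $w(X)\mapsto v_n(w(X)/p(X))$ for $\deg(w)<n$. Then there is an algorithm (using fast circular convolution by fast Fourier transforms) which carries out the component-by-component construction of higher order polynomial lattice rules, i.e. which outputs $(q_1(X),\ldots,q_s(X))\in G_{b,n}^s$ such that, for each $d=1,\ldots,s$ successively, $q_d(X)$ minimizes $e_{b^m,\alpha}((q_1(X),\ldots,q_{d-1}(X),q(X)),p(X))$ over all $q(X)\in G_{b,n}$, with construction cost $$O\bigl(s\,b^n\log b^n+b^n(c_\omega+\tilde c_v)\bigr)$$ and using $O(b^n)=O(N^\alpha)$ memory.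
   Context: Digits and Walsh functions. For $k\in\mathbb N$ write $k=\sum_{i=0}^a\kappa_ib^i$ in base $b$; let $\#k$ be the number of non-zero digits, $k=\sum_{i=1}^{\#k}\kappa_{a_i}b^{a_i}$ with $\kappa_{a_i}\ne0$, $a_1>\cdots>a_{\#k}\ge0$ (and $\#0=0$). Set $r_\alpha(k)=b^{-\sum_{i=1}^{\min(\#k,\alpha)}(a_i+1)}$. For $x=\sum_{i\ge1}\xi_ib^{-i}\in[0,1)$ (digits not eventually all $b-1$), $\mathrm{wal}_k(x)=\exp(2\pi\mathrm i(\xi_1\kappa_0+\cdots+\xi_{a+1}\kappa_a)/b)$, with $\mathrm{wal}_0=1$; $\mathrm{wal}_{\boldsymbol k}(\boldsymbol x)=\prod_j\mathrm{wal}_{k_j}(x_j)$; $\omega_\alpha(x)=\sum_{k=1}^\infty r_\alpha(k)\mathrm{wal}_k(x)$; $r_\alpha(\boldsymbol\gamma,\boldsymbol k)=\prod_{j:\,k_j\ne0}\gamma_jr_\alpha(k_j)$ (equal to $1$ for $\boldsymbol k=\boldsymbol0$). Polynomial lattice rule. $v_n(\sum_{i=\ell}^\infty w_iX^{-i})=\sum_{i=\max(\ell,1)}^nw_ib^{-i}$ for formal Laurent series over $\mathbb F_b=\{0,\ldots,b-1\}$. For $0\le h<b^m$ with base $b$ digits $h_0,\ldots,h_{m-1}$ put $h(X)=\sum_{i=0}^{m-1}h_iX^i$. The rule in dimension $d$ with generating vector $(q_1,\ldots,q_d)$ modulo $p$ is the equal-weight quadrature rule with the $b^m$ nodes $\boldsymbol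 x_h=(v_n(h(X)q_j(X)/p(X)))_{1\le j\le d}$, $0\le h<b^m$. Worst-case error. $e_{b^m,\alpha}((q_1,\ldots,q_d),p)$ is the supremum of $\left|\int_{[0,1]^d}f-\frac1{b^m}\sum_{h=0}^{b^m-1}f(\boldsymbol x_h)\right|$ over all $f:[0,1)^d\to\mathbb C$ with absolutely convergent Walsh series $f=\sum_{\boldsymbol k\in\mathbb N_0^d}\widehat f_{\boldsymbol k}\mathrm{wal}_{\boldsymbol k}$ and $\sup_{\boldsymbol k}|\widehat f_{\boldsymbol k}|/r_\alpha(\boldsymbol\gamma,\boldsymbol k)\le1$. Search set. $G_{b,n}=\{v(X)\in\mathbb F_b[X]\setminus\{0\}:\deg(v)<n\}$. Cost model. Exact arithmetic on real/complex numbers at unit cost (roots of unity available), unit cost for storing, comparing and looking up numbers or polynomials of degree less than $n$ (encoded as integers below $b^n$); the memory bound counts working storage, not the input weights or the output vector. Ties in the minimization may be broken arbitrarily. *)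

theory Defs
  imports
    "HOL-Analysis.Analysis"
    "HOL-Number_Theory.Cong"
    "HOL-Algebra.Generated_Groups"
    "Berlekamp_Zassenhaus.Poly_Mod"
begin

section \<open>Walsh functions\<close>

definition digit :: "nat \<Rightarrow> nat \<Rightarrow> nat \<Rightarrow> nat" where
  "digit b k i = k div b ^ i mod b"

definition digit_support :: "nat \<Rightarrow> nat \<Rightarrow> nat set" where
  "digit_support b k = {i. digit b k i \<noteq> 0}"

text \<open>The list below is $a_1 > a_2 > \dots > a_{\#k}$; \<open>take\<close> stops at $\min(\#k,\alpha)$.\<close>

definition leading_positions :: "nat \<Rightarrow> nat \<Rightarrow> nat list" where
  "leading_positions b k = rev (sorted_list_of_set (digit_support b k))"

definition r_walsh :: "nat \<Rightarrow> nat \<Rightarrow> nat \<Rightarrow> real" where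
  "r_walsh b \<alpha> k = 1 / real b ^ (\<Sum>a\<leftarrow>take \<alpha> (leading_positions b k). a + 1)"

text \<open>\<open>real_digit b x i\<close> is $\xi_i$ for $i \ge 1$; taking floors yields the expansion whose digits
  are not eventually all $b-1$.\<close>

definition real_digit :: "nat \<Rightarrow> real \<Rightarrow> nat \<Rightarrow> nat" where
  "real_digit b x i = nat (\<lfloor>x * real b ^ i\<rfloor> mod int b)"

definition wal :: "nat \<Rightarrow> nat \<Rightarrow> real \<Rightarrow> complex" where
  "wal b k x =
     exp (2 * of_real pi * \<i> * of_nat (\<Sum>i\<in>digit_support b k. real_digit b x (i + 1) * digit b k i)
          / of_nat b)"

definition omega :: "nat \<Rightarrow> nat \<Rightarrow> real \<Rightarrow> complex" where
  "omega b \<alpha> x = (\<Sum>k. of_real (r_walsh b \<alpha> (Suc k)) * wal b (Suc k) x)"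

text \<open>Vectors of dimension \<open>d\<close> are extensional functions on \<open>{1..d}\<close>.\<close>

definition unit_cube :: "nat \<Rightarrow> (nat \<Rightarrow> real) set" where
  "unit_cube d = {1..d} \<rightarrow>\<^sub>E {0..<1}"

definition freqs :: "nat \<Rightarrow> (nat \<Rightarrow> nat) set" where
  "freqs d = {1..d} \<rightarrow>\<^sub>E UNIV"

definition wal_vec :: "nat \<Rightarrow> nat \<Rightarrow> (nat \<Rightarrow> nat) \<Rightarrow> (nat \<Rightarrow> real) \<Rightarrow> complex" where
  "wal_vec b d k x = (\<Prod>j\<in>{1..d}. wal b (k j) (x j))"

definition r_vec :: "nat \<Rightarrow> nat \<Rightarrow> (nat \<Rightarrow> real) \<Rightarrow> nat \<Rightarrow> (nat \<Rightarrow> nat) \<Rightarrow> real" where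
  "r_vec b \<alpha> \<gamma> d k = (\<Prod>j\<in>{j\<in>{1..d}. k j \<noteq> 0}. \<gamma> j * r_walsh b \<alpha> (k j))"


section \<open>Polynomials over the field with \<open>b\<close> elements\<close>

text \<open>As \<open>b\<close> is a variable, polynomials over $\mathbb{F}_b = \{0,\dots,b-1\}$ are integer polynomials
  with coefficients in that range, calculated with modulo \<open>b\<close> (locale \<open>poly_mod\<close>).\<close>

definition Fpolys :: "nat \<Rightarrow> int poly set" where
  "Fpolys b = {v. \<forall>i. coeff v i \<in> {0..<int b}}"

definition search_set :: "nat \<Rightarrow> nat \<Rightarrow> int poly set" where
  "search_set b n = {v \<in> Fpolys b. v \<noteq> 0 \<and> degree v < n}"

definition poly_of_nat :: "nat \<Rightarrow> nat \<Rightarrow> int poly" where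
  "poly_of_nat b h = (\<Sum>i\<in>digit_support b h. monom (int (digit b h i)) i)"

definition nat_of_poly :: "nat \<Rightarrow> int poly \<Rightarrow> nat" where
  "nat_of_poly b v = nat (poly v (int b))"

definition residue :: "nat \<Rightarrow> int poly \<Rightarrow> int poly \<Rightarrow> int poly" where
  "residue b p f =
     (THE r. r \<in> Fpolys b \<and> degree r < degree p \<and> poly_mod.dvdm (int b) p (f - r))"

text \<open>$\mathbb{F}_b[X]/p$ under multiplication, on representatives of minimal degree
  (for \<open>p\<close> of positive degree); its group of units is $(\mathbb{F}_b[X]/p)^\times$.\<close>

definition quotient_monoid :: "nat \<Rightarrow> int poly \<Rightarrow> int poly monoid" where
  "quotient_monoid b p =
     \<lparr>carrier = {u \<in> Fpolys b. degree u < degree p},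
      monoid.mult = (\<lambda>u v. residue b p (u * v)),
      one = 1\<rparr>"

definition unit_group_generator :: "nat \<Rightarrow> int poly \<Rightarrow> int poly \<Rightarrow> bool" where
  "unit_group_generator b p g \<longleftrightarrow>
     g \<in> Fpolys b \<and>
     residue b p g \<in> carrier (units_of (quotient_monoid b p)) \<and>
     generate (units_of (quotient_monoid b p)) {residue b p g}
       = carrier (units_of (quotient_monoid b p))"

text \<open>A formal Laurent series $\sum_{i \ge \ell} w_i X^{-i}$ is the function $i \mapsto w_i$,
  zero below $\ell$. The expansion of $f/p$ is the series \<open>w\<close> with $p\,w = f$; the congruence
  compares the coefficients of $X^{-j}$.\<close>

definition laurent_quotient :: "nat \<Rightarrow> int poly \<Rightarrow> int poly \<Rightarrow> int \<Rightarrow> int" where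
  "laurent_quotient b f p =
     (THE w. (\<forall>i. w i \<in> {0..<int b}) \<and>
             (\<exists>l. \<forall>i<l. w i = 0) \<and>
             (\<forall>j. [(\<Sum>k\<le>degree p. coeff p k * w (int k + j))
                    = (if j \<le> 0 then coeff f (nat (- j)) else 0)] (mod int b)))"

text \<open>The lower limit $\max(\ell,1)$ may be replaced by 1, since $w_i = 0$ for $i < \ell$.\<close>

definition v_trunc :: "nat \<Rightarrow> nat \<Rightarrow> (int \<Rightarrow> int) \<Rightarrow> real" where
  "v_trunc b n w = (\<Sum>i=1..n. real_of_int (w (int i)) / real b ^ i)"


section \<open>Polynomial lattice rules and their worst-case error\<close>

definition lattice_node ::
  "nat \<Rightarrow> nat \<Rightarrow> nat \<Rightarrow> (nat \<Rightarrow> int poly) \<Rightarrow> int poly \<Rightarrow> nat \<Rightarrow> (nat \<Rightarrow> real)" where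
  "lattice_node b n d q p h =
     (\<lambda>j\<in>{1..d}. v_trunc b n (laurent_quotient b (poly_of_nat b h * q j) p))"

definition walsh_unit_ball ::
  "nat \<Rightarrow> nat \<Rightarrow> (nat \<Rightarrow> real) \<Rightarrow> nat \<Rightarrow> ((nat \<Rightarrow> real) \<Rightarrow> complex) set" where
  "walsh_unit_ball b \<alpha> \<gamma> d =
     {f. \<exists>c. (\<lambda>k. norm (c k)) summable_on freqs d \<and>
             (\<forall>x\<in>unit_cube d. ((\<lambda>k. c k * wal_vec b d k x) has_sum f x) (freqs d)) \<and>
             (\<forall>k\<in>freqs d. norm (c k) / r_vec b \<alpha> \<gamma> d k \<le> 1)}"

definition worst_case_error ::
  "nat \<Rightarrow> nat \<Rightarrow> nat \<Rightarrow> nat \<Rightarrow> (nat \<Rightarrow> real) \<Rightarrow> nat \<Rightarrow> (nat \<Rightarrow> int poly) \<Rightarrow> int poly \<Rightarrow> real" where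
  "worst_case_error b \<alpha> n m \<gamma> d q p =
     (SUP f\<in>walsh_unit_ball b \<alpha> \<gamma> d.
        norm (set_lebesgue_integral (\<Pi>\<^sub>M j\<in>{1..d}. lborel) (unit_cube d) f
              - (1 / of_nat (b ^ m)) * (\<Sum>h<b ^ m. f (lattice_node b n d q p h))))"

definition cbc_vector ::
  "nat \<Rightarrow> nat \<Rightarrow> nat \<Rightarrow> nat \<Rightarrow> (nat \<Rightarrow> real) \<Rightarrow> nat \<Rightarrow> int poly \<Rightarrow> (nat \<Rightarrow> int poly) \<Rightarrow> bool" where
  "cbc_vector b \<alpha> n m \<gamma> s p q \<longleftrightarrow>
     (\<forall>d\<in>{1..s}. q d \<in> search_set b n \<and>
        (\<forall>v\<in>search_set b n.
           worst_case_error b \<alpha> n m \<gamma> d q p \<le> worst_case_error b \<alpha> n m \<gamma> d (q(d := v)) p))"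


section \<open>The cost model\<close>

text \<open>
  Programs are terms of a deterministic imperative language with arrays of natural numbers and
  arrays of complex numbers; a scalar variable is entry 0 of an array. The parameters of the
  machine are

  \<^item> \<open>cells\<close>: the cells of working storage that may be read or written, so that its cardinality
    bounds the memory;
  \<^item> \<open>word\<close>: the largest natural number that may occur in a calculation, so that unit cost integer
    operations cannot exploit numbers of unbounded length;
  \<^item> the three subroutines charged separately, \<open>mulgen\<close> (multiplication by $g$ modulo $p$),
    \<open>veval\<close> ($w \mapsto b^n v_n(w/p)$) and \<open>omegaeval\<close> ($v \mapsto \omega_\alpha(v/b^n)$), all on
    arguments below \<open>npoly\<close> ($= b^n$), with their costs;
  \<^item> \<open>weights\<close>: the read-only input weights with indices \<open>1\<close> to \<open>nweights\<close>.

  A program that violates one of these restrictions, or divides by zero, is stuck. The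
  output is a write-only list. Numbers enter a program only as natural constants, input parameters,
  weights, values of \<open>omegaeval\<close> and roots of unity, so a program cannot hide precomputed data in
  real constants.
\<close>

datatype cell = ICell string nat | CCell string nat

record machine =
  cells :: "cell set"
  word :: nat
  npoly :: nat
  mulgen :: "nat \<Rightarrow> nat"
  veval :: "nat \<Rightarrow> nat"
  omegaeval :: "nat \<Rightarrow> complex"
  mulgen_cost :: nat
  veval_cost :: nat
  omegaeval_cost :: nat
  nweights :: nat
  weights :: "nat \<Rightarrow> real"

record store =
  ints :: "string \<Rightarrow> nat \<Rightarrow> nat"
  nums :: "string \<Rightarrow> nat \<Rightarrow> complex"
  out :: "nat list"

datatype iexp =
    IConst nat
  | IGet string iexp
  | IAdd iexp iexp
  | ISub iexp iexp
  | IMul iexp iexp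
  | IDiv iexp iexp
  | IMod iexp iexp
  | MulGen iexp
  | VEval iexp

primrec ival :: "machine \<Rightarrow> store \<Rightarrow> iexp \<Rightarrow> nat" where
  "ival M \<sigma> (IConst k) = k"
| "ival M \<sigma> (IGet a e) = ints \<sigma> a (ival M \<sigma> e)"
| "ival M \<sigma> (IAdd e f) = ival M \<sigma> e + ival M \<sigma> f"
| "ival M \<sigma> (ISub e f) = ival M \<sigma> e - ival M \<sigma> f"
| "ival M \<sigma> (IMul e f) = ival M \<sigma> e * ival M \<sigma> f"
| "ival M \<sigma> (IDiv e f) = ival M \<sigma> e div ival M \<sigma> f"
| "ival M \<sigma> (IMod e f) = ival M \<sigma> e mod ival M \<sigma> f"
| "ival M \<sigma> (MulGen e) = mulgen M (ival M \<sigma> e)"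
| "ival M \<sigma> (VEval e) = veval M (ival M \<sigma> e)"

primrec isafe :: "machine \<Rightarrow> store \<Rightarrow> iexp \<Rightarrow> bool" where
  "isafe M \<sigma> (IConst k) \<longleftrightarrow> k \<le> word M"
| "isafe M \<sigma> (IGet a e) \<longleftrightarrow> isafe M \<sigma> e \<and> ICell a (ival M \<sigma> e) \<in> cells M"
| "isafe M \<sigma> (IAdd e f) \<longleftrightarrow> isafe M \<sigma> e \<and> isafe M \<sigma> f \<and> ival M \<sigma> (IAdd e f) \<le> word M"
| "isafe M \<sigma> (ISub e f) \<longleftrightarrow> isafe M \<sigma> e \<and> isafe M \<sigma> f"
| "isafe M \<sigma> (IMul e f) \<longleftrightarrow> isafe M \<sigma> e \<and> isafe M \<sigma> f \<and> ival M \<sigma> (IMul e f) \<le> word M"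
| "isafe M \<sigma> (IDiv e f) \<longleftrightarrow> isafe M \<sigma> e \<and> isafe M \<sigma> f \<and> ival M \<sigma> f \<noteq> 0"
| "isafe M \<sigma> (IMod e f) \<longleftrightarrow> isafe M \<sigma> e \<and> isafe M \<sigma> f \<and> ival M \<sigma> f \<noteq> 0"
| "isafe M \<sigma> (MulGen e) \<longleftrightarrow>
     isafe M \<sigma> e \<and> ival M \<sigma> e < npoly M \<and> ival M \<sigma> (MulGen e) \<le> word M"
| "isafe M \<sigma> (VEval e) \<longleftrightarrow>
     isafe M \<sigma> e \<and> ival M \<sigma> e < npoly M \<and> ival M \<sigma> (VEval e) \<le> word M"

primrec icost :: "machine \<Rightarrow> iexp \<Rightarrow> nat" where
  "icost M (IConst k) = 1"
| "icost M (IGet a e) = icost M e + 1"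
| "icost M (IAdd e f) = icost M e + icost M f + 1"
| "icost M (ISub e f) = icost M e + icost M f + 1"
| "icost M (IMul e f) = icost M e + icost M f + 1"
| "icost M (IDiv e f) = icost M e + icost M f + 1"
| "icost M (IMod e f) = icost M e + icost M f + 1"
| "icost M (MulGen e) = icost M e + mulgen_cost M"
| "icost M (VEval e) = icost M e + veval_cost M"

datatype cexp =
    OfInt iexp
  | RootOfUnity iexp
  | CGet string iexp
  | CAdd cexp cexp
  | CSub cexp cexp
  | CMul cexp cexp
  | CDiv cexp cexp
  | Weight iexp
  | OmegaEval iexp

primrec cval :: "machine \<Rightarrow> store \<Rightarrow> cexp \<Rightarrow> complex" where
  "cval M \<sigma> (OfInt e) = of_nat (ival M \<sigma> e)"
| "cval M \<sigma> (RootOfUnity e) = exp (2 * of_real pi * \<i> / of_nat (ival M \<sigma> e))"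
| "cval M \<sigma> (CGet a e) = nums \<sigma> a (ival M \<sigma> e)"
| "cval M \<sigma> (CAdd e f) = cval M \<sigma> e + cval M \<sigma> f"
| "cval M \<sigma> (CSub e f) = cval M \<sigma> e - cval M \<sigma> f"
| "cval M \<sigma> (CMul e f) = cval M \<sigma> e * cval M \<sigma> f"
| "cval M \<sigma> (CDiv e f) = cval M \<sigma> e / cval M \<sigma> f"
| "cval M \<sigma> (Weight e) = of_real (weights M (ival M \<sigma> e))"
| "cval M \<sigma> (OmegaEval e) = omegaeval M (ival M \<sigma> e)"

primrec csafe :: "machine \<Rightarrow> store \<Rightarrow> cexp \<Rightarrow> bool" where
  "csafe M \<sigma> (OfInt e) \<longleftrightarrow> isafe M \<sigma> e"
| "csafe M \<sigma> (RootOfUnity e) \<longleftrightarrow> isafe M \<sigma> e \<and> ival M \<sigma> e \<noteq> 0"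
| "csafe M \<sigma> (CGet a e) \<longleftrightarrow> isafe M \<sigma> e \<and> CCell a (ival M \<sigma> e) \<in> cells M"
| "csafe M \<sigma> (CAdd e f) \<longleftrightarrow> csafe M \<sigma> e \<and> csafe M \<sigma> f"
| "csafe M \<sigma> (CSub e f) \<longleftrightarrow> csafe M \<sigma> e \<and> csafe M \<sigma> f"
| "csafe M \<sigma> (CMul e f) \<longleftrightarrow> csafe M \<sigma> e \<and> csafe M \<sigma> f"
| "csafe M \<sigma> (CDiv e f) \<longleftrightarrow> csafe M \<sigma> e \<and> csafe M \<sigma> f \<and> cval M \<sigma> f \<noteq> 0"
| "csafe M \<sigma> (Weight e) \<longleftrightarrow> isafe M \<sigma> e \<and> ival M \<sigma> e \<in> {1..nweights M}"
| "csafe M \<sigma> (OmegaEval e) \<longleftrightarrow> isafe M \<sigma> e \<and> ival M \<sigma> e < npoly M"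

primrec ccost :: "machine \<Rightarrow> cexp \<Rightarrow> nat" where
  "ccost M (OfInt e) = icost M e + 1"
| "ccost M (RootOfUnity e) = icost M e + 1"
| "ccost M (CGet a e) = icost M e + 1"
| "ccost M (CAdd e f) = ccost M e + ccost M f + 1"
| "ccost M (CSub e f) = ccost M e + ccost M f + 1"
| "ccost M (CMul e f) = ccost M e + ccost M f + 1"
| "ccost M (CDiv e f) = ccost M e + ccost M f + 1"
| "ccost M (Weight e) = icost M e + 1"
| "ccost M (OmegaEval e) = icost M e + omegaeval_cost M"

text \<open>Complex numbers are compared by their real parts.\<close>

datatype test = ILess iexp iexp | IEq iexp iexp | CLess cexp cexp

primrec tval :: "machine \<Rightarrow> store \<Rightarrow> test \<Rightarrow> bool" where
  "tval M \<sigma> (ILess e f) \<longleftrightarrow> ival M \<sigma> e < ival M \<sigma> f"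
| "tval M \<sigma> (IEq e f) \<longleftrightarrow> ival M \<sigma> e = ival M \<sigma> f"
| "tval M \<sigma> (CLess e f) \<longleftrightarrow> Re (cval M \<sigma> e) < Re (cval M \<sigma> f)"

primrec tsafe :: "machine \<Rightarrow> store \<Rightarrow> test \<Rightarrow> bool" where
  "tsafe M \<sigma> (ILess e f) \<longleftrightarrow> isafe M \<sigma> e \<and> isafe M \<sigma> f"
| "tsafe M \<sigma> (IEq e f) \<longleftrightarrow> isafe M \<sigma> e \<and> isafe M \<sigma> f"
| "tsafe M \<sigma> (CLess e f) \<longleftrightarrow> csafe M \<sigma> e \<and> csafe M \<sigma> f"

primrec tcost :: "machine \<Rightarrow> test \<Rightarrow> nat" where
  "tcost M (ILess e f) = icost M e + icost M f + 1"
| "tcost M (IEq e f) = icost M e + icost M f + 1"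
| "tcost M (CLess e f) = ccost M e + ccost M f + 1"

datatype com =
    Skip
  | ISet string iexp iexp
  | CSet string iexp cexp
  | Emit iexp
  | Seq com com
  | Cond test com com
  | While test com

text \<open>\<open>exec M c \<sigma> t \<tau>\<close>: started in \<open>\<sigma>\<close>, the program \<open>c\<close> terminates in \<open>\<tau>\<close> at total cost \<open>t\<close>.\<close>

inductive exec :: "machine \<Rightarrow> com \<Rightarrow> store \<Rightarrow> nat \<Rightarrow> store \<Rightarrow> bool" for M where
  Skip: "exec M Skip \<sigma> 0 \<sigma>"
| ISet: "\<lbrakk>isafe M \<sigma> i; isafe M \<sigma> e; ICell a (ival M \<sigma> i) \<in> cells M\<rbrakk> \<Longrightarrow>
    exec M (ISet a i e) \<sigma> (icost M i + icost M e + 1)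
      (\<sigma>\<lparr>ints := (ints \<sigma>)(a := (ints \<sigma> a)(ival M \<sigma> i := ival M \<sigma> e))\<rparr>)"
| CSet: "\<lbrakk>isafe M \<sigma> i; csafe M \<sigma> e; CCell a (ival M \<sigma> i) \<in> cells M\<rbrakk> \<Longrightarrow>
    exec M (CSet a i e) \<sigma> (icost M i + ccost M e + 1)
      (\<sigma>\<lparr>nums := (nums \<sigma>)(a := (nums \<sigma> a)(ival M \<sigma> i := cval M \<sigma> e))\<rparr>)"
| Emit: "isafe M \<sigma> e \<Longrightarrow>
    exec M (Emit e) \<sigma> (icost M e + 1) (\<sigma>\<lparr>out := out \<sigma> @ [ival M \<sigma> e]\<rparr>)"
| Seq: "\<lbrakk>exec M c \<sigma> t \<sigma>'; exec M c' \<sigma>' t' \<sigma>''\<rbrakk> \<Longrightarrow> exec M (Seq c c') \<sigma> (t + t') \<sigma>''"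
| CondTrue: "\<lbrakk>tsafe M \<sigma> B; tval M \<sigma> B; exec M c \<sigma> t \<sigma>'\<rbrakk> \<Longrightarrow>
    exec M (Cond B c c') \<sigma> (tcost M B + t) \<sigma>'"
| CondFalse: "\<lbrakk>tsafe M \<sigma> B; \<not> tval M \<sigma> B; exec M c' \<sigma> t \<sigma>'\<rbrakk> \<Longrightarrow>
    exec M (Cond B c c') \<sigma> (tcost M B + t) \<sigma>'"
| WhileTrue: "\<lbrakk>tsafe M \<sigma> B; tval M \<sigma> B; exec M c \<sigma> t \<sigma>'; exec M (While B c) \<sigma>' t' \<sigma>''\<rbrakk> \<Longrightarrow>
    exec M (While B c) \<sigma> (tcost M B + t + t') \<sigma>''"
| WhileFalse: "\<lbrakk>tsafe M \<sigma> B; \<not> tval M \<sigma> B\<rbrakk> \<Longrightarrow> exec M (While B c) \<sigma> (tcost M B) \<sigma>"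

inductive_cases exec_SkipE: "exec M Skip \<sigma> t \<tau>"
inductive_cases exec_ISetE: "exec M (ISet a i e) \<sigma> t \<tau>"
inductive_cases exec_CSetE: "exec M (CSet a i e) \<sigma> t \<tau>"
inductive_cases exec_EmitE: "exec M (Emit e) \<sigma> t \<tau>"
inductive_cases exec_SeqE: "exec M (Seq c c') \<sigma> t \<tau>"
inductive_cases exec_CondE: "exec M (Cond B c c') \<sigma> t \<tau>"
inductive_cases exec_WhileE: "exec M (While B c) \<sigma> t \<tau>"

lemma exec_deterministic:
  "exec M c \<sigma> t \<tau> \<Longrightarrow> exec M c \<sigma> t' \<tau>' \<Longrightarrow> t' = t \<and> \<tau>' = \<tau>"
proof (induction arbitrary: t' \<tau>' rule: exec.induct)
  case (Skip \<sigma>)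
  then show ?case by (auto elim: exec_SkipE)
next
  case (ISet \<sigma> i e a)
  from ISet.prems show ?case by (rule exec_ISetE) auto
next
  case (CSet \<sigma> i e a)
  from CSet.prems show ?case by (rule exec_CSetE) auto
next
  case (Emit \<sigma> e)
  from Emit.prems show ?case by (rule exec_EmitE) auto
next
  case (Seq c \<sigma> t \<sigma>' c' u \<sigma>'')
  from Seq.prems show ?case by (rule exec_SeqE) (use Seq.IH in blast)
next
  case (CondTrue \<sigma> B c t \<sigma>' c')
  from CondTrue.prems show ?case by (rule exec_CondE) (use CondTrue in blast)+
next
  case (CondFalse \<sigma> B c' t \<sigma>' c)
  from CondFalse.prems show ?case by (rule exec_CondE) (use CondFalse in blast)+
next
  case (WhileTrue \<sigma> B c t \<sigma>' u \<sigma>'')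
  from WhileTrue.prems show ?case by (rule exec_WhileE) (use WhileTrue in blast)+
next
  case (WhileFalse \<sigma> B c)
  from WhileFalse.prems show ?case by (rule exec_WhileE) (use WhileFalse in blast)+
qed

text \<open>The machine for the component-by-component construction. Polynomials of degree less than
  \<open>n\<close> are encoded by the number whose base \<open>b\<close> digits are the coefficients.\<close>

definition cbc_machine ::
  "nat \<Rightarrow> nat \<Rightarrow> nat \<Rightarrow> nat \<Rightarrow> (nat \<Rightarrow> real) \<Rightarrow> int poly \<Rightarrow> int poly \<Rightarrow>
   nat \<Rightarrow> nat \<Rightarrow> nat \<Rightarrow> nat \<Rightarrow> cell set \<Rightarrow> machine" where
  "cbc_machine b \<alpha> n s \<gamma> p g c\<^sub>\<omega> c\<^sub>g c\<^sub>v W A =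
     \<lparr>cells = A,
      word = W,
      npoly = b ^ n,
      mulgen = (\<lambda>w. nat_of_poly b (residue b p (g * poly_of_nat b w))),
      veval = (\<lambda>w. nat \<lfloor>real (b ^ n) * v_trunc b n (laurent_quotient b (poly_of_nat b w) p)\<rfloor>),
      omegaeval = (\<lambda>v. omega b \<alpha> (real v / real (b ^ n))),
      mulgen_cost = c\<^sub>g,
      veval_cost = c\<^sub>v,
      omegaeval_cost = c\<^sub>\<omega>,
      nweights = s,
      weights = \<gamma>\<rparr>"

text \<open>The parameters are passed in scalar variables; all other cells hold 0.\<close>

definition initial_store :: "nat \<Rightarrow> nat \<Rightarrow> nat \<Rightarrow> nat \<Rightarrow> store" where
  "initial_store b \<alpha> s m =
     \<lparr>ints = (\<lambda>_ _. 0)(''b'' := (\<lambda>_. 0)(0 := b), ''alpha'' := (\<lambda>_. 0)(0 := \<alpha>),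
                       ''s'' := (\<lambda>_. 0)(0 := s), ''m'' := (\<lambda>_. 0)(0 := m)),
      nums = (\<lambda>_ _. 0),
      out = []\<rparr>"

end

theory Submission
  imports Defs "HOL-Algebra.FiniteProduct"
begin

text \<open>
  For a polynomial lattice rule the average of a Walsh function over the nodes is 0 or 1, since the
  nodes form a group under digitwise addition. Hence the worst case is attained by the function whose
  Walsh coefficients are as large as possible, and the worst-case error equals
  $-1 + b^{-m} \sum_h \prod_j (1 + \gamma_j \omega_\alpha(x_{h,j}))$. Given the first $d-1$ components,
  choosing $q_d$ therefore amounts to minimizing
  $\sum_{h \neq 0} P(h)\, \omega_\alpha(v_n(h q/p))$, where $P(h)$ is the product over the previous
  components. Writing the nonzero residues as powers of the generator, $h = g^a$ and $q = g^z$, turns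
  this into a cyclic correlation of length $b^n - 1$ in $a$ and $z$, which is evaluated for all $z$
  by fast Fourier transforms whose length is a power of two below $4 b^n$. Between two
  components only the table of $P(g^a)$ has to be updated.
\<close>

section \<open>Total correctness with cost\<close>

text \<open>The program has to be one term, with one constant, for all parameters. It therefore
  computes all sizes and tables itself, and every array index and every integer needs a bound in
  terms of b^n and s. Only the b^m polynomials h of degree below m index nodes, whereas the
  correlation runs over all b^n - 1 powers of g; P is set to 0 at the remaining powers. The
  polynomial 0 is no power of g, but the node h = 0 contributes the same amount for every candidate.
  Since b^n - 1 need not have small prime factors, the correlation is not transformed at its own
  length: the kernel is repeated periodically and P is padded with zeros, which keeps the result
  exact. As the weights are positive, the error is an increasing affine function of the real part of
  the correlation, so comparing real parts finds the minimum. The charged subroutines are called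
  only while the powers of g are tabulated, so their costs carry no factor s.\<close>

definition run :: "machine \<Rightarrow> com \<Rightarrow> store \<Rightarrow> (nat \<Rightarrow> store \<Rightarrow> bool) \<Rightarrow> bool" where
  "run M c \<sigma> Q \<longleftrightarrow> (\<exists>t \<tau>. exec M c \<sigma> t \<tau> \<and> Q t \<tau>)"

lemma runI: "exec M c \<sigma> t \<tau> \<Longrightarrow> Q t \<tau> \<Longrightarrow> run M c \<sigma> Q"
  unfolding run_def by blast

text \<open>\<open>run\<close> is a weakest precondition in which the cost is the first argument of
  the postcondition. The rules for simple commands are equivalences, so the simplifier evaluates
  straight-line code together with its cost.\<close>

lemma run_Skip [simp]: "run M Skip \<sigma> Q \<longleftrightarrow> Q 0 \<sigma>"
  unfolding run_def by (auto elim: exec_SkipE intro: exec.Skip)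

lemma run_ISet [simp]: "run M (ISet a i e) \<sigma> Q \<longleftrightarrow>
    isafe M \<sigma> i \<and> isafe M \<sigma> e \<and> ICell a (ival M \<sigma> i) \<in> cells M \<and>
    Q (icost M i + icost M e + 1)
      (\<sigma>\<lparr>ints := (ints \<sigma>)(a := (ints \<sigma> a)(ival M \<sigma> i := ival M \<sigma> e))\<rparr>)" (is "?L \<longleftrightarrow> ?R")
proof
  assume ?L then show ?R unfolding run_def by (auto elim!: exec_ISetE)
next
  assume ?R then show ?L by (intro runI[OF exec.ISet]) simp_all
qed

lemma run_CSet [simp]: "run M (CSet a i e) \<sigma> Q \<longleftrightarrow>
    isafe M \<sigma> i \<and> csafe M \<sigma> e \<and> CCell a (ival M \<sigma> i) \<in> cells M \<and>
    Q (icost M i + ccost M e + 1)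
      (\<sigma>\<lparr>nums := (nums \<sigma>)(a := (nums \<sigma> a)(ival M \<sigma> i := cval M \<sigma> e))\<rparr>)" (is "?L \<longleftrightarrow> ?R")
proof
  assume ?L then show ?R unfolding run_def by (auto elim!: exec_CSetE)
next
  assume ?R then show ?L by (intro runI[OF exec.CSet]) simp_all
qed

lemma run_Emit [simp]: "run M (Emit e) \<sigma> Q \<longleftrightarrow>
    isafe M \<sigma> e \<and> Q (icost M e + 1) (\<sigma>\<lparr>out := out \<sigma> @ [ival M \<sigma> e]\<rparr>)" (is "?L \<longleftrightarrow> ?R")
proof
  assume ?L then show ?R unfolding run_def by (auto elim!: exec_EmitE)
next
  assume ?R then show ?L by (intro runI[OF exec.Emit]) simp_all
qed

lemma run_Seq: "run M (Seq c c') \<sigma> Q \<longleftrightarrow> run M c \<sigma> (\<lambda>t \<tau>. run M c' \<tau> (\<lambda>t'. Q (t + t')))"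
  unfolding run_def by (auto elim!: exec_SeqE intro: exec.Seq)

lemma run_Cond: "run M (Cond B c c') \<sigma> Q \<longleftrightarrow>
    tsafe M \<sigma> B \<and> run M (if tval M \<sigma> B then c else c') \<sigma> (\<lambda>t. Q (tcost M B + t))"
  unfolding run_def by (auto elim!: exec_CondE intro: exec.CondTrue exec.CondFalse)

lemma run_mono: "run M c \<sigma> Q \<Longrightarrow> (\<And>t \<tau>. Q t \<tau> \<Longrightarrow> R t \<tau>) \<Longrightarrow> run M c \<sigma> R"
  unfolding run_def by blast

lemma run_SeqI:
  assumes "run M c \<sigma> Q" "\<And>t \<tau>. Q t \<tau> \<Longrightarrow> run M c' \<tau> (\<lambda>t'. R (t + t'))"
  shows "run M (Seq c c') \<sigma> R"
  unfolding run_Seq using run_mono[OF assms] .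

text \<open>The number \<open>K\<close> of rounds is fixed in advance and the invariant carries the
  round number, so termination and cost come from one downward induction on \<open>k\<close>. The
  extra \<open>tcost M B\<close> pays for the failing last test.\<close>

lemma run_While:
  assumes init: "I 0 \<sigma>"
    and body: "\<And>k \<tau>. k < K \<Longrightarrow> I k \<tau> \<Longrightarrow>
      tsafe M \<tau> B \<and> tval M \<tau> B \<and> run M c \<tau> (\<lambda>t \<tau>'. t \<le> ct \<and> I (Suc k) \<tau>')"
    and final: "\<And>\<tau>. I K \<tau> \<Longrightarrow> tsafe M \<tau> B \<and> \<not> tval M \<tau> B"
  shows "run M (While B c) \<sigma> (\<lambda>t \<tau>. t \<le> K * (ct + tcost M B) + tcost M B \<and> I K \<tau>)"
proof -
  have "run M (While B c) \<tau> (\<lambda>t \<tau>. t \<le> (K - k) * (ct + tcost M B) + tcost M B \<and> I K \<tau>)"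
    if "k \<le> K" "I k \<tau>" for k \<tau>
    using that
  proof (induction k arbitrary: \<tau> rule: inc_induct)
    case base
    then show ?case using final[of \<tau>] unfolding run_def by (auto intro!: exI exec.WhileFalse)
  next
    case (step k)
    from body[OF step.hyps(2) step.prems]
    obtain t \<tau>' where 1: "tsafe M \<tau> B" "tval M \<tau> B" "exec M c \<tau> t \<tau>'" "t \<le> ct" "I (Suc k) \<tau>'"
      unfolding run_def by blast
    from step.IH[OF 1(5)] obtain t' \<tau>'' where 2: "exec M (While B c) \<tau>' t' \<tau>''" "I K \<tau>''"
      "t' \<le> (K - Suc k) * (ct + tcost M B) + tcost M B"
      unfolding run_def by blast
    have "K - k = Suc (K - Suc k)" using step.hyps by simp
    then have "tcost M B + t + t' \<le> (K - k) * (ct + tcost M B) + tcost M B"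
      using 1(4) 2(3) by simp
    then show ?case using exec.WhileTrue[OF 1(1-3) 2(1)] 2(2) unfolding run_def by blast
  qed
  from this[of 0] init show ?thesis by simp
qed

section \<open>Counting loops and array-filling loops\<close>

abbreviation ivar :: "string \<Rightarrow> iexp" where
  "ivar x \<equiv> IGet x (IConst 0)"

definition for_loop :: "string \<Rightarrow> iexp \<Rightarrow> com \<Rightarrow> com" where
  "for_loop i e c = Seq (ISet i (IConst 0) (IConst 0))
     (While (ILess (ivar i) e) (Seq c (ISet i (IConst 0) (IAdd (ivar i) (IConst 1)))))"

abbreviation set_ivar :: "string \<Rightarrow> nat \<Rightarrow> store \<Rightarrow> store" where
  "set_ivar x v \<sigma> \<equiv> \<sigma>\<lparr>ints := (ints \<sigma>)(x := (ints \<sigma> x)(0 := v))\<rparr>"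

text \<open>The bound \<open>e\<close> is evaluated before each round and once more at the end,
  hence \<open>guard\<close> also for \<open>k = K\<close>. Besides \<open>e\<close>, a round pays 3
  for the test and 6 for the increment; the 6 outside the product is 3 for the initial assignment
  and 3 for the last test.\<close>

lemma run_for_loop:
  assumes init: "I 0 (set_ivar i 0 \<sigma>)"
    and guard: "\<And>k \<tau>. k \<le> K \<Longrightarrow> I k \<tau> \<Longrightarrow> ints \<tau> i 0 = k \<and> isafe M \<tau> e \<and> ival M \<tau> e = K"
    and body: "\<And>k \<tau>. k < K \<Longrightarrow> I k \<tau> \<Longrightarrow>
      run M c \<tau> (\<lambda>t \<tau>'. t \<le> ct \<and> ints \<tau>' i 0 = k \<and> I (Suc k) (set_ivar i (Suc k) \<tau>'))"
    and cell: "ICell i 0 \<in> cells M" and word: "K \<le> word M" "0 < word M"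
  shows "run M (for_loop i e c) \<sigma> (\<lambda>t \<tau>. t \<le> K * (ct + icost M e + 9) + icost M e + 6 \<and> I K \<tau>)"
proof -
  let ?B = "ILess (ivar i) e" and ?c = "Seq c (ISet i (IConst 0) (IAdd (ivar i) (IConst 1)))"
  have "run M (While ?B ?c) (set_ivar i 0 \<sigma>)
      (\<lambda>t \<tau>. t \<le> K * ((ct + 6) + tcost M ?B) + tcost M ?B \<and> I K \<tau>)"
  proof (rule run_While[where I = I])
    fix k \<tau> assume k: "k < K" "I k \<tau>"
    have "run M ?c \<tau> (\<lambda>t \<tau>'. t \<le> ct + 6 \<and> I (Suc k) \<tau>')"
      by (rule run_SeqI[OF body[OF k]]) (use k cell word in auto)
    then show "tsafe M \<tau> ?B \<and> tval M \<tau> ?B \<and> run M ?c \<tau> (\<lambda>t \<tau>'. t \<le> ct + 6 \<and> I (Suc k) \<tau>')"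
      using guard[of k \<tau>] k cell by auto
  qed (use init guard[of K] cell in auto)
  then show ?thesis
    unfolding for_loop_def run_Seq using cell by (auto elim!: run_mono simp: algebra_simps)
qed

definition map_loop :: "string \<Rightarrow> iexp \<Rightarrow> cexp \<Rightarrow> com" where
  "map_loop A e x = for_loop ''i'' e (CSet A (ivar ''i'') x)"

definition map_store :: "string \<Rightarrow> (nat \<Rightarrow> complex) \<Rightarrow> nat \<Rightarrow> store \<Rightarrow> store" where
  "map_store A f k \<sigma> = \<sigma>\<lparr>ints := (ints \<sigma>)(''i'' := (ints \<sigma> ''i'')(0 := k)),
      nums := (nums \<sigma>)(A := (\<lambda>j. if j < k then f j else nums \<sigma> A j))\<rparr>"

lemma map_store_simps [simp]:
  "ints (map_store A f k \<sigma>) = (ints \<sigma>)(''i'' := (ints \<sigma> ''i'')(0 := k))"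
  "nums (map_store A f k \<sigma>) = (nums \<sigma>)(A := (\<lambda>j. if j < k then f j else nums \<sigma> A j))"
  "out (map_store A f k \<sigma>) = out \<sigma>"
  by (simp_all add: map_store_def)

text \<open>Fixing the intermediate store exactly, with entries below \<open>k\<close> new and the
  others old, lets \<open>x\<close> read the array \<open>A\<close> that is being written. In-place
  updates and the recurrence for the roots of unity rely on this. The 12 adds the 3 of the
  assignment to the 9 of the loop.\<close>

lemma run_map_loop:
  assumes guard: "\<And>k. k \<le> K \<Longrightarrow> isafe M (map_store A f k \<sigma>) e \<and> ival M (map_store A f k \<sigma>) e = K"
    and x: "\<And>k. k < K \<Longrightarrow> csafe M (map_store A f k \<sigma>) x \<and> cval M (map_store A f k \<sigma>) x = f k"
    and cells: "ICell ''i'' 0 \<in> cells M" "\<And>k. k < K \<Longrightarrow> CCell A k \<in> cells M"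
    and word: "K \<le> word M" "0 < word M"
  shows "run M (map_loop A e x) \<sigma>
    (\<lambda>t \<tau>. t \<le> K * (ccost M x + icost M e + 12) + icost M e + 6 \<and> \<tau> = map_store A f K \<sigma>)"
proof -
  have "run M (map_loop A e x) \<sigma>
    (\<lambda>t \<tau>. t \<le> K * ((ccost M x + 3) + icost M e + 9) + icost M e + 6 \<and> \<tau> = map_store A f K \<sigma>)"
    unfolding map_loop_def
  proof (rule run_for_loop[where I = "\<lambda>k \<tau>. \<tau> = map_store A f k \<sigma>"])
    fix k \<tau> assume k: "k < K" "\<tau> = map_store A f k \<sigma>"
    show "run M (CSet A (ivar ''i'') x) \<tau> (\<lambda>t \<tau>'. t \<le> ccost M x + 3 \<and> ints \<tau>' ''i'' 0 = k \<and>
        set_ivar ''i'' (Suc k) \<tau>' = map_store A f (Suc k) \<sigma>)"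
      using x[OF k(1)] k cells word by (auto simp: map_store_def less_Suc_eq fun_eq_iff)
  qed (use guard cells word in \<open>auto simp: map_store_def\<close>)
  then show ?thesis by (simp add: numeral_eq_Suc)
qed

section \<open>The fast Fourier transform\<close>

definition zeta :: "nat \<Rightarrow> complex" where
  "zeta n = exp (2 * of_real pi * \<i> / of_nat n)"

lemma zeta_power: "zeta n ^ j = exp (2 * of_real pi * \<i> * of_nat j / of_nat n)"
  unfolding zeta_def exp_of_nat_mult[symmetric] by (simp add: mult_ac)

lemma zeta_power_eq_1_iff: "n > 0 \<Longrightarrow> zeta n ^ j = 1 \<longleftrightarrow> n dvd j"
  unfolding zeta_power using complex_root_unity_eq_1[of n j] by simp

lemma zeta_nonzero [simp]: "zeta n \<noteq> 0"
  by (simp add: zeta_def)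

lemma norm_zeta [simp]: "norm (zeta n) = 1"
proof -
  have "zeta n = cis (2 * pi / real n)" unfolding zeta_def cis_conv_exp by (simp add: mult_ac)
  then show ?thesis by simp
qed

lemma zeta_power_cong: "n > 0 \<Longrightarrow> [i = j] (mod n) \<Longrightarrow> zeta n ^ i = zeta n ^ j"
  unfolding zeta_power cong_def using complex_root_unity_eq[of n i j] by simp

lemma sum_zeta_power:
  assumes "n > 0"
  shows "(\<Sum>c<n. zeta n ^ (c * j)) = (if n dvd j then of_nat n else 0)"
proof -
  have *: "(\<Sum>c<n. zeta n ^ (c * j)) = (\<Sum>c<n. (zeta n ^ j) ^ c)"
    by (simp add: power_mult[symmetric] mult.commute)
  show ?thesis
  proof (cases "n dvd j")
    case False
    then have "zeta n ^ j \<noteq> 1" using assms by (simp add: zeta_power_eq_1_iff)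
    moreover have "(zeta n ^ j) ^ n = 1"
      using assms by (simp add: zeta_power_eq_1_iff power_mult[symmetric])
    ultimately show ?thesis using False unfolding * by (simp add: geometric_sum)
  next
    case True
    then have "zeta n ^ j = 1" using assms by (simp add: zeta_power_eq_1_iff)
    then show ?thesis using True unfolding * by simp
  qed
qed

definition dft :: "nat \<Rightarrow> (nat \<Rightarrow> complex) \<Rightarrow> nat \<Rightarrow> complex" where
  "dft L x k = (\<Sum>i<L. x i * zeta L ^ (i * k))"

text \<open>Stockham's scheme, which needs no bit reversal: with $r = 1, 2, 4, \dots$, entry $q + r p$ for
  $q < r$ is the value at $q$ of the transform of length $r$ of the entries $p, p + L/r, p + 2L/r, \dots$\<close>

definition fft_stage :: "nat \<Rightarrow> nat \<Rightarrow> (nat \<Rightarrow> complex) \<Rightarrow> nat \<Rightarrow> complex" where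
  "fft_stage L r x k =
     (\<Sum>u<r. x (k div r + (L div r) * u) * zeta L ^ ((L div r) * u * (k mod r)))"

lemma fft_stage_1: "fft_stage L 1 x k = x k"
  by (simp add: fft_stage_def)

lemma fft_stage_last: "k < L \<Longrightarrow> fft_stage L L x k = dft L x k"
  by (simp add: fft_stage_def dft_def)

lemma sum_even_odd:
  fixes f :: "nat \<Rightarrow> 'a::comm_monoid_add"
  shows "(\<Sum>u<2 * r. f u) = (\<Sum>v<r. f (2 * v) + f (2 * v + 1))"
  by (induction r) (simp_all add: add.assoc)

text \<open>Radix-2 butterfly: with p = k div 2r, even and odd \<open>u\<close> in the sum of length
  2r give the sums of length r that start at p and p + m. The odd half carries the twiddle factor
  zeta^(m q), where q = k mod 2r.\<close>

lemma fft_stage_step: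
  assumes L: "L = 2 * r * m" and r: "r > 0" and k: "k < L"
  defines "j \<equiv> k mod r + r * (k div (2 * r))"
  shows "fft_stage L (2 * r) x k =
    fft_stage L r x j + zeta L ^ ((L div (2 * r)) * (k mod (2 * r))) * fft_stage L r x (j + L div 2)"
proof -
  define p q where "p = k div (2 * r)" and "q = k mod (2 * r)"
  have L0: "L > 0" using k by simp
  have div1: "L div (2 * r) = m" "L div r = 2 * m" "L div 2 = r * m"
    using L r by (simp_all add: mult.assoc mult.left_commute)
  have qr: "q mod r = k mod r" unfolding q_def by (simp add: mod_mod_cancel)
  have j: "j = q mod r + r * p" by (simp add: j_def p_def qr)
  have jd: "j div r = p" "j mod r = q mod r" using r by (simp_all add: j)
  \<comment> \<open>Here L/2 = r m, so adding L/2 to the position moves the starting index from p to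
    p + m and keeps the frequency.\<close>
  have "j + L div 2 = q mod r + r * (p + m)" by (simp add: j div1 algebra_simps)
  then have jd': "(j + L div 2) div r = p + m" "(j + L div 2) mod r = q mod r"
    using r by simp_all
  \<comment> \<open>The frequency matters only modulo r here, because zeta^(2m) has order r.\<close>
  have z: "zeta L ^ (2 * m * v * (q mod r)) = zeta L ^ (2 * m * v * q)" for v
  proof (rule zeta_power_cong[OF L0])
    have "2 * m * v * q = 2 * m * v * (q mod r) + L * (v * (q div r))"
      unfolding L using mult_div_mod_eq[of r q]
      by (metis (no_types, lifting) ab_semigroup_mult_class.mult_ac(1) add.commute distrib_left mult.left_commute)
    then show "[2 * m * v * (q mod r) = 2 * m * v * q] (mod L)" by (simp add: cong_def)
  qed
  have "fft_stage L (2 * r) x k = (\<Sum>u<2*r. x (p + m * u) * zeta L ^ (m * u * q))"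
    by (simp add: fft_stage_def div1 p_def q_def)
  also have "\<dots> = (\<Sum>v<r. x (p + 2 * m * v) * zeta L ^ (2 * m * v * q)
      + zeta L ^ (m * q) * (x (p + m + 2 * m * v) * zeta L ^ (2 * m * v * q)))"
    unfolding sum_even_odd
    by (intro sum.cong refl) (simp add: algebra_simps power_add)
  also have "\<dots> = fft_stage L r x j + zeta L ^ (m * q) * fft_stage L r x (j + L div 2)"
    unfolding fft_stage_def jd jd' by (simp add: div1 z sum.distrib sum_distrib_left)
  finally show ?thesis by (simp add: div1 q_def)
qed

text \<open>Reading \<open>f\<close> backwards turns the convolution into a correlation, and lets a second forward
  transform take the place of the inverse one, up to the factor \<open>L\<close>. As $a + z < L$, extending \<open>f\<close>
  periodically to length \<open>L\<close> causes no wrap-around error.\<close>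

lemma dft_correlation:
  assumes M: "M > 0" "2 * M \<le> L" and z: "z < M"
    and x: "\<And>a. M \<le> a \<Longrightarrow> a < L \<Longrightarrow> x a = 0"
  shows "dft L (\<lambda>k. dft L x k * dft L (\<lambda>i. f ((L - i) mod L mod M)) k) z =
    of_nat L * (\<Sum>a<M. x a * f ((a + z) mod M))"
proof -
  define y where "y = (\<lambda>i. f ((L - i) mod L mod M))"
  have L0: "L > 0" using M by simp
  have inner: "(\<Sum>i<L. y i * (\<Sum>k<L. zeta L ^ (k * (a + i + z)))) = of_nat L * f ((a + z) mod M)"
    if a: "a < M" for a
  proof -
    let ?i = "(L - (a + z)) mod L"
    have az: "a + z < L" using a z M by simp
    \<comment> \<open>The sum lies below 2L, so L divides it only if it is 0 or L; the outer
      \<open>mod L\<close> in \<open>?i\<close> covers the first case.\<close>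
    have uniq: "L dvd a + i + z \<longleftrightarrow> i = ?i" if i: "i < L" for i
    proof (cases "a + z = 0")
      case True
      then show ?thesis using i by (auto simp: dvd_imp_le intro: ccontr)
    next
      case False
      have "i = L - (a + z)" if dvd: "L dvd a + i + z"
      proof -
        obtain c where c: "a + i + z = L * c" using dvd by (elim dvdE)
        have "L * c < L * 2" "0 < L * c" using c i az False by linarith+
        then have "c = 1" by (simp; linarith?)
        then show ?thesis using c by simp
      qed
      then show ?thesis using False az by (auto simp: mod_less)
    qed
    have "(\<Sum>i<L. y i * (\<Sum>k<L. zeta L ^ (k * (a + i + z)))) = (\<Sum>i<L. if i = ?i then y i * of_nat L else 0)"
      unfolding sum_zeta_power[OF L0] by (intro sum.cong refl) (use uniq in auto)
    also have "\<dots> = y ?i * of_nat L" using L0 by simp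
    also have "y ?i = f ((a + z) mod M)"
    proof -
      have "(L - ?i) mod L = a + z" using az L0 by (cases "a + z = 0") (auto simp: mod_less)
      then show ?thesis by (simp add: y_def)
    qed
    finally show ?thesis by simp
  qed
  have "dft L (\<lambda>k. dft L x k * dft L y k) z =
      (\<Sum>k<L. \<Sum>a<L. \<Sum>i<L. x a * (y i * zeta L ^ (k * (a + i + z))))"
    unfolding dft_def sum_product unfolding sum_distrib_right
    by (intro sum.cong refl) (simp add: algebra_simps power_add)
  also have "\<dots> = (\<Sum>a<L. x a * (\<Sum>i<L. y i * (\<Sum>k<L. zeta L ^ (k * (a + i + z)))))"
    unfolding sum_distrib_left
    by (subst sum.swap) (rule sum.cong[OF refl], rule sum.swap)
  also have "\<dots> = (\<Sum>a<M. x a * (\<Sum>i<L. y i * (\<Sum>k<L. zeta L ^ (k * (a + i + z)))))"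
    by (rule sum.mono_neutral_right) (use x M in auto)
  also have "\<dots> = (\<Sum>a<M. x a * (of_nat L * f ((a + z) mod M)))"
    by (intro sum.cong refl) (use inner in auto)
  finally show ?thesis by (simp add: y_def sum_distrib_left mult_ac)
qed

definition power_prog :: "string \<Rightarrow> iexp \<Rightarrow> com" where
  "power_prog r e = Seq (ISet r (IConst 0) (IConst 1))
     (for_loop ''i'' e (ISet r (IConst 0) (IMul (ivar r) (ivar ''b''))))"

text \<open>\<open>h\<close> holds the current r. A stage reads positions scattered over the array,
  so its result goes to \<open>Z\<close> and is copied back.\<close>

definition fft_prog :: "string \<Rightarrow> com" where
  "fft_prog X = Seq (ISet ''h'' (IConst 0) (IConst 1))
     (While (ILess (ivar ''h'') (ivar ''L''))
       (let h2 = IMul (IConst 2) (ivar ''h'');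
            j = IAdd (IMod (ivar ''i'') (ivar ''h'')) (IMul (ivar ''h'') (IDiv (ivar ''i'') h2))
        in Seq (map_loop ''Z'' (ivar ''L'')
             (CAdd (CGet X j)
               (CMul (CGet ''w'' (IMul (IDiv (ivar ''L'') h2) (IMod (ivar ''i'') h2)))
                 (CGet X (IAdd j (IDiv (ivar ''L'') (IConst 2)))))))
          (Seq (map_loop X (ivar ''L'') (CGet ''Z'' (ivar ''i'')))
            (ISet ''h'' (IConst 0) h2))))"

section \<open>Working storage and size bounds\<close>

definition int_names :: "string set" where
  "int_names = {''b'', ''alpha'', ''s'', ''m'', ''B'', ''N'', ''M'', ''L'', ''i'', ''h'', ''d'', ''z'', ''E''}"

definition num_names :: "string set" where
  "num_names = {''w'', ''o'', ''P'', ''X'', ''Y'', ''Z''}"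

lemma int_names_iff [simp]: "a \<in> int_names \<longleftrightarrow> a = ''b'' \<or> a = ''alpha'' \<or> a = ''s'' \<or> a = ''m'' \<or>
    a = ''B'' \<or> a = ''N'' \<or> a = ''M'' \<or> a = ''L'' \<or> a = ''i'' \<or> a = ''h'' \<or> a = ''d'' \<or> a = ''z'' \<or> a = ''E''"
  unfolding int_names_def insert_iff empty_iff simp_thms ..

lemma num_names_iff [simp]: "a \<in> num_names \<longleftrightarrow>
    a = ''w'' \<or> a = ''o'' \<or> a = ''P'' \<or> a = ''X'' \<or> a = ''Y'' \<or> a = ''Z''"
  unfolding num_names_def insert_iff empty_iff simp_thms ..

text \<open>Every name gets 4B cells, scalars included, because the longest arrays have length L <
  4B.\<close>

definition working_cells :: "nat \<Rightarrow> cell set" where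
  "working_cells B = (\<lambda>(a, j). ICell a j) ` (int_names \<times> {..<4 * B})
     \<union> (\<lambda>(a, j). CCell a j) ` (num_names \<times> {..<4 * B})"

lemma ICell_working_cells [simp]: "ICell a j \<in> working_cells B \<longleftrightarrow> j < 4 * B \<and> a \<in> int_names"
  unfolding working_cells_def by (auto simp del: int_names_iff num_names_iff)

lemma CCell_working_cells [simp]: "CCell a j \<in> working_cells B \<longleftrightarrow> j < 4 * B \<and> a \<in> num_names"
  unfolding working_cells_def by (auto simp del: int_names_iff num_names_iff)

lemma finite_working_cells: "finite (working_cells B)"
  unfolding working_cells_def by (simp add: int_names_def num_names_def)

text \<open>The constant is 76 = (13 + 6) * 4, from thirteen integer and six complex arrays of 4B
  cells.\<close>

lemma card_working_cells: "card (working_cells B) \<le> 76 * B"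
proof -
  have fin: "finite int_names" "finite num_names" by (simp_all add: int_names_def num_names_def)
  have I: "card int_names \<le> 13" and C: "card num_names \<le> 6"
    unfolding int_names_def num_names_def by simp_all
  have "card (working_cells B) \<le> card (int_names \<times> {..<4 * B}) + card (num_names \<times> {..<4 * B})"
    unfolding working_cells_def using fin
    by (intro order.trans[OF card_Un_le] add_mono card_image_le finite_cartesian_product) simp_all
  also have "\<dots> \<le> 13 * (4 * B) + 6 * (4 * B)"
    unfolding card_cartesian_product card_lessThan by (intro add_mono mult_right_mono I C) simp_all
  finally show ?thesis by simp
qed

text \<open>The program is verified without polynomials: of the subroutines \<open>mulgen\<close>
  and \<open>veval\<close> it is only assumed that they map codes below B to codes below B. The link
  to polynomials is made later, by instantiating this locale.\<close>

locale cbc_run =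
  fixes M :: machine and b al s m B :: nat
  assumes b: "b \<ge> 2" and m: "m \<ge> 1" and al: "al \<ge> 2"
    and B_def: "B = b ^ (al * m)"
    and cells: "cells M = working_cells B"
    and word: "100 * (B + s) \<le> word M"
    and npoly: "npoly M = B"
    and mulgen: "\<And>w. w < B \<Longrightarrow> mulgen M w < B"
    and veval: "\<And>w. w < B \<Longrightarrow> veval M w < B"
    and nweights: "nweights M = s"
begin

lemma n_less_B: "al * m < B"
proof -
  have "al * m < 2 ^ (al * m)" by (rule less_exp)
  also have "\<dots> \<le> B" unfolding B_def using b by (simp add: power_mono)
  finally show ?thesis .
qed

lemma B_ge: "B \<ge> 4"
proof -
  have "2 * 1 \<le> al * m" using al m by (intro mult_le_mono)
  then have "(2::nat) ^ 2 \<le> 2 ^ (al * m)" by (intro power_increasing) simp_all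
  also have "\<dots> \<le> B" unfolding B_def using b by (simp add: power_mono)
  finally show ?thesis by simp
qed

lemma K_exists: "\<exists>K. 2 * B \<le> 2 ^ K \<and> 2 ^ K < 4 * B \<and> (\<forall>k<K. 2 ^ k < 2 * B)"
proof -
  define K where "K = (LEAST k. 2 * B \<le> 2 ^ k)"
  have ex: "2 * B \<le> 2 ^ (2 * B)" using less_exp[of "2 * B"] by simp
  have 1: "2 * B \<le> 2 ^ K" unfolding K_def by (rule LeastI) (rule ex)
  have 2: "2 ^ k < 2 * B" if "k < K" for k
    using not_less_Least[of k "\<lambda>k. 2 * B \<le> 2 ^ k"] that unfolding K_def by simp
  have "K \<noteq> 0" using 1 B_ge by (intro notI) simp
  then have "2 ^ K < 4 * B" using 2[of "K - 1"] by (cases K) auto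
  with 1 2 show ?thesis by blast
qed

text \<open>\<open>K\<close> counts the doublings that compute L; by its third property the loop
  test still succeeds before each of them.\<close>

definition K :: nat where "K = (SOME K. 2 * B \<le> 2 ^ K \<and> 2 ^ K < 4 * B \<and> (\<forall>k<K. 2 ^ k < 2 * B))"
definition L :: nat where "L = 2 ^ K"

lemma K_props: "2 * B \<le> L" "L < 4 * B" "\<And>k. k < K \<Longrightarrow> 2 ^ k < 2 * B"
  using someI_ex[OF K_exists] unfolding K_def[symmetric] L_def by auto

end

context cbc_run begin
text \<open>After \<open>k\<close> rounds \<open>h\<close> is 2^k and the array \<open>X\<close>
  holds the stage with r = 2^k; stage 1 is the input and stage L the transform. Each of the K rounds
  costs O(L). The frame clauses let the callers keep their tables.\<close>

lemma run_fft:
  assumes X: "X = ''X'' \<or> X = ''Y''" and L: "ints \<sigma> ''L'' 0 = L"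
    and w: "\<And>i. i < L \<Longrightarrow> nums \<sigma> ''w'' i = zeta L ^ i"
  shows "run M (fft_prog X) \<sigma> (\<lambda>t \<tau>. t \<le> K * (200 * L + 200) + 20 \<and>
    (\<forall>k<L. nums \<tau> X k = dft L (nums \<sigma> X) k) \<and>
    (\<forall>a. a \<noteq> ''i'' \<longrightarrow> a \<noteq> ''h'' \<longrightarrow> ints \<tau> a = ints \<sigma> a) \<and>
    (\<forall>a. a \<noteq> X \<longrightarrow> a \<noteq> ''Z'' \<longrightarrow> nums \<tau> a = nums \<sigma> a) \<and> out \<tau> = out \<sigma>)"
  (is "run M _ _ (\<lambda>t \<tau>. _ \<and> ?fin \<tau>)")
proof -
  define I where "I k \<tau> \<longleftrightarrow> ints \<tau> ''h'' 0 = 2 ^ k \<and> (\<forall>j<L. nums \<tau> X j = fft_stage L (2 ^ k) (nums \<sigma> X) j) \<and>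
    (\<forall>a. a \<noteq> ''i'' \<longrightarrow> a \<noteq> ''h'' \<longrightarrow> ints \<tau> a = ints \<sigma> a) \<and>
    (\<forall>a. a \<noteq> X \<longrightarrow> a \<noteq> ''Z'' \<longrightarrow> nums \<tau> a = nums \<sigma> a) \<and> out \<tau> = out \<sigma>" for k and \<tau> :: store
  let ?h2 = "IMul (IConst 2) (ivar ''h'')"
  let ?j = "IAdd (IMod (ivar ''i'') (ivar ''h'')) (IMul (ivar ''h'') (IDiv (ivar ''i'') ?h2))"
  let ?x = "CAdd (CGet X ?j)
               (CMul (CGet ''w'' (IMul (IDiv (ivar ''L'') ?h2) (IMod (ivar ''i'') ?h2)))
                 (CGet X (IAdd ?j (IDiv (ivar ''L'') (IConst 2)))))"
  have XZ: "X \<noteq> ''Z''" "X \<noteq> ''w''" "X = ''o'' \<or> X = ''P'' \<or> X = ''X'' \<or> X = ''Y''" and Xc: "CCell X j \<in> cells M \<longleftrightarrow> j < 4 * B" for j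
    using X cells by auto
  have L4: "L < 4 * B" "L < word M" and W: "100 \<le> word M" and B0: "B > 0"
    using K_props word B_ge by auto
  have step: "run M (Seq (map_loop ''Z'' (ivar ''L'') ?x)
          (Seq (map_loop X (ivar ''L'') (CGet ''Z'' (ivar ''i'')))
            (ISet ''h'' (IConst 0) ?h2))) \<tau> (\<lambda>t \<tau>'. t \<le> 200 * L + 100 \<and> I (Suc k) \<tau>')"
    if k: "k < K" and I: "I k \<tau>" for k \<tau>
  proof -
    \<comment> \<open>This is the factorization L = 2 r m that \<open>fft_stage_step\<close> asks
      for.\<close>
    define r mm where "r = (2::nat) ^ k" and "mm = (2::nat) ^ (K - Suc k)"
    have Lr: "L = 2 * r * mm"
      unfolding L_def r_def mm_def using k by (simp add: power_Suc[symmetric] power_add[symmetric] del: power_Suc)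
    have r0: "r > 0" "mm > 0" by (simp_all add: r_def mm_def)
    have h: "ints \<tau> ''h'' 0 = r" "ints \<tau> ''L'' 0 = L"
      using I L by (auto simp: I_def r_def)
    define j where "j i = i mod r + r * (i div (2 * r))" for i
    have div: "L div (2 * r) = mm" "L div 2 = r * mm" using Lr r0 by (simp_all add: mult_ac)
    \<comment> \<open>Both inputs of the butterfly, at j and at j + L/2, have to stay inside the
      array.\<close>
    have jb: "j i < L div 2" if "i < L" for i
    proof -
      have "i div (2 * r) < mm" using that Lr r0 by (simp add: less_mult_imp_div_less mult_ac)
      then have "r * (i div (2 * r)) + r \<le> r * mm"
        by (metis Suc_leI mult_Suc_right mult_le_mono2 add.commute)
      then show ?thesis unfolding j_def div using mod_less_divisor[OF r0(1), of i] by linarith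
    qed
    have jb2: "j i < L" "j i + L div 2 < L" if "i < L" for i using jb[OF that] by linarith+
    have jp: "r * (i div (2 * r)) \<le> j i" for i by (simp add: j_def)
    have e: "mm * (i mod (2 * r)) < L" for i
      using mult_strict_left_mono[OF mod_less_divisor[of "2 * r" i] r0(2)] r0 Lr by (simp add: mult_ac)
    have rL: "2 * r \<le> L" using Lr r0 by simp
    let ?f = "fft_stage L (2 * r) (nums \<sigma> X)"
    have x: "csafe M (map_store ''Z'' ?f i \<tau>) ?x \<and> cval M (map_store ''Z'' ?f i \<tau>) ?x = ?f i"
      if i: "i < L" for i
    proof -
      have "?f i = fft_stage L r (nums \<sigma> X) (j i) + zeta L ^ (mm * (i mod (2 * r))) *
          fft_stage L r (nums \<sigma> X) (j i + L div 2)"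
        using fft_stage_step[OF Lr r0(1) i] by (simp add: j_def div)
      moreover have "nums \<tau> X (j i) = fft_stage L r (nums \<sigma> X) (j i)"
        "nums \<tau> X (j i + L div 2) = fft_stage L r (nums \<sigma> X) (j i + L div 2)"
        using I jb2[OF i] by (auto simp: I_def r_def)
      moreover have "nums \<tau> ''w'' (mm * (i mod (2 * r))) = zeta L ^ (mm * (i mod (2 * r)))"
        using I e w XZ by (auto simp: I_def)
      moreover define \<rho> where "\<rho> = map_store ''Z'' ?f i \<tau>"
      have \<rho>: "ints \<rho> ''i'' 0 = i" "ints \<rho> ''h'' 0 = r" "ints \<rho> ''L'' 0 = L"
          "nums \<rho> X = nums \<tau> X" "nums \<rho> ''w'' = nums \<tau> ''w''"
        unfolding \<rho>_def using h XZ by simp_all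
      have var: "isafe M \<rho> (ivar v)" if "v \<in> {''i'', ''h'', ''L''}" for v
        using that B0 by (auto simp: cells)
      have h2: "isafe M \<rho> ?h2" "ival M \<rho> ?h2 = 2 * r"
        using var rL L4 W by (simp_all add: \<rho>)
      have ij: "ival M \<rho> ?j = j i" by (simp add: \<rho> j_def)
      have sj: "isafe M \<rho> ?j"
        using var h2 r0 jp[of i] jb2[OF i] L4 by (simp add: \<rho> j_def[symmetric])
      have sL: "isafe M \<rho> (IDiv (ivar ''L'') (IConst 2))" using var W by simp
      have "isafe M \<rho> (IMul (IDiv (ivar ''L'') ?h2) (IMod (ivar ''i'') ?h2))"
        using var h2 r0 e[of i] L4 by (simp add: \<rho> div(1))
      moreover have "isafe M \<rho> (IAdd ?j (IDiv (ivar ''L'') (IConst 2)))"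
        unfolding isafe.simps(3)[of _ _ ?j] using sj sL jb2[OF i] L4
        by (simp add: \<rho> j_def[symmetric] del: isafe.simps)
      ultimately show ?thesis
        unfolding \<rho>_def[symmetric]
        using sj e[of i] jb2[OF i] L4 XZ by (simp add: \<rho> div(1) j_def[symmetric] cells del: isafe.simps)
    qed
    let ?S = "map_store X ?f L (map_store ''Z'' ?f L \<tau>)"
    have fin: "I (Suc k) (?S\<lparr>ints := (ints ?S)(''h'' := (ints ?S ''h'')(0 := 2 * r))\<rparr>)"
      unfolding I_def using I by (simp add: I_def r_def)
    show ?thesis
      apply (rule run_SeqI[OF run_map_loop[where K = L and f = ?f]])
      subgoal using L4 B0 h by (simp add: cells)
      subgoal by (rule x)
      subgoal using B0 by (simp add: cells)
      subgoal using L4 by (simp add: cells)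
      subgoal using L4 by simp
      subgoal using W by simp
      subgoal for t1 \<tau>1
        apply (elim conjE, hypsubst)
        apply (rule run_SeqI[OF run_map_loop[where K = L and f = ?f]])
        subgoal using L4 B0 h by (simp add: cells)
        subgoal using L4 B0 h XZ by (simp add: cells)
        subgoal using B0 by (simp add: cells)
        subgoal using L4 Xc by simp
        subgoal using L4 by simp
        subgoal using W by simp
        subgoal for t2 \<tau>2
          apply (elim conjE, hypsubst)
          using L4 B0 h rL W fin by (simp add: cells)
        done
      done
  qed
  have "run M (While (ILess (ivar ''h'') (ivar ''L'')) (Seq (map_loop ''Z'' (ivar ''L'') ?x)
          (Seq (map_loop X (ivar ''L'') (CGet ''Z'' (ivar ''i'')))
            (ISet ''h'' (IConst 0) ?h2)))) (set_ivar ''h'' 1 \<sigma>)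
      (\<lambda>t \<tau>. t \<le> K * ((200 * L + 100) + tcost M (ILess (ivar ''h'') (ivar ''L''))) + tcost M (ILess (ivar ''h'') (ivar ''L'')) \<and> I K \<tau>)"
  proof (rule run_While[where I = I])
    show "I 0 (set_ivar ''h'' 1 \<sigma>)" by (simp add: I_def fft_stage_1[simplified])
  next
    fix k \<tau> assume k: "k < K" "I k \<tau>"
    have "(2::nat) ^ k < L" unfolding L_def using k by simp
    then show "tsafe M \<tau> (ILess (ivar ''h'') (ivar ''L'')) \<and> tval M \<tau> (ILess (ivar ''h'') (ivar ''L'')) \<and>
      run M (Seq (map_loop ''Z'' (ivar ''L'') ?x)
          (Seq (map_loop X (ivar ''L'') (CGet ''Z'' (ivar ''i'')))
            (ISet ''h'' (IConst 0) ?h2))) \<tau> (\<lambda>t \<tau>'. t \<le> 200 * L + 100 \<and> I (Suc k) \<tau>')"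
      using step[OF k] k L B0 by (simp add: I_def cells)
  next
    fix \<tau> assume "I K \<tau>"
    then show "tsafe M \<tau> (ILess (ivar ''h'') (ivar ''L'')) \<and> \<not> tval M \<tau> (ILess (ivar ''h'') (ivar ''L''))"
      using L B0 by (simp add: I_def cells L_def)
  qed
  then show ?thesis
    unfolding fft_prog_def Let_def run_Seq
    using B0 W
    apply (simp add: cells)
    apply (erule run_mono)
    apply (auto simp: I_def L_def[symmetric] fft_stage_last algebra_simps)
    done
qed

end

section \<open>The component-by-component program\<close>

definition dims_prog :: com where
  "dims_prog =
    Seq (power_prog ''B'' (IMul (ivar ''alpha'') (ivar ''m'')))
   (Seq (power_prog ''N'' (ivar ''m''))
   (Seq (ISet ''M'' (IConst 0) (ISub (ivar ''B'') (IConst 1)))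
   (Seq (ISet ''L'' (IConst 0) (IConst 1))
        (While (ILess (ivar ''L'') (IMul (IConst 2) (ivar ''B'')))
          (ISet ''L'' (IConst 0) (IMul (IConst 2) (ivar ''L'')))))))"

text \<open>The powers of g and the values of \<omega>_\<alpha> at their points come from one pass,
  which calls each charged subroutine B - 1 times.\<close>

definition orbit_prog :: com where
  "orbit_prog = Seq (ISet ''E'' (IConst 0) (IConst 1))
     (for_loop ''i'' (ivar ''M'')
       (Seq (ISet ''E'' (IAdd (ivar ''i'') (IConst 1)) (MulGen (IGet ''E'' (ivar ''i''))))
            (CSet ''o'' (ivar ''i'') (OmegaEval (VEval (IGet ''E'' (ivar ''i'')))))))"

text \<open>Cell $L - 1$ of \<open>w\<close> is preset to $\zeta^{-1}$, so that every power of $\zeta$ is obtained from its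
  cyclic predecessor. The initial entry of \<open>P\<close> is 1 or 0 by truncated subtraction, according to
  whether $g^a$ has degree less than $m$.\<close>

definition tables_prog :: com where
  "tables_prog =
    Seq (CSet ''w'' (ISub (ivar ''L'') (IConst 1)) (CDiv (OfInt (IConst 1)) (RootOfUnity (ivar ''L''))))
   (Seq (map_loop ''w'' (ivar ''L'')
          (CMul (CGet ''w'' (IMod (IAdd (ivar ''i'') (ISub (ivar ''L'') (IConst 1))) (ivar ''L'')))
                (RootOfUnity (ivar ''L''))))
   (Seq orbit_prog
   (Seq (map_loop ''P'' (ivar ''M'')
          (OfInt (ISub (IConst 1) (IDiv (IGet ''E'' (ivar ''i'')) (ivar ''N'')))))
   (Seq (map_loop ''Y'' (ivar ''L'')
          (CGet ''o'' (IMod (IMod (ISub (ivar ''L'') (ivar ''i'')) (ivar ''L'')) (ivar ''M''))))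
        (fft_prog ''Y'')))))"

definition argmin_prog :: com where
  "argmin_prog = Seq (ISet ''z'' (IConst 0) (IConst 0))
     (for_loop ''i'' (ivar ''M'')
       (Cond (CLess (CGet ''X'' (ivar ''i'')) (CGet ''X'' (ivar ''z'')))
         (ISet ''z'' (IConst 0) (ivar ''i'')) Skip))"

text \<open>Copying L entries of \<open>P\<close> pads with zeros, as \<open>P\<close> vanishes from
  B - 1 on. The factor L left by the second transform is positive and does not move the minimum. The
  last loop multiplies into \<open>P\<close> the factor of the component just emitted.\<close>

definition step_prog :: com where
  "step_prog =
    Seq (map_loop ''X'' (ivar ''L'') (CGet ''P'' (ivar ''i'')))
   (Seq (fft_prog ''X'')
   (Seq (map_loop ''X'' (ivar ''L'') (CMul (CGet ''X'' (ivar ''i'')) (CGet ''Y'' (ivar ''i''))))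
   (Seq (fft_prog ''X'')
   (Seq argmin_prog
   (Seq (Emit (IGet ''E'' (ivar ''z'')))
        (map_loop ''P'' (ivar ''M'')
          (CMul (CGet ''P'' (ivar ''i''))
            (CAdd (OfInt (IConst 1))
              (CMul (Weight (IAdd (ivar ''d'') (IConst 1)))
                (CGet ''o'' (IMod (IAdd (ivar ''i'') (ivar ''z'')) (ivar ''M''))))))))))))"

definition cbc_prog :: com where
  "cbc_prog = Seq dims_prog (Seq tables_prog (for_loop ''d'' (ivar ''s'') step_prog))"

section \<open>Verification of the program\<close>

context cbc_run
begin

abbreviation Mo :: nat where "Mo \<equiv> B - 1"

definition orbit :: "nat \<Rightarrow> nat" where
  "orbit a = (mulgen M ^^ a) 1"

text \<open>The kernel of the correlation: \<omega>_\<alpha> at the point belonging to the a-th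
  power of g.\<close>

definition om :: "nat \<Rightarrow> complex" where
  "om a = omegaeval M (veval M (orbit a))"

lemma orbit_less: "orbit a < B"
  unfolding orbit_def using B_ge by (induction a) (simp_all add: mulgen)

lemma bounds: "B \<ge> 4" "L < 4 * B" "2 * B \<le> L" "100 \<le> word M" "L + L < word M" "2 * B < word M"
  "s + 1 \<le> word M" "K < 4 * B" "K < word M"
proof -
  have "K < 2 ^ K" by (rule less_exp)
  then have "K < L" unfolding L_def .
  then show "B \<ge> 4" "L < 4 * B" "2 * B \<le> L" "100 \<le> word M" "L + L < word M" "2 * B < word M"
  "s + 1 \<le> word M" "K < 4 * B" "K < word M"
    using B_ge K_props word by auto
qed

lemma run_power:
  assumes b\<sigma>: "ints \<sigma> ''b'' 0 = b" and r: "r = ''B'' \<or> r = ''N''"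
    and e: "\<And>\<tau>. (\<And>a. a \<noteq> r \<Longrightarrow> a \<noteq> ''i'' \<Longrightarrow> ints \<tau> a = ints \<sigma> a) \<Longrightarrow> isafe M \<tau> e \<and> ival M \<tau> e = k"
    and k: "b ^ k \<le> B" "k < B"
  shows "run M (power_prog r e) \<sigma> (\<lambda>t \<tau>. t \<le> k * (icost M e + 20) + icost M e + 20 \<and> ints \<tau> r 0 = b ^ k \<and>
    (\<forall>a. a \<noteq> r \<longrightarrow> a \<noteq> ''i'' \<longrightarrow> ints \<tau> a = ints \<sigma> a) \<and> nums \<tau> = nums \<sigma> \<and> out \<tau> = out \<sigma>)"
proof -
  define I where "I j \<tau> \<longleftrightarrow> ints \<tau> ''i'' 0 = j \<and> ints \<tau> r 0 = b ^ j \<and>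
    (\<forall>a. a \<noteq> r \<longrightarrow> a \<noteq> ''i'' \<longrightarrow> ints \<tau> a = ints \<sigma> a) \<and> nums \<tau> = nums \<sigma> \<and> out \<tau> = out \<sigma>" for j and \<tau> :: store
  have ri: "r \<noteq> ''i''" "r \<noteq> ''b''" "ICell r 0 \<in> cells M" "ICell ''i'' 0 \<in> cells M" "ICell ''b'' 0 \<in> cells M"
    using r bounds(1) by (auto simp: cells)
  have e': "isafe M \<tau> e \<and> ival M \<tau> e = k" if "I j \<tau>" for j \<tau>
    by (rule e) (use that in \<open>simp add: I_def\<close>)
  have pow: "b ^ j * b \<le> B" if "j < k" for j
  proof -
    have "b ^ Suc j \<le> b ^ k" using that b by (intro power_increasing) auto
    then show ?thesis using k(1) by (simp add: mult.commute)
  qed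
  have "run M (for_loop ''i'' e (ISet r (IConst 0) (IMul (ivar r) (ivar ''b'')))) (set_ivar r 1 \<sigma>)
    (\<lambda>t \<tau>. t \<le> k * (7 + icost M e + 9) + icost M e + 6 \<and> I k \<tau>)"
  proof (rule run_for_loop[where I = I])
    fix j \<tau> assume j: "j < k" "I j \<tau>"
    show "run M (ISet r (IConst 0) (IMul (ivar r) (ivar ''b''))) \<tau>
      (\<lambda>t \<tau>'. t \<le> 7 \<and> ints \<tau>' ''i'' 0 = j \<and> I (Suc j) (set_ivar ''i'' (Suc j) \<tau>'))"
      using j(2) ri b\<sigma> pow[OF j(1)] bounds by (simp add: I_def)
  next
    show "I 0 (set_ivar ''i'' 0 (set_ivar r 1 \<sigma>))" using ri by (simp add: I_def)
  next
    fix j \<tau> assume "I j \<tau>"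
    then show "ints \<tau> ''i'' 0 = j \<and> isafe M \<tau> e \<and> ival M \<tau> e = k"
      using e' by (simp add: I_def)
  qed (use ri bounds k in simp_all)
  then show ?thesis
    unfolding power_prog_def run_Seq using ri bounds
    by (simp, elim run_mono) (simp add: I_def algebra_simps)
qed

text \<open>The loops make \<alpha> m, m and K rounds, each number below 4B, so crude bounds suffice
  for a linear cost.\<close>

lemma run_dims:
  assumes \<sigma>: "ints \<sigma> ''b'' 0 = b" "ints \<sigma> ''alpha'' 0 = al" "ints \<sigma> ''m'' 0 = m" "ints \<sigma> ''s'' 0 = s"
  shows "run M dims_prog \<sigma> (\<lambda>t \<tau>. t \<le> 200 * B \<and> ints \<tau> ''s'' 0 = s \<and>
    ints \<tau> ''N'' 0 = b ^ m \<and> ints \<tau> ''M'' 0 = Mo \<and> ints \<tau> ''L'' 0 = L \<and> nums \<tau> = nums \<sigma> \<and> out \<tau> = out \<sigma>)"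
proof -
  have alm: "al * m < B" by (rule n_less_B)
  have mm: "m \<le> al * m" using al by simp
  then have mB: "m < B" using alm by linarith
  have bm: "b ^ m \<le> B" unfolding B_def using mm b by (intro power_increasing) auto
  have alB: "al < B" using alm m by (metis le_trans not_less mult_le_mono2 mult.right_neutral)
  show ?thesis
    unfolding dims_prog_def
    apply (rule run_SeqI[OF run_power[where k = "al * m"]])
    subgoal by (rule \<sigma>)
    subgoal by simp
    subgoal for \<tau> using \<sigma> alm bounds by (simp add: cells)
    subgoal by (simp add: B_def)
    subgoal by (rule alm)
    subgoal for t1 \<tau>1
      apply (rule run_SeqI[OF run_power[where k = m]])
      subgoal using \<sigma> by simp
      subgoal by simp
      subgoal for \<tau> using \<sigma> alm bounds by (simp add: cells)
      subgoal by (rule bm)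
      subgoal by (rule mB)
      subgoal for t2 \<tau>2
      proof -
        assume 1: "t1 \<le> al * m * (icost M (IMul (ivar ''alpha'') (ivar ''m'')) + 20) + icost M (IMul (ivar ''alpha'') (ivar ''m'')) + 20 \<and>
          ints \<tau>1 ''B'' 0 = b ^ (al * m) \<and> (\<forall>a. a \<noteq> ''B'' \<longrightarrow> a \<noteq> ''i'' \<longrightarrow> ints \<tau>1 a = ints \<sigma> a) \<and> nums \<tau>1 = nums \<sigma> \<and> out \<tau>1 = out \<sigma>"
        assume 2: "t2 \<le> m * (icost M (ivar ''m'') + 20) + icost M (ivar ''m'') + 20 \<and> ints \<tau>2 ''N'' 0 = b ^ m \<and>
          (\<forall>a. a \<noteq> ''N'' \<longrightarrow> a \<noteq> ''i'' \<longrightarrow> ints \<tau>2 a = ints \<tau>1 a) \<and> nums \<tau>2 = nums \<tau>1 \<and> out \<tau>2 = out \<tau>1"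
        define I where "I j \<tau> \<longleftrightarrow> ints \<tau> ''L'' 0 = 2 ^ j \<and> ints \<tau> ''s'' 0 = s \<and> ints \<tau> ''B'' 0 = B \<and>
          ints \<tau> ''N'' 0 = b ^ m \<and> ints \<tau> ''M'' 0 = Mo \<and> nums \<tau> = nums \<sigma> \<and> out \<tau> = out \<sigma>" for j and \<tau> :: store
        let ?T = "ILess (ivar ''L'') (IMul (IConst 2) (ivar ''B''))"
        let ?\<tau> = "set_ivar ''L'' 1 (set_ivar ''M'' Mo \<tau>2)"
        have "run M (While ?T (ISet ''L'' (IConst 0) (IMul (IConst 2) (ivar ''L'')))) ?\<tau>
          (\<lambda>t \<tau>. t \<le> K * (6 + tcost M ?T) + tcost M ?T \<and> I K \<tau>)"
        proof (rule run_While[where I = I])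
          show "I 0 ?\<tau>" using 1 2 \<sigma> by (simp add: I_def B_def)
        next
          fix j \<tau> assume j: "j < K" "I j \<tau>"
          show "tsafe M \<tau> ?T \<and> tval M \<tau> ?T \<and>
            run M (ISet ''L'' (IConst 0) (IMul (IConst 2) (ivar ''L''))) \<tau> (\<lambda>t \<tau>'. t \<le> 6 \<and> I (Suc j) \<tau>')"
            using j(2) K_props(3)[OF j(1)] bounds by (simp add: I_def cells)
        next
          fix \<tau> assume "I K \<tau>"
          then show "tsafe M \<tau> ?T \<and> \<not> tval M \<tau> ?T"
            using bounds unfolding I_def L_def by (simp add: cells)
        qed
        moreover have "ints \<tau>2 ''B'' 0 = B" using 1 2 by (simp add: B_def)
        moreover have "t1 \<le> al * m * 25 + 25" "t2 \<le> m * 22 + 22" using 1 2 by simp_all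
        ultimately show ?thesis
          unfolding run_Seq using bounds alm mB
          by (simp add: cells, elim run_mono) (simp add: I_def L_def)
      qed
      done
    done
qed


lemma run_orbit:
  assumes \<sigma>: "ints \<sigma> ''M'' 0 = Mo"
  defines "c \<equiv> mulgen_cost M + veval_cost M + omegaeval_cost M"
  shows "run M orbit_prog \<sigma> (\<lambda>t \<tau>. t \<le> B * (c + 40) \<and>
    (\<forall>a<B. ints \<tau> ''E'' a = orbit a) \<and> (\<forall>a<Mo. nums \<tau> ''o'' a = om a) \<and>
    (\<forall>a. a \<noteq> ''E'' \<longrightarrow> a \<noteq> ''i'' \<longrightarrow> ints \<tau> a = ints \<sigma> a) \<and>
    (\<forall>a. a \<noteq> ''o'' \<longrightarrow> nums \<tau> a = nums \<sigma> a) \<and> out \<tau> = out \<sigma>)"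
proof -
  define I where "I k \<tau> \<longleftrightarrow> ints \<tau> ''i'' 0 = k \<and> (\<forall>a\<le>k. ints \<tau> ''E'' a = orbit a) \<and> (\<forall>a<k. nums \<tau> ''o'' a = om a) \<and>
    (\<forall>a. a \<noteq> ''E'' \<longrightarrow> a \<noteq> ''i'' \<longrightarrow> ints \<tau> a = ints \<sigma> a) \<and>
    (\<forall>a. a \<noteq> ''o'' \<longrightarrow> nums \<tau> a = nums \<sigma> a) \<and> out \<tau> = out \<sigma>" for k and \<tau> :: store
  let ?c = "Seq (ISet ''E'' (IAdd (ivar ''i'') (IConst 1)) (MulGen (IGet ''E'' (ivar ''i''))))
            (CSet ''o'' (ivar ''i'') (OmegaEval (VEval (IGet ''E'' (ivar ''i'')))))"
  have "run M (for_loop ''i'' (ivar ''M'') ?c) (set_ivar ''E'' 1 \<sigma>)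
    (\<lambda>t \<tau>. t \<le> Mo * ((c + 20) + icost M (ivar ''M'') + 9) + icost M (ivar ''M'') + 6 \<and> I Mo \<tau>)"
  proof (rule run_for_loop[where I = I])
    fix k \<tau> assume k: "k < Mo" "I k \<tau>"
    have o: "orbit k < B" "mulgen M (orbit k) < B" "veval M (orbit k) < B"
      using orbit_less mulgen veval by blast+
    have oS: "orbit (Suc k) = mulgen M (orbit k)" by (simp add: orbit_def)
    have kb: "Suc k \<le> word M" "k < 4 * B" "Suc k < 4 * B"
        "mulgen M (orbit k) \<le> word M" "veval M (orbit k) \<le> word M"
      using k(1) bounds o by linarith+
    show "run M ?c \<tau> (\<lambda>t \<tau>'. t \<le> c + 20 \<and> ints \<tau>' ''i'' 0 = k \<and> I (Suc k) (set_ivar ''i'' (Suc k) \<tau>'))"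
      unfolding run_Seq using k o kb oS bounds(4)
      by (simp add: I_def cells npoly c_def om_def le_Suc_eq less_Suc_eq)
  next
    show "I 0 (set_ivar ''i'' 0 (set_ivar ''E'' 1 \<sigma>))" by (simp add: I_def orbit_def)
  next
    fix k \<tau> assume "I k \<tau>"
    then show "ints \<tau> ''i'' 0 = k \<and> isafe M \<tau> (ivar ''M'') \<and> ival M \<tau> (ivar ''M'') = Mo"
      using \<sigma> bounds by (simp add: I_def cells)
  qed (use bounds in \<open>simp_all add: cells\<close>)
  moreover have "20 + (B - Suc 0) * (31 + c) \<le> B * (c + 40)"
  proof -
    have "20 + (B - Suc 0) * (31 + c) \<le> B * 9 + B * (31 + c)" using bounds(1) by (intro add_mono mult_right_mono) simp_all
    then show ?thesis by (simp add: algebra_simps)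
  qed
  ultimately show ?thesis
    unfolding orbit_prog_def run_Seq using bounds(1,4)
    by (simp add: cells, elim run_mono) (auto simp: I_def add.commute)
qed

definition start_prod :: "nat \<Rightarrow> complex" where
  "start_prod a = of_nat (1 - orbit a div b ^ m)"

text \<open>What has to survive from one component to the next. \<open>Y\<close> is kept in
  transformed form, and the zero tail of \<open>P\<close> is the padding.\<close>

definition env :: "store \<Rightarrow> bool" where
  "env \<sigma> \<longleftrightarrow> ints \<sigma> ''s'' 0 = s \<and> ints \<sigma> ''M'' 0 = Mo \<and> ints \<sigma> ''L'' 0 = L \<and>
    (\<forall>a<Mo. ints \<sigma> ''E'' a = orbit a) \<and> (\<forall>i<L. nums \<sigma> ''w'' i = zeta L ^ i) \<and>
    (\<forall>a<Mo. nums \<sigma> ''o'' a = om a) \<and>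
    (\<forall>k<L. nums \<sigma> ''Y'' k = dft L (\<lambda>i. om ((L - i) mod L mod Mo)) k) \<and>
    (\<forall>a\<ge>Mo. nums \<sigma> ''P'' a = 0)"

lemma dft_cong: "(\<And>i. i < n \<Longrightarrow> x i = y i) \<Longrightarrow> dft n x k = dft n y k"
  unfolding dft_def by (intro sum.cong) auto

lemma run_tables:
  assumes \<sigma>: "ints \<sigma> ''s'' 0 = s" "ints \<sigma> ''N'' 0 = b ^ m" "ints \<sigma> ''M'' 0 = Mo" "ints \<sigma> ''L'' 0 = L"
    "\<And>a. nums \<sigma> ''P'' a = 0"
  defines "c \<equiv> mulgen_cost M + veval_cost M + omegaeval_cost M"
  shows "run M tables_prog \<sigma> (\<lambda>t \<tau>. t \<le> B * c + 2000 * (K + 1) * B \<and> env \<tau> \<and>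
     (\<forall>a<Mo. nums \<tau> ''P'' a = start_prod a) \<and> out \<tau> = out \<sigma>)"
proof -
  have B0: "B > 0" and L0: "L > 0" using bounds by auto
  have LM: "L - Suc 0 \<le> word M" "L - Suc 0 < 4 * B" using bounds by linarith+
  define \<sigma>1 where "\<sigma>1 = \<sigma>\<lparr>nums := (nums \<sigma>)(''w'' := (nums \<sigma> ''w'')(L - 1 := 1 / zeta L))\<rparr>"
  let ?w = "CMul (CGet ''w'' (IMod (IAdd (ivar ''i'') (ISub (ivar ''L'') (IConst 1))) (ivar ''L'')))
                (RootOfUnity (ivar ''L''))"
  define \<sigma>2 where "\<sigma>2 = map_store ''w'' (\<lambda>i. zeta L ^ i) L \<sigma>1"
  have w: "csafe M (map_store ''w'' (\<lambda>i. zeta L ^ i) k \<sigma>1) ?w \<and>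
      cval M (map_store ''w'' (\<lambda>i. zeta L ^ i) k \<sigma>1) ?w = zeta L ^ k" if k: "k < L" for k
  \<comment> \<open>Entry 0 reads the preset last cell and becomes zeta^-1 * zeta = 1; every other
    entry reads the one written in the round before.\<close>
  proof (cases k)
    case 0
    then show ?thesis using \<sigma> bounds L0 LM
      by (simp add: cells \<sigma>1_def zeta_def[symmetric])
  next
    case (Suc k')
    have "(k + (L - 1)) mod L = k'"
    proof -
      have "k + (L - 1) = k' + L" using Suc L0 by simp
      then show ?thesis using Suc k by simp
    qed
    then show ?thesis using \<sigma> bounds L0 LM k Suc
      by (simp add: cells \<sigma>1_def zeta_def[symmetric])
  qed
  have r1: "run M (CSet ''w'' (ISub (ivar ''L'') (IConst 1)) (CDiv (OfInt (IConst 1)) (RootOfUnity (ivar ''L'')))) \<sigma>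
      (\<lambda>t \<tau>. t \<le> 20 \<and> \<tau> = \<sigma>1)"
    using \<sigma> bounds L0 LM by (simp add: cells \<sigma>1_def zeta_def[symmetric])
  have r2: "run M (map_loop ''w'' (ivar ''L'') ?w) \<sigma>1
      (\<lambda>t \<tau>. t \<le> L * (ccost M ?w + icost M (ivar ''L'') + 12) + icost M (ivar ''L'') + 6 \<and> \<tau> = \<sigma>2)"
    unfolding \<sigma>2_def
  proof (rule run_map_loop)
    fix k assume "k < L"
    then show "csafe M (map_store ''w'' (\<lambda>i. zeta L ^ i) k \<sigma>1) ?w \<and>
      cval M (map_store ''w'' (\<lambda>i. zeta L ^ i) k \<sigma>1) ?w = zeta L ^ k" by (rule w)
  qed (use \<sigma> bounds in \<open>simp_all add: cells \<sigma>1_def\<close>)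
  have \<sigma>2: "ints \<sigma>2 ''s'' 0 = s" "ints \<sigma>2 ''N'' 0 = b ^ m" "ints \<sigma>2 ''M'' 0 = Mo" "ints \<sigma>2 ''L'' 0 = L"
    "\<And>a. nums \<sigma>2 ''P'' a = 0" "\<And>i. i < L \<Longrightarrow> nums \<sigma>2 ''w'' i = zeta L ^ i" "out \<sigma>2 = out \<sigma>"
    using \<sigma> by (simp_all add: \<sigma>2_def \<sigma>1_def)
  have r3: "run M orbit_prog \<sigma>2 (\<lambda>t \<tau>. t \<le> B * (c + 40) \<and>
    ints \<tau> ''s'' 0 = s \<and> ints \<tau> ''N'' 0 = b ^ m \<and> ints \<tau> ''M'' 0 = Mo \<and> ints \<tau> ''L'' 0 = L \<and>
    (\<forall>a. nums \<tau> ''P'' a = 0) \<and> (\<forall>i<L. nums \<tau> ''w'' i = zeta L ^ i) \<and> out \<tau> = out \<sigma> \<and>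
    (\<forall>a<B. ints \<tau> ''E'' a = orbit a) \<and> (\<forall>a<Mo. nums \<tau> ''o'' a = om a))"
    using run_orbit[OF \<sigma>2(3)] by (rule run_mono) (simp add: \<sigma>2 c_def)
  let ?P = "OfInt (ISub (IConst 1) (IDiv (IGet ''E'' (ivar ''i'')) (ivar ''N'')))"
  let ?Y = "CGet ''o'' (IMod (IMod (ISub (ivar ''L'') (ivar ''i'')) (ivar ''L'')) (ivar ''M''))"
  have r46: "run M (Seq (map_loop ''P'' (ivar ''M'') ?P) (Seq (map_loop ''Y'' (ivar ''L'') ?Y) (fft_prog ''Y''))) \<tau>
     (\<lambda>t \<tau>'. t \<le> 40 * B + 40 * L + (K * (200 * L + 200) + 20) + 40 \<and> env \<tau>' \<and>
        (\<forall>a<Mo. nums \<tau>' ''P'' a = start_prod a) \<and> out \<tau>' = out \<sigma>)"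
    if \<tau>: "ints \<tau> ''s'' 0 = s" "ints \<tau> ''N'' 0 = b ^ m" "ints \<tau> ''M'' 0 = Mo" "ints \<tau> ''L'' 0 = L"
      "\<And>a. nums \<tau> ''P'' a = 0" "\<And>i. i < L \<Longrightarrow> nums \<tau> ''w'' i = zeta L ^ i" "out \<tau> = out \<sigma>"
      "\<And>a. a < B \<Longrightarrow> ints \<tau> ''E'' a = orbit a" "\<And>a. a < Mo \<Longrightarrow> nums \<tau> ''o'' a = om a" for \<tau>
  proof -
    define \<tau>1 where "\<tau>1 = map_store ''P'' start_prod Mo \<tau>"
    define y where "y = (\<lambda>i. om ((L - i) mod L mod Mo))"
    define \<tau>2 where "\<tau>2 = map_store ''Y'' y L \<tau>1"
    have q1: "run M (map_loop ''P'' (ivar ''M'') ?P) \<tau>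
        (\<lambda>t \<rho>. t \<le> Mo * (ccost M ?P + icost M (ivar ''M'') + 12) + icost M (ivar ''M'') + 6 \<and> \<rho> = \<tau>1)"
      unfolding \<tau>1_def
    proof (rule run_map_loop)
      fix k assume "k < Mo"
      then show "csafe M (map_store ''P'' start_prod k \<tau>) ?P \<and> cval M (map_store ''P'' start_prod k \<tau>) ?P = start_prod k"
        using \<tau> bounds b by (simp add: cells start_prod_def)
    qed (use \<tau> bounds in \<open>simp_all add: cells\<close>)
    have q2: "run M (map_loop ''Y'' (ivar ''L'') ?Y) \<tau>1
        (\<lambda>t \<rho>. t \<le> L * (ccost M ?Y + icost M (ivar ''L'') + 12) + icost M (ivar ''L'') + 6 \<and> \<rho> = \<tau>2)"
      unfolding \<tau>2_def
    proof (rule run_map_loop)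
      fix k assume k: "k < L"
      have "(L - k) mod L mod Mo < Mo" using bounds by simp
      moreover from this have "(L - k) mod L mod Mo < 4 * B" by linarith
      ultimately show "csafe M (map_store ''Y'' y k \<tau>1) ?Y \<and> cval M (map_store ''Y'' y k \<tau>1) ?Y = y k"
        using \<tau> bounds L0 k by (simp add: cells \<tau>1_def y_def)
    qed (use \<tau> bounds in \<open>simp_all add: cells \<tau>1_def\<close>)
    have \<tau>2: "ints \<tau>2 ''L'' 0 = L" "\<And>i. i < L \<Longrightarrow> nums \<tau>2 ''w'' i = zeta L ^ i"
      using \<tau> by (simp_all add: \<tau>2_def \<tau>1_def)
    have dy: "dft L (nums \<tau>2 ''Y'') k = dft L y k" for k
      by (rule dft_cong) (simp add: \<tau>2_def)
    show ?thesis
      apply (rule run_SeqI[OF q1])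
      apply (elim conjE, hypsubst)
      apply (rule run_SeqI[OF q2])
      apply (elim conjE, hypsubst)
      apply (rule run_mono[OF run_fft])
      subgoal by simp
      subgoal by (rule \<tau>2)
      subgoal by (rule \<tau>2)
      subgoal premises p for t1 \<rho>1 t2 \<rho>2 t3 \<tau>3
      proof -
        have Y: "\<forall>k<L. nums \<tau>3 ''Y'' k = dft L y k" using p dy by simp
        have f: "ints \<tau>3 a = ints \<tau>2 a" if "a \<noteq> ''i''" "a \<noteq> ''h''" for a using p that by blast
        have g: "nums \<tau>3 a = nums \<tau>2 a" if "a \<noteq> ''Y''" "a \<noteq> ''Z''" for a using p that by blast
        have "env \<tau>3"
          unfolding env_def using \<tau> Y by (simp add: f g) (simp add: \<tau>2_def \<tau>1_def y_def)
        moreover have "t1 + (t2 + t3) \<le> 40 * B + 40 * L + (K * (200 * L + 200) + 20) + 40"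
        proof -
          have "t1 \<le> Mo * 23 + 8" "t2 \<le> L * 26 + 8" "t3 \<le> K * (200 * L + 200) + 20" using p by simp_all
          then show ?thesis by linarith
        qed
        moreover have "out \<tau>3 = out \<sigma>" "\<forall>a<Mo. nums \<tau>3 ''P'' a = start_prod a"
          using p \<tau>(7) by (simp_all add: g) (simp_all add: \<tau>2_def \<tau>1_def)
        ultimately show ?thesis by blast
      qed
      done
  qed
  show ?thesis
    unfolding tables_prog_def
    apply (rule run_SeqI[OF r1])
    apply (elim conjE, hypsubst)
    apply (rule run_SeqI[OF r2])
    apply (elim conjE, hypsubst)
    apply (rule run_SeqI[OF r3])
    apply (elim conjE)
    apply (rule run_mono[OF r46])
    subgoal by assumption
    subgoal by assumption
    subgoal by assumption
    subgoal by assumption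
    subgoal by (erule spec)
    subgoal by blast
    subgoal by assumption
    subgoal by blast
    subgoal by blast
    subgoal premises p for t1 \<rho>1 t2 \<rho>2 t3 \<tau>3 t4 \<tau>4
    proof -
      \<comment> \<open>By L < 4B a round of 200 L + 200 steps is at most 1000 B.\<close>
      have "K * (200 * L + 200) \<le> K * (1000 * B)"
        using bounds by (intro mult_le_mono2) linarith
      then have "K * (200 * L + 200) \<le> 1000 * (K * B)" by simp
      moreover have "t1 \<le> 20" "t2 \<le> L * 29 + 8" "t3 \<le> B * c + B * 40"
        "t4 \<le> 40 * B + 40 * L + (K * (200 * L + 200) + 20) + 40"
        using p by (simp_all add: algebra_simps)
      moreover have "2000 * (K + 1) * B = 2000 * (K * B) + 2000 * B" by (simp add: algebra_simps)
      ultimately have "t1 + (t2 + (t3 + t4)) \<le> B * c + 2000 * (K + 1) * B"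
        using bounds(1,2) by linarith
      then show ?thesis using p by blast
    qed
    done
qed


lemma run_argmin:
  assumes \<sigma>: "ints \<sigma> ''M'' 0 = Mo"
  shows "run M argmin_prog \<sigma> (\<lambda>t \<tau>. t \<le> 40 * B \<and> ints \<tau> ''z'' 0 < Mo \<and>
    (\<forall>a<Mo. Re (nums \<sigma> ''X'' (ints \<tau> ''z'' 0)) \<le> Re (nums \<sigma> ''X'' a)) \<and>
    (\<forall>a. a \<noteq> ''z'' \<longrightarrow> a \<noteq> ''i'' \<longrightarrow> ints \<tau> a = ints \<sigma> a) \<and> nums \<tau> = nums \<sigma> \<and> out \<tau> = out \<sigma>)"
proof -
  define I where "I k \<tau> \<longleftrightarrow> ints \<tau> ''i'' 0 = k \<and> ints \<tau> ''z'' 0 < Mo \<and>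
    (\<forall>a<k. Re (nums \<sigma> ''X'' (ints \<tau> ''z'' 0)) \<le> Re (nums \<sigma> ''X'' a)) \<and>
    (\<forall>a. a \<noteq> ''z'' \<longrightarrow> a \<noteq> ''i'' \<longrightarrow> ints \<tau> a = ints \<sigma> a) \<and> nums \<tau> = nums \<sigma> \<and> out \<tau> = out \<sigma>" for k and \<tau> :: store
  let ?c = "Cond (CLess (CGet ''X'' (ivar ''i'')) (CGet ''X'' (ivar ''z''))) (ISet ''z'' (IConst 0) (ivar ''i'')) Skip"
  have "run M (for_loop ''i'' (ivar ''M'') ?c) (set_ivar ''z'' 0 \<sigma>)
    (\<lambda>t \<tau>. t \<le> Mo * (11 + icost M (ivar ''M'') + 9) + icost M (ivar ''M'') + 6 \<and> I Mo \<tau>)"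
  proof (rule run_for_loop[where I = I])
    show "I 0 (set_ivar ''i'' 0 (set_ivar ''z'' 0 \<sigma>))" using bounds by (simp add: I_def)
  next
    fix k \<tau> assume "I k \<tau>"
    then show "ints \<tau> ''i'' 0 = k \<and> isafe M \<tau> (ivar ''M'') \<and> ival M \<tau> (ivar ''M'') = Mo"
      using \<sigma> bounds by (simp add: I_def cells)
  next
    fix k \<tau> assume k: "k < Mo" "I k \<tau>"
    have kb: "k < 4 * B" "ints \<tau> ''z'' 0 < 4 * B" "B > 0" using k unfolding I_def by linarith+
    show "run M ?c \<tau> (\<lambda>t \<tau>'. t \<le> 11 \<and> ints \<tau>' ''i'' 0 = k \<and> I (Suc k) (set_ivar ''i'' (Suc k) \<tau>'))"
    proof (cases "Re (nums \<sigma> ''X'' k) < Re (nums \<sigma> ''X'' (ints \<tau> ''z'' 0))")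
      case True
      have "\<forall>a<Suc k. Re (nums \<sigma> ''X'' k) \<le> Re (nums \<sigma> ''X'' a)"
        using True k(2) unfolding I_def less_Suc_eq by (meson less_le_trans order.refl less_imp_le)
      then show ?thesis
        using k kb bounds True by (simp add: I_def cells run_Cond)
    next
      case False
      then have "\<forall>a<Suc k. Re (nums \<sigma> ''X'' (ints \<tau> ''z'' 0)) \<le> Re (nums \<sigma> ''X'' a)"
        using k(2) unfolding I_def less_Suc_eq by (metis not_less)
      then show ?thesis
        using k kb bounds False by (simp add: I_def cells run_Cond)
    qed
  qed (use bounds in \<open>simp_all add: cells\<close>)
  moreover have "3 + (Mo * 22 + 8) \<le> 40 * B" using bounds(1) by linarith
  ultimately show ?thesis
    unfolding argmin_prog_def run_Seq using bounds(1,4)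
    by (simp add: cells, elim run_mono) (simp add: I_def)
qed

text \<open>The quantity that the search minimizes over z; \<open>p\<close> will be the product over
  the components chosen so far.\<close>

definition corr :: "(nat \<Rightarrow> complex) \<Rightarrow> nat \<Rightarrow> complex" where
  "corr p z = (\<Sum>a<Mo. p a * om ((a + z) mod Mo))"

lemma run_step:
  assumes env: "env \<sigma>" and d: "ints \<sigma> ''d'' 0 = d" "d < s"
    and p: "\<And>a. a < Mo \<Longrightarrow> nums \<sigma> ''P'' a = p a"
  shows "run M step_prog \<sigma> (\<lambda>t \<tau>. t \<le> 4000 * (K + 1) * B \<and> env \<tau> \<and> ints \<tau> ''d'' 0 = d \<and>
    (\<exists>z<Mo. (\<forall>z'<Mo. Re (corr p z) \<le> Re (corr p z')) \<and> out \<tau> = out \<sigma> @ [orbit z] \<and>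
      (\<forall>a<Mo. nums \<tau> ''P'' a = p a * (1 + of_real (weights M (d + 1)) * om ((a + z) mod Mo)))))"
proof -
  have B0: "B > 0" "L > 0" "Mo > 0" using bounds by auto
  note \<sigma> = env[unfolded env_def]
  define y where "y = (\<lambda>i. om ((L - i) mod L mod Mo))"
  let ?x1 = "CGet ''P'' (ivar ''i'')"
  let ?x2 = "CMul (CGet ''X'' (ivar ''i'')) (CGet ''Y'' (ivar ''i''))"
  let ?x3 = "CMul (CGet ''P'' (ivar ''i''))
            (CAdd (OfInt (IConst 1))
              (CMul (Weight (IAdd (ivar ''d'') (IConst 1)))
                (CGet ''o'' (IMod (IAdd (ivar ''i'') (ivar ''z'')) (ivar ''M'')))))"
  define \<sigma>1 where "\<sigma>1 = map_store ''X'' (nums \<sigma> ''P'') L \<sigma>"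
  have r1: "run M (map_loop ''X'' (ivar ''L'') ?x1) \<sigma> (\<lambda>t \<rho>. t \<le> L * 17 + 8 \<and> \<rho> = \<sigma>1)"
  proof -
    have "run M (map_loop ''X'' (ivar ''L'') ?x1) \<sigma>
      (\<lambda>t \<rho>. t \<le> L * (ccost M ?x1 + icost M (ivar ''L'') + 12) + icost M (ivar ''L'') + 6 \<and> \<rho> = \<sigma>1)"
      unfolding \<sigma>1_def by (rule run_map_loop) (use \<sigma> bounds in \<open>simp_all add: cells\<close>)
    then show ?thesis by (rule run_mono) simp
  qed
  let ?D = "dft L (nums \<sigma> ''P'')"
  have r2: "run M (fft_prog ''X'') \<sigma>1 (\<lambda>t \<tau>. t \<le> K * (200 * L + 200) + 20 \<and>
    (\<forall>k<L. nums \<tau> ''X'' k = ?D k) \<and>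
    (\<forall>a. a \<noteq> ''i'' \<longrightarrow> a \<noteq> ''h'' \<longrightarrow> ints \<tau> a = ints \<sigma> a) \<and>
    (\<forall>a. a \<noteq> ''X'' \<longrightarrow> a \<noteq> ''Z'' \<longrightarrow> nums \<tau> a = nums \<sigma> a) \<and> out \<tau> = out \<sigma>)"
  proof (rule run_mono[OF run_fft])
    fix t \<tau> assume *: "t \<le> K * (200 * L + 200) + 20 \<and> (\<forall>k<L. nums \<tau> ''X'' k = dft L (nums \<sigma>1 ''X'') k) \<and>
      (\<forall>a. a \<noteq> ''i'' \<longrightarrow> a \<noteq> ''h'' \<longrightarrow> ints \<tau> a = ints \<sigma>1 a) \<and>
      (\<forall>a. a \<noteq> ''X'' \<longrightarrow> a \<noteq> ''Z'' \<longrightarrow> nums \<tau> a = nums \<sigma>1 a) \<and> out \<tau> = out \<sigma>1"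
    have "dft L (nums \<sigma>1 ''X'') k = ?D k" for k by (rule dft_cong) (simp add: \<sigma>1_def)
    then show "t \<le> K * (200 * L + 200) + 20 \<and> (\<forall>k<L. nums \<tau> ''X'' k = ?D k) \<and>
      (\<forall>a. a \<noteq> ''i'' \<longrightarrow> a \<noteq> ''h'' \<longrightarrow> ints \<tau> a = ints \<sigma> a) \<and>
      (\<forall>a. a \<noteq> ''X'' \<longrightarrow> a \<noteq> ''Z'' \<longrightarrow> nums \<tau> a = nums \<sigma> a) \<and> out \<tau> = out \<sigma>"
      using * by (simp add: \<sigma>1_def)
  qed (use \<sigma> in \<open>simp_all add: \<sigma>1_def\<close>)
  have r3: "run M (Seq (map_loop ''X'' (ivar ''L'') ?x2) (fft_prog ''X'')) \<rho>
    (\<lambda>t \<tau>. t \<le> L * 40 + 8 + (K * (200 * L + 200) + 20) \<and>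
      (\<forall>k<Mo. nums \<tau> ''X'' k = of_nat L * corr p k) \<and>
      (\<forall>a. a \<noteq> ''i'' \<longrightarrow> a \<noteq> ''h'' \<longrightarrow> ints \<tau> a = ints \<sigma> a) \<and>
      (\<forall>a. a \<noteq> ''X'' \<longrightarrow> a \<noteq> ''Z'' \<longrightarrow> nums \<tau> a = nums \<sigma> a) \<and> out \<tau> = out \<sigma>)"
    if \<rho>: "\<forall>k<L. nums \<rho> ''X'' k = ?D k"
      "\<forall>a. a \<noteq> ''i'' \<longrightarrow> a \<noteq> ''h'' \<longrightarrow> ints \<rho> a = ints \<sigma> a"
      "\<forall>a. a \<noteq> ''X'' \<longrightarrow> a \<noteq> ''Z'' \<longrightarrow> nums \<rho> a = nums \<sigma> a" "out \<rho> = out \<sigma>" for \<rho>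
  proof -
    define f where "f k = ?D k * dft L y k" for k
    define \<rho>1 where "\<rho>1 = map_store ''X'' f L \<rho>"
    have q1: "run M (map_loop ''X'' (ivar ''L'') ?x2) \<rho>
      (\<lambda>t \<tau>. t \<le> L * (ccost M ?x2 + icost M (ivar ''L'') + 12) + icost M (ivar ''L'') + 6 \<and> \<tau> = \<rho>1)"
      unfolding \<rho>1_def
    proof (rule run_map_loop)
      fix k assume "k < L"
      then show "csafe M (map_store ''X'' f k \<rho>) ?x2 \<and> cval M (map_store ''X'' f k \<rho>) ?x2 = f k"
        using \<rho> \<sigma> bounds by (simp add: cells f_def y_def)
    qed (use \<rho> \<sigma> bounds in \<open>simp_all add: cells\<close>)
    have corr: "dft L (nums \<rho>1 ''X'') k = of_nat L * corr p k" if "k < Mo" for k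
    proof -
      have "dft L (nums \<rho>1 ''X'') k = dft L f k" by (rule dft_cong) (simp add: \<rho>1_def)
      \<comment> \<open>The premises hold because 2B <= L leaves room for a + z and because
        \<open>env\<close> keeps the tail of \<open>P\<close> at 0.\<close>
      also have "\<dots> = of_nat L * (\<Sum>a<Mo. nums \<sigma> ''P'' a * om ((a + k) mod Mo))"
        unfolding f_def y_def
        by (rule dft_correlation) (use bounds \<sigma> that in \<open>auto\<close>)
      also have "\<dots> = of_nat L * corr p k"
        unfolding corr_def using p by simp
      finally show ?thesis .
    qed
    show ?thesis
      apply (rule run_SeqI[OF q1])
      apply (elim conjE, hypsubst)
      apply (rule run_mono[OF run_fft])
      subgoal by simp
      subgoal using \<rho> \<sigma> by (simp add: \<rho>1_def)
      subgoal using \<rho> \<sigma> by (simp add: \<rho>1_def)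
      subgoal premises q for t1 \<rho>2 t2 \<tau>
      proof -
        have "t1 + t2 \<le> L * 40 + 8 + (K * (200 * L + 200) + 20)"
        proof -
          have "t1 \<le> L * 21 + 8" "t2 \<le> K * (200 * L + 200) + 20" using q by simp_all
          then show ?thesis by linarith
        qed
        moreover have "nums \<tau> ''X'' k = of_nat L * corr p k" if "k < Mo" for k
        proof -
          have "k < L" using that bounds by linarith
          then show ?thesis using q corr[OF that] by simp
        qed
        moreover have "\<forall>a. a \<noteq> ''i'' \<longrightarrow> a \<noteq> ''h'' \<longrightarrow> ints \<tau> a = ints \<sigma> a"
          "\<forall>a. a \<noteq> ''X'' \<longrightarrow> a \<noteq> ''Z'' \<longrightarrow> nums \<tau> a = nums \<sigma> a" "out \<tau> = out \<sigma>"
          using q \<rho> by (simp_all add: \<rho>1_def)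
        ultimately show ?thesis by blast
      qed
      done
  qed
  have r5: "run M (Seq argmin_prog (Seq (Emit (IGet ''E'' (ivar ''z''))) (map_loop ''P'' (ivar ''M'') ?x3))) \<rho>
    (\<lambda>t \<tau>. t \<le> 100 * B \<and> env \<tau> \<and> ints \<tau> ''d'' 0 = d \<and>
    (\<exists>z<Mo. (\<forall>z'<Mo. Re (corr p z) \<le> Re (corr p z')) \<and> out \<tau> = out \<sigma> @ [orbit z] \<and>
      (\<forall>a<Mo. nums \<tau> ''P'' a = p a * (1 + of_real (weights M (d + 1)) * om ((a + z) mod Mo)))))"
    if \<rho>: "\<forall>k<Mo. nums \<rho> ''X'' k = of_nat L * corr p k"
      "\<forall>a. a \<noteq> ''i'' \<longrightarrow> a \<noteq> ''h'' \<longrightarrow> ints \<rho> a = ints \<sigma> a"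
      "\<forall>a. a \<noteq> ''X'' \<longrightarrow> a \<noteq> ''Z'' \<longrightarrow> nums \<rho> a = nums \<sigma> a" "out \<rho> = out \<sigma>" for \<rho>
  proof -
    have r6: "run M (Seq (Emit (IGet ''E'' (ivar ''z''))) (map_loop ''P'' (ivar ''M'') ?x3)) \<rho>'
        (\<lambda>t \<tau>. t \<le> 6 + (Mo * 36 + 8) \<and> env \<tau> \<and> ints \<tau> ''d'' 0 = d \<and> out \<tau> = out \<sigma> @ [orbit z] \<and>
      (\<forall>a<Mo. nums \<tau> ''P'' a = p a * (1 + of_real (weights M (d + 1)) * om ((a + z) mod Mo))))"
      if z: "ints \<rho>' ''z'' 0 = z" "z < Mo" and \<rho>': "\<forall>a. a \<noteq> ''z'' \<longrightarrow> a \<noteq> ''i'' \<longrightarrow> ints \<rho>' a = ints \<rho> a"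
        "nums \<rho>' = nums \<rho>" "out \<rho>' = out \<rho>" for \<rho>' z
    proof -
      define f where "f a = p a * (1 + of_real (weights M (d + 1)) * om ((a + z) mod Mo))" for a
      define \<rho>1 where "\<rho>1 = \<rho>'\<lparr>out := out \<rho>' @ [orbit z]\<rparr>"
      define \<rho>2 where "\<rho>2 = map_store ''P'' f Mo \<rho>1"
      have zb: "z < 4 * B" using z by linarith
      have q1: "run M (Emit (IGet ''E'' (ivar ''z''))) \<rho>' (\<lambda>t \<tau>. t \<le> 6 \<and> \<tau> = \<rho>1)"
        using z zb \<rho> \<rho>' \<sigma> bounds(1,4) by (simp add: cells \<rho>1_def)
      have q2: "run M (map_loop ''P'' (ivar ''M'') ?x3) \<rho>1
        (\<lambda>t \<tau>. t \<le> Mo * (ccost M ?x3 + icost M (ivar ''M'') + 12) + icost M (ivar ''M'') + 6 \<and> \<tau> = \<rho>2)"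
        unfolding \<rho>2_def
      proof (rule run_map_loop)
        fix a assume a: "a < Mo"
        have "(a + z) mod Mo < Mo" using B0 by simp
        moreover from this have "(a + z) mod Mo < 4 * B" by linarith
        moreover have "a + z \<le> word M" "a < 4 * B" "d + 1 \<le> word M" using a z bounds d by linarith+
        ultimately show "csafe M (map_store ''P'' f a \<rho>1) ?x3 \<and> cval M (map_store ''P'' f a \<rho>1) ?x3 = f a"
          using a z \<rho> \<rho>' \<sigma> d p[OF a] bounds(1,4) by (simp add: cells f_def \<rho>1_def nweights)
      qed (use \<rho> \<rho>' \<sigma> bounds in \<open>simp_all add: cells \<rho>1_def\<close>)
      have env2: "env \<rho>2"
        unfolding env_def using \<rho> \<rho>' \<sigma> by (simp add: \<rho>2_def \<rho>1_def)
      show ?thesis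
        apply (rule run_SeqI[OF q1])
        apply (elim conjE, hypsubst)
        apply (rule run_mono[OF q2])
        using env2 \<rho> \<rho>' d by (simp add: \<rho>2_def \<rho>1_def f_def)
    qed
    have "ints \<rho> ''M'' 0 = Mo" using \<rho> \<sigma> by simp
    from run_argmin[OF this] show ?thesis
    proof (rule run_SeqI)
      fix t and \<rho>' :: store
      assume *: "t \<le> 40 * B \<and> ints \<rho>' ''z'' 0 < Mo \<and>
        (\<forall>a<Mo. Re (nums \<rho> ''X'' (ints \<rho>' ''z'' 0)) \<le> Re (nums \<rho> ''X'' a)) \<and>
        (\<forall>a. a \<noteq> ''z'' \<longrightarrow> a \<noteq> ''i'' \<longrightarrow> ints \<rho>' a = ints \<rho> a) \<and> nums \<rho>' = nums \<rho> \<and> out \<rho>' = out \<rho>"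
      define z where "z = ints \<rho>' ''z'' 0"
      have z: "z < Mo" "ints \<rho>' ''z'' 0 = z" using * by (simp_all add: z_def)
      \<comment> \<open>The array holds L times the correlation; dividing by L > 0 keeps the
        order.\<close>
      have opt: "\<forall>z'<Mo. Re (corr p z) \<le> Re (corr p z')"
      proof (intro allI impI)
        fix z' assume z': "z' < Mo"
        then have "Re (nums \<rho> ''X'' z) \<le> Re (nums \<rho> ''X'' z')" using * by (simp add: z_def)
        then have "real L * Re (corr p z) \<le> real L * Re (corr p z')" using \<rho>(1) z(1) z' by simp
        then show "Re (corr p z) \<le> Re (corr p z')" using B0 by simp
      qed
      have t: "t \<le> 40 * B" using * by simp
      show "run M (Seq (Emit (IGet ''E'' (ivar ''z''))) (map_loop ''P'' (ivar ''M'') ?x3)) \<rho>'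
        (\<lambda>t'. (\<lambda>t \<tau>. t \<le> 100 * B \<and> env \<tau> \<and> ints \<tau> ''d'' 0 = d \<and>
          (\<exists>z<Mo. (\<forall>z'<Mo. Re (corr p z) \<le> Re (corr p z')) \<and> out \<tau> = out \<sigma> @ [orbit z] \<and>
          (\<forall>a<Mo. nums \<tau> ''P'' a = p a * (1 + of_real (weights M (d + 1)) * om ((a + z) mod Mo))))) (t + t'))"
      proof (rule run_mono[OF r6[OF z(2,1)]], goal_cases)
        case (4 t' \<tau>)
        have "t + t' \<le> 100 * B" using 4 t bounds(1) by linarith
        then show ?case using 4 opt z(1) by blast
      qed (use * in simp_all)
    qed
  qed
  \<comment> \<open>\<open>step_prog\<close> nests its commands to the right; regrouping them lets
    \<open>r1\<close>, \<open>r2\<close>, \<open>r3\<close> and \<open>r5\<close> be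
    chained.\<close>
  have assoc: "run M step_prog \<sigma> Q" if
    "run M (map_loop ''X'' (ivar ''L'') ?x1) \<sigma> (\<lambda>t1 \<tau>1. run M (fft_prog ''X'') \<tau>1 (\<lambda>t2 \<tau>2.
      run M (Seq (map_loop ''X'' (ivar ''L'') ?x2) (fft_prog ''X'')) \<tau>2 (\<lambda>t3 \<tau>3.
        run M (Seq argmin_prog (Seq (Emit (IGet ''E'' (ivar ''z''))) (map_loop ''P'' (ivar ''M'') ?x3))) \<tau>3
          (\<lambda>t4. Q (t1 + (t2 + (t3 + t4)))))))" for Q
    using that unfolding step_prog_def run_Seq by (simp add: add.assoc)
  show ?thesis
    apply (rule assoc)
    apply (rule run_mono[OF r1])
    apply (elim conjE, hypsubst)
    apply (rule run_mono[OF r2])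
    apply (elim conjE)
    apply (rule run_mono[OF r3])
    subgoal by assumption
    subgoal by assumption
    subgoal by assumption
    subgoal by assumption
    apply (elim conjE)
    apply (rule run_mono[OF r5])
    subgoal by assumption
    subgoal by assumption
    subgoal by assumption
    subgoal by assumption
    subgoal premises q for t1 \<rho>1 t2 \<rho>2 t3 \<rho>3 t4 \<rho>4
    proof -
      have "K * (200 * L + 200) \<le> K * (1000 * B)"
        using bounds by (intro mult_le_mono2) linarith
      then have "K * (200 * L + 200) \<le> 1000 * (K * B)" by simp
      moreover have "t1 \<le> L * 17 + 8" "t2 \<le> K * (200 * L + 200) + 20"
        "t3 \<le> L * 40 + 8 + (K * (200 * L + 200) + 20)" "t4 \<le> 100 * B"
        using q by simp_all
      moreover have "4000 * (K + 1) * B = 4000 * (K * B) + 4000 * B" by (simp add: algebra_simps)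
      ultimately have "t1 + (t2 + (t3 + t4)) \<le> 4000 * (K + 1) * B"
        using bounds(1,2) by linarith
      then show ?thesis using q by blast
    qed
    done
qed


text \<open>Components are counted from 1 and exponents from 0, so \<open>zs j\<close> belongs to
  component j + 1. Its factor is evaluated at the product of g^a and g^(zs j).\<close>

definition partial_prod :: "(nat \<Rightarrow> nat) \<Rightarrow> nat \<Rightarrow> nat \<Rightarrow> complex" where
  "partial_prod zs d a =
     start_prod a * (\<Prod>j<d. 1 + of_real (weights M (j + 1)) * om ((a + zs j) mod Mo))"

definition greedy :: "(nat \<Rightarrow> nat) \<Rightarrow> nat \<Rightarrow> bool" where
  "greedy zs d \<longleftrightarrow> (\<forall>j<d. zs j < Mo \<and>
     (\<forall>z<Mo. Re (corr (partial_prod zs j) (zs j)) \<le> Re (corr (partial_prod zs j) z)))"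

text \<open>Since the first d exponents determine the product, appending a new choice leaves the
  optimality of the earlier ones intact.\<close>

lemma partial_prod_cong:
  assumes "\<And>j. j < d \<Longrightarrow> zs j = zs' j"
  shows "partial_prod zs d = partial_prod zs' d"
  using assms by (auto simp: partial_prod_def fun_eq_iff)

text \<open>From 2^K <= 4B follows K ln 2 <= ln 4 + ln B. With ln 2 >= 1/2 and B >= 4 this gives K
  <= 4 ln B, and 1 <= ln 4 <= ln B pays for the additional 1.\<close>

lemma K_le_ln: "real (K + 1) \<le> 5 * ln (real B)"
proof -
  have ln2: "ln (2::real) \<ge> 1 / 2" using ln_ge_iff[of 2 "1/2"] ln_add_one_self_le_self2 ln_one_minus_pos_lower_bound
    by (smt (verit) ln_le_minus_one ln_inverse field_sum_of_halves inverse_eq_divide)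
  have B4: "ln (4::real) \<le> ln (real B)" using bounds(1) by simp
  have ln4: "ln (4::real) = 2 * ln 2" using ln_realpow[of 2 2] by simp
  have "(2::real) ^ K \<le> 4 * real B"
    using bounds(2) unfolding L_def by (metis less_imp_le of_nat_le_iff of_nat_mult of_nat_numeral of_nat_power)
  then have "ln ((2::real) ^ K) \<le> ln (4 * real B)" by (subst ln_le_cancel_iff) (use bounds(1) in auto)
  then have "real K * ln 2 \<le> ln 4 + ln (real B)" using bounds(1) by (simp add: ln_realpow ln_mult)
  moreover have "real K * (1 / 2) \<le> real K * ln 2" using ln2 by (intro mult_left_mono) simp_all
  ultimately show ?thesis using B4 ln4 ln2 by simp
qed

theorem run_cbc:
  assumes s: "s \<ge> 1"
    and \<sigma>: "ints \<sigma> ''b'' 0 = b" "ints \<sigma> ''alpha'' 0 = al" "ints \<sigma> ''m'' 0 = m" "ints \<sigma> ''s'' 0 = s"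
    "\<And>a. nums \<sigma> ''P'' a = 0" "out \<sigma> = []"
  defines "c \<equiv> mulgen_cost M + veval_cost M + omegaeval_cost M"
  shows "run M cbc_prog \<sigma> (\<lambda>t \<tau>. real t \<le> 40000 * (real s * real B * ln (real B)) + real B * real c \<and>
    (\<exists>zs. greedy zs s \<and> out \<tau> = map (\<lambda>j. orbit (zs j)) [0..<s]))"
proof -
  define I where "I d \<tau> \<longleftrightarrow> env \<tau> \<and> ints \<tau> ''d'' 0 = d \<and> (\<exists>zs. greedy zs d \<and>
     out \<tau> = map (\<lambda>j. orbit (zs j)) [0..<d] \<and> (\<forall>a<Mo. nums \<tau> ''P'' a = partial_prod zs d a))" for d and \<tau> :: store
  have loop: "run M (for_loop ''d'' (ivar ''s'') step_prog) \<tau>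
     (\<lambda>t \<tau>. t \<le> s * (4000 * (K + 1) * B + icost M (ivar ''s'') + 9) + icost M (ivar ''s'') + 6 \<and> I s \<tau>)"
    if \<tau>: "env \<tau>" "\<forall>a<Mo. nums \<tau> ''P'' a = start_prod a" "out \<tau> = []" for \<tau>
  proof (rule run_for_loop[where I = I])
    have "env (set_ivar ''d'' 0 \<tau>)" using \<tau>(1) by (simp add: env_def)
    then show "I 0 (set_ivar ''d'' 0 \<tau>)"
      using \<tau> by (auto simp: I_def greedy_def partial_prod_def)
  next
    fix d \<tau> assume "I d \<tau>"
    then show "ints \<tau> ''d'' 0 = d \<and> isafe M \<tau> (ivar ''s'') \<and> ival M \<tau> (ivar ''s'') = s"
      using bounds(1) by (simp add: I_def env_def cells)
  next
    fix d \<tau> assume d: "d < s" and I: "I d \<tau>"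
    from I obtain zs where zs: "greedy zs d" "out \<tau> = map (\<lambda>j. orbit (zs j)) [0..<d]"
      "\<forall>a<Mo. nums \<tau> ''P'' a = partial_prod zs d a" and e: "env \<tau>" "ints \<tau> ''d'' 0 = d"
      unfolding I_def by blast
    show "run M step_prog \<tau> (\<lambda>t \<tau>'. t \<le> 4000 * (K + 1) * B \<and> ints \<tau>' ''d'' 0 = d \<and> I (Suc d) (set_ivar ''d'' (Suc d) \<tau>'))"
    proof (rule run_mono[OF run_step[OF e d]])
      fix a assume "a < Mo"
      then show "nums \<tau> ''P'' a = partial_prod zs d a" using zs by simp
    next
      fix t \<tau>'
      assume *: "t \<le> 4000 * (K + 1) * B \<and> env \<tau>' \<and> ints \<tau>' ''d'' 0 = d \<and>
        (\<exists>z<Mo. (\<forall>z'<Mo. Re (corr (partial_prod zs d) z) \<le> Re (corr (partial_prod zs d) z')) \<and>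
          out \<tau>' = out \<tau> @ [orbit z] \<and>
          (\<forall>a<Mo. nums \<tau>' ''P'' a = partial_prod zs d a * (1 + of_real (weights M (d + 1)) * om ((a + z) mod Mo))))"
      then obtain z where z: "z < Mo" "\<forall>z'<Mo. Re (corr (partial_prod zs d) z) \<le> Re (corr (partial_prod zs d) z')"
          "out \<tau>' = out \<tau> @ [orbit z]"
          "\<forall>a<Mo. nums \<tau>' ''P'' a = partial_prod zs d a * (1 + of_real (weights M (d + 1)) * om ((a + z) mod Mo))"
        by blast
      define zs' where "zs' = zs(d := z)"
      have pp: "partial_prod zs' j = partial_prod zs j" if "j \<le> d" for j
        by (rule partial_prod_cong) (use that in \<open>auto simp: zs'_def\<close>)
      have "greedy zs' (Suc d)"
        unfolding greedy_def
      proof (intro allI impI)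
        fix j assume j: "j < Suc d"
        show "zs' j < Mo \<and> (\<forall>z<Mo. Re (corr (partial_prod zs' j) (zs' j)) \<le> Re (corr (partial_prod zs' j) z))"
        proof (cases "j = d")
          case True
          then show ?thesis using z pp[of d] by (simp add: zs'_def)
        next
          case False
          then have "j < d" using j by simp
          then show ?thesis using zs(1) pp[of j] unfolding greedy_def by (simp add: zs'_def)
        qed
      qed
      moreover have "out \<tau>' = map (\<lambda>j. orbit (zs' j)) [0..<Suc d]"
        using z(3) zs(2) by (simp add: zs'_def)
      moreover have "\<forall>a<Mo. nums \<tau>' ''P'' a = partial_prod zs' (Suc d) a"
      proof (intro allI impI)
        fix a assume a: "a < Mo"
        have "partial_prod zs' (Suc d) a = partial_prod zs' d a * (1 + of_real (weights M (d + 1)) * om ((a + z) mod Mo))"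
          by (simp add: partial_prod_def zs'_def mult.assoc)
        then show "nums \<tau>' ''P'' a = partial_prod zs' (Suc d) a" using z(4) a pp[of d] by simp
      qed
      moreover have "env (set_ivar ''d'' (Suc d) \<tau>')" using * by (simp add: env_def)
      ultimately have "I (Suc d) (set_ivar ''d'' (Suc d) \<tau>')"
        unfolding I_def by (simp del: upt_Suc) blast
      then show "t \<le> 4000 * (K + 1) * B \<and> ints \<tau>' ''d'' 0 = d \<and> I (Suc d) (set_ivar ''d'' (Suc d) \<tau>')"
        using * by blast
    qed
  qed (use bounds in \<open>simp_all add: cells\<close>)
  have cost: "real (t1 + (t2 + t3)) \<le> 40000 * (real s * real B * ln (real B)) + real B * real c"
    if t: "t1 \<le> 200 * B" "t2 \<le> B * c + 2000 * (K + 1) * B" "t3 \<le> s * (4000 * (K + 1) * B + 11) + 8" for t1 t2 t3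
  proof -
    \<comment> \<open>The coefficients of s (K + 1) B add up to at most 200 + 2000 + 4000 + 11 + 8 <
      7000. With \<open>K_le_ln\<close> this becomes 7000 * 5 = 35000 <= 40000.\<close>
    have "t1 + (t2 + t3) \<le> B * c + 7000 * (s * ((K + 1) * B))"
    proof -
      have "(K + 1) * B \<le> s * ((K + 1) * B)" "s \<le> s * ((K + 1) * B)"
        using s bounds(1) by (simp_all add: Suc_le_eq)
      moreover have "B \<le> (K + 1) * B" by simp
      moreover have "t3 \<le> 4000 * (s * ((K + 1) * B)) + 11 * s + 8" using t(3) by (simp add: algebra_simps)
      moreover have "t2 \<le> B * c + 2000 * ((K + 1) * B)" using t(2) by (simp add: algebra_simps)
      ultimately show ?thesis using t(1) bounds(1) by linarith
    qed
    then have "real (t1 + (t2 + t3)) \<le> real (B * c + 7000 * (s * ((K + 1) * B)))" by (rule of_nat_mono)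
    also have "\<dots> = real B * real c + 7000 * (real s * real B) * real (K + 1)" by (simp add: algebra_simps)
    also have "\<dots> \<le> real B * real c + 7000 * (real s * real B) * (5 * ln (real B))"
      by (intro add_left_mono mult_left_mono K_le_ln) simp
    also have "\<dots> \<le> 40000 * (real s * real B * ln (real B)) + real B * real c"
      using bounds(1) by simp
    finally show ?thesis .
  qed
  show ?thesis
    unfolding cbc_prog_def
    apply (rule run_SeqI[OF run_dims])
    subgoal by (rule \<sigma>)
    subgoal by (rule \<sigma>)
    subgoal by (rule \<sigma>)
    subgoal by (rule \<sigma>)
    apply (elim conjE)
    apply (rule run_SeqI[OF run_tables])
    subgoal by assumption
    subgoal by assumption
    subgoal by assumption
    subgoal by assumption
    subgoal using \<sigma>(5) by simp
    apply (elim conjE)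
    apply (rule run_mono[OF loop])
    subgoal by assumption
    subgoal by assumption
    subgoal using \<sigma>(6) by simp
    subgoal premises p for t1 \<tau>1 t2 \<tau>2 t3 \<tau>3
    proof -
      have "real (t1 + (t2 + t3)) \<le> 40000 * (real s * real B * ln (real B)) + real B * real c"
        by (rule cost) (use p in \<open>simp_all add: c_def add.commute\<close>)
      moreover have "I s \<tau>3" using p by blast
      ultimately show ?thesis unfolding I_def by blast
    qed
    done
qed

end

section \<open>Residues modulo an irreducible polynomial\<close>

locale prime_poly = poly_mod "int b" for b :: nat +
  assumes prime_b: "prime b"
begin

lemma b_gt1: "b > 1"
  using prime_b prime_gt_1_nat by blast

lemma Fpolys_iff: "v \<in> Fpolys b \<longleftrightarrow> Mp v = v"
proof -
  have "poly_mod_2 (int b)" using b_gt1 by (simp add: poly_mod_2_def)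
  from poly_mod_2.Mp_ident_iff[OF this, of v] show ?thesis by (simp add: Fpolys_def)
qed

lemma Mp_in_Fpolys [simp]: "Mp v \<in> Fpolys b"
  by (simp add: Fpolys_iff)

lemma mod_inverse:
  assumes "a mod int b \<noteq> 0"
  shows "\<exists>c. (c * a) mod int b = 1"
proof -
  have "gcd (int b) a = 1"
    using assms prime_b prime_imp_coprime[of "int b" a] by (auto simp: dvd_eq_mod_eq_0)
  then have "gcd a (int b) = 1" by (simp only: gcd.commute)
  then obtain c where "[a * c = 1] (mod int b)" using cong_solve_int[of a "int b"] by auto
  then show ?thesis using b_gt1 by (auto simp: cong_def mult.commute)
qed

lemma mod_mult_nonzero:
  assumes "x mod int b \<noteq> 0" "y mod int b \<noteq> 0"
  shows "(x * y) mod int b \<noteq> 0"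
  using assms prime_b prime_dvd_mult_iff[of "int b" x y] by (auto simp: dvd_eq_mod_eq_0)

lemma lead_coeff_Mp_nonzero:
  assumes "Mp f \<noteq> 0"
  shows "lead_coeff (Mp f) mod int b \<noteq> 0"
proof -
  have "lead_coeff (Mp f) mod int b = lead_coeff (Mp f)"
    by (metis M_def Mp_Mp Mp_coeff)
  then show ?thesis using assms by simp
qed

text \<open>Modulo a prime the product of the leading coefficients does not vanish.\<close>

lemma degree_m_mult:
  assumes "Mp f \<noteq> 0" "Mp g \<noteq> 0"
  shows "Mp (f * g) \<noteq> 0" "degree_m (f * g) = degree_m f + degree_m g"
proof -
  let ?d = "degree_m f + degree_m g"
  have "coeff (Mp f * Mp g) ?d = lead_coeff (Mp f) * lead_coeff (Mp g)"
    by (rule coeff_mult_degree_sum)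
  then have "coeff (Mp (Mp f * Mp g)) ?d = (lead_coeff (Mp f) * lead_coeff (Mp g)) mod int b"
    by (simp only: Mp_coeff[of "Mp f * Mp g"] M_def)
  then have "coeff (Mp (Mp f * Mp g)) ?d \<noteq> 0"
    using mod_mult_nonzero[OF lead_coeff_Mp_nonzero[OF assms(1)] lead_coeff_Mp_nonzero[OF assms(2)]] by (simp only: not_False_eq_True)
  then have c: "coeff (Mp (f * g)) ?d \<noteq> 0" by simp
  then show "Mp (f * g) \<noteq> 0" by auto
  have "degree_m (f * g) \<le> ?d" by (rule degree_m_mult_le) simp
  with c show "degree_m (f * g) = ?d" by (meson le_antisym le_degree)
qed

text \<open>Pseudo-division over the integers multiplies f by a power of the leading coefficient of
  the divisor. Modulo the prime b that power has an inverse, and scaling by it gives division with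
  remainder of f itself.\<close>

lemma division_m:
  assumes d: "Mp d \<noteq> 0"
  shows "\<exists>q r. Mp f = Mp (d * q + r) \<and> Mp r = r \<and> (r = 0 \<or> degree r < degree_m d)"
proof -
  define D where "D = Mp d"
  obtain Q R where QR: "pseudo_divmod f D = (Q, R)" by fastforce
  have 1: "smult (coeff D (degree D) ^ (Suc (degree f) - degree D)) f = D * Q + R" "R = 0 \<or> degree R < degree D"
    using pseudo_divmod[OF _ QR] d by (auto simp: D_def)
  define a where "a = coeff D (degree D) ^ (Suc (degree f) - degree D)"
  have "a mod int b \<noteq> 0"
  proof -
    have "\<not> int b dvd coeff D (degree D)" using lead_coeff_Mp_nonzero[OF d] by (simp add: D_def dvd_eq_mod_eq_0)
    then have "\<not> int b dvd a" unfolding a_def using prime_b prime_dvd_power[of "int b"] by auto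
    then show ?thesis by (simp add: dvd_eq_mod_eq_0)
  qed
  then obtain c where c: "(c * a) mod int b = 1" using mod_inverse by blast
  define r where "r = Mp (smult c R)"
  have "Mp f = Mp (smult (M (c * a)) f)" using c by (simp add: M_def)
  also have "\<dots> = Mp (smult c (smult a f))" by simp
  also have "\<dots> = Mp (D * smult c Q + smult c R)"
    unfolding a_def 1(1) by (simp add: smult_add_right)
  also have "\<dots> = Mp (Mp (D * smult c Q) + r)" by (simp add: r_def)
  also have "\<dots> = Mp (d * smult c Q + r)" unfolding D_def by (simp only: mult_Mp plus_Mp)
  finally have "Mp f = Mp (d * smult c Q + r)" .
  moreover have "r = 0 \<or> degree r < degree_m d"
  proof (cases "R = 0")
    case False
    then have "degree R < degree_m d" using 1(2) by (simp add: D_def)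
    moreover have "degree r \<le> degree R"
      unfolding r_def using degree_m_le[of "smult c R"] degree_smult_le[of c R] by linarith
    ultimately show ?thesis by simp
  qed (simp add: r_def)
  moreover have "Mp r = r" by (simp add: r_def)
  ultimately show ?thesis by blast
qed

lemma dvdm_mult: "f dvdm g \<Longrightarrow> f dvdm g * h"
  unfolding dvdm_def by (metis mult.assoc mult_Mp(1))

lemma dvdm_diff: "f dvdm g \<Longrightarrow> f dvdm h \<Longrightarrow> f dvdm (g - h)"
  using dvdm_add[of f g "- h"] by simp

lemma dvdm_0 [simp]: "f dvdm 0"
  unfolding dvdm_def by (rule exI[of _ 0]) simp

end

locale irreducible_poly = prime_poly b for b :: nat +
  fixes p :: "int poly" and n :: nat
  assumes p_F: "p \<in> Fpolys b" and irr: "irreducible_m p" and deg_p: "degree p = n" and n_pos: "n > 0"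
begin

lemma Mp_p [simp]: "Mp p = p"
  using p_F by (simp add: Fpolys_iff)

lemma p_nonzero: "p \<noteq> 0"
  using deg_p n_pos by auto

text \<open>A nonzero multiple of p has at least the degree of p; this makes representatives of
  degree below n unique.\<close>

lemma dvdm_small:
  assumes "p dvdm h" "Mp h = h" "degree h < n"
  shows "h = 0"
proof (rule ccontr)
  assume h: "h \<noteq> 0"
  obtain q where q: "Mp h = Mp (p * q)" using assms(1) unfolding dvdm_def by blast
  have "Mp q \<noteq> 0"
  proof
    assume "Mp q = 0"
    then have "Mp (p * q) = 0" by (metis mult_Mp(2) mult_zero_right Mp_0)
    then show False using q h assms(2) by simp
  qed
  then have "degree_m (p * q) = n + degree_m q"
    using degree_m_mult(2)[of p q] p_nonzero deg_p by simp
  then show False using q assms by simp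
qed

lemma residue_unique:
  assumes "r \<in> Fpolys b" "degree r < n" "p dvdm (f - r)"
    and "r' \<in> Fpolys b" "degree r' < n" "p dvdm (f - r')"
  shows "r = r'"
proof -
  have "p dvdm (r' - r)" using dvdm_diff[OF assms(3,6)] by simp
  then have "p dvdm Mp (r' - r)" by simp
  moreover have "degree_m (r' - r) < n"
    using degree_m_le[of "r' - r"] degree_diff_le_max[of r' r] assms by linarith
  ultimately have "Mp (r' - r) = 0" using dvdm_small by simp
  then have "\<forall>i. (coeff r' i - coeff r i) mod int b = 0"
    by (simp add: poly_eq_iff Mp_coeff M_def)
  then have "\<forall>i. coeff r' i mod int b = coeff r i mod int b"
    by (simp add: mod_eq_dvd_iff mod_eq_0_iff_dvd)
  then have "Mp r' = Mp r" by (simp add: poly_eq_iff Mp_coeff M_def)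
  then show ?thesis using assms by (simp add: Fpolys_iff)
qed

lemma residue_ex: "\<exists>r. r \<in> Fpolys b \<and> degree r < degree p \<and> p dvdm (f - r)"
proof -
  obtain q r where qr: "Mp f = Mp (p * q + r)" "Mp r = r" "r = 0 \<or> degree r < degree_m p"
    using division_m[of p f] p_nonzero by auto
  have "Mp (f - r) = Mp (Mp f - r)" by simp
  also have "\<dots> = Mp (p * q)" using qr(1) by simp
  finally have "p dvdm (f - r)" unfolding dvdm_def by blast
  moreover have "degree r < degree p" using qr(3) deg_p n_pos by auto
  ultimately show ?thesis using qr(2) Fpolys_iff by blast
qed

abbreviation res :: "int poly \<Rightarrow> int poly" where "res \<equiv> residue b p"

lemma residue_props: "res f \<in> Fpolys b" "degree (res f) < n" "p dvdm (f - res f)"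
proof -
  have "res f \<in> Fpolys b \<and> degree (res f) < degree p \<and> p dvdm (f - res f)"
    unfolding residue_def
    by (rule theI'[OF ex_ex1I[OF residue_ex]]) (use residue_unique deg_p in blast)
  then show "res f \<in> Fpolys b" "degree (res f) < n" "p dvdm (f - res f)" using deg_p by auto
qed

lemma residue_eqI: "r \<in> Fpolys b \<Longrightarrow> degree r < n \<Longrightarrow> p dvdm (f - r) \<Longrightarrow> res f = r"
  using residue_unique residue_props by blast

lemma residue_eq_iff: "res f = res g \<longleftrightarrow> p dvdm (f - g)"
proof
  assume "res f = res g"
  then have "p dvdm ((f - res f) - (g - res g))" by (intro dvdm_diff residue_props)
  then show "p dvdm (f - g)" using \<open>res f = res g\<close> by simp
next
  assume "p dvdm (f - g)"
  then have "p dvdm (f - g) + (g - res g)" by (intro dvdm_add residue_props)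
  then show "res f = res g" using residue_eqI residue_props by (metis diff_add_cancel add_diff_eq)
qed

lemma residue_small: "r \<in> Fpolys b \<Longrightarrow> degree r < n \<Longrightarrow> res r = r"
  by (rule residue_eqI) simp_all

lemma residue_mult_left [simp]: "res (res u * v) = res (u * v)"
proof -
  have "p dvdm (u - res u) * v" by (intro dvdm_mult residue_props)
  then show ?thesis unfolding residue_eq_iff by (metis dvdm_uminus left_diff_distrib minus_diff_eq)
qed

lemma residue_mult_right [simp]: "res (u * res v) = res (u * v)"
  using residue_mult_left[of v u] by (simp add: mult.commute)

lemma one_F: "1 \<in> Fpolys b"
  using b_gt1 by (simp add: Fpolys_def)

lemma zero_F: "0 \<in> Fpolys b"
  using b_gt1 by (simp add: Fpolys_def)

lemma residue_0 [simp]: "res 0 = 0"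
  by (rule residue_small) (use zero_F n_pos in auto)

lemma residue_1 [simp]: "res 1 = 1"
  by (rule residue_small) (use one_F n_pos in auto)

abbreviation Q :: "int poly monoid" where "Q \<equiv> quotient_monoid b p"

lemma carrier_Q: "u \<in> carrier Q \<longleftrightarrow> u \<in> Fpolys b \<and> degree u < n"
  by (simp add: quotient_monoid_def deg_p)

lemma mult_Q [simp]: "u \<otimes>\<^bsub>Q\<^esub> v = res (u * v)" and one_Q [simp]: "\<one>\<^bsub>Q\<^esub> = 1"
  by (simp_all add: quotient_monoid_def)

lemma comm_monoid_Q: "comm_monoid Q"
  by (rule comm_monoidI)
     (auto simp: carrier_Q residue_props residue_small one_F n_pos mult_ac)

text \<open>A nonzero element of least degree in the ideal generated by \<open>u\<close> and \<open>p\<close> divides both, so by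
  irreducibility it is a unit.\<close>

lemma nonzero_unit:
  assumes u: "u \<in> carrier Q" "u \<noteq> 0"
  shows "\<exists>v. res (u * v) = 1"
proof -
  define J where "J = {f. Mp f \<noteq> 0 \<and> (\<exists>a c. Mp f = Mp (u * a + p * c))}"
  have uF: "Mp u = u" "degree u < n" using u by (auto simp: carrier_Q Fpolys_iff)
  have uJ: "u \<in> J"
  proof -
    have "Mp u = Mp (u * 1 + p * 0)" by simp
    then have "\<exists>a c. Mp u = Mp (u * a + p * c)" by blast
    then show ?thesis unfolding J_def using u uF by simp
  qed
  have pJ: "p \<in> J"
  proof -
    have "Mp p = Mp (u * 0 + p * 1)" by simp
    then have "\<exists>a c. Mp p = Mp (u * a + p * c)" by blast
    then show ?thesis unfolding J_def using p_nonzero by simp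
  qed
  obtain d where d: "d \<in> J" "\<And>f. f \<in> J \<Longrightarrow> degree_m d \<le> degree_m f"
    using ex_has_least_nat[of "\<lambda>f. f \<in> J" u degree_m] uJ by blast
  obtain a c where ac: "Mp d = Mp (u * a + p * c)" and d0: "Mp d \<noteq> 0"
    using d(1) unfolding J_def by blast
  \<comment> \<open>The remainder of f modulo d stays in the ideal and has smaller degree than d
    unless it is 0, so it is 0.\<close>
  have dvd: "d dvdm f" if f: "f \<in> J" for f
  proof -
    obtain q r where qr: "Mp f = Mp (d * q + r)" "Mp r = r" "r = 0 \<or> degree r < degree_m d"
      using division_m[OF d0] by blast
    obtain a' c' where ac': "Mp f = Mp (u * a' + p * c')" using f unfolding J_def by blast
    have "Mp r = Mp (Mp (d * q + r) - d * q)" by simp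
    also have "\<dots> = Mp (Mp f - Mp (Mp d * q))" using qr(1) by simp
    also have "\<dots> = Mp ((u * a' + p * c') - (u * a + p * c) * q)" unfolding ac ac' by simp
    also have "(u * a' + p * c') - (u * a + p * c) * q = u * (a' - a * q) + p * (c' - c * q)"
      by (simp add: algebra_simps)
    finally have "Mp r = Mp (u * (a' - a * q) + p * (c' - c * q))" .
    then have "r = 0" using d(2)[of r] qr(2,3) unfolding J_def by (metis (mono_tags, lifting) mem_Collect_eq not_le)
    then show ?thesis using qr(1) unfolding dvdm_def by auto
  qed
  obtain e where e: "Mp p = Mp (d * e)" using dvd[OF pJ] unfolding dvdm_def by blast
  \<comment> \<open>By p = d e and irreducibility, d or e is a unit. If e were one, d would have
    degree n, although \<open>u\<close> lies in \<open>J\<close> and has smaller degree.\<close>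
  have "d dvdm 1"
  proof (rule ccontr)
    assume nd: "\<not> d dvdm 1"
    then have "e dvdm 1" using irr e unfolding irreducible_m_def by blast
    then obtain e' where e': "Mp 1 = Mp (e * e')" unfolding dvdm_def by blast
    have nz: "Mp e \<noteq> 0"
    proof
      assume "Mp e = 0"
      then have "Mp (e * e') = 0" by (metis mult_Mp(1) mult_zero_left Mp_0)
      then show False using e' one_F by (simp add: Fpolys_iff)
    qed
    have "degree_m (e * e') = 0" using e' one_F by (metis Fpolys_iff degree_1)
    moreover have "Mp e' \<noteq> 0"
    proof
      assume "Mp e' = 0"
      then have "Mp (e * e') = 0" by (metis mult_Mp(2) mult_zero_right Mp_0)
      then show False using e' one_F by (simp add: Fpolys_iff)
    qed
    ultimately have "degree_m e = 0" using degree_m_mult(2)[OF nz] by simp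
    then have "n = degree_m d" using degree_m_mult(2)[OF d0 nz] e deg_p by simp
    then show False using d(2)[OF uJ] uF by simp
  qed
  then obtain d' where d': "Mp 1 = Mp (d * d')" unfolding dvdm_def by blast
  have "Mp (u * (a * d') - 1) = Mp (u * (a * d') - Mp 1)" by (simp only: minus_Mp)
  also have "Mp 1 = Mp (Mp d * d')" using d' by simp
  also have "\<dots> = Mp ((u * a + p * c) * d')" unfolding ac by simp
  also have "Mp (u * (a * d') - \<dots>) = Mp (p * (- c * d'))" by (simp add: algebra_simps)
  finally have "p dvdm (u * (a * d') - 1)" unfolding dvdm_def by blast
  then have "res (u * (a * d')) = res 1" unfolding residue_eq_iff .
  then show ?thesis by auto
qed

end

section \<open>Base b digits as polynomial coefficients\<close>

lemma digit_0: "digit b k 0 = k mod b"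
  by (simp add: digit_def)

lemma digit_Suc: "digit b k (Suc i) = digit b (k div b) i"
  by (simp add: digit_def div_mult2_eq)

lemma digit_ge:
  assumes "b > 1" "k < b ^ n" "n \<le> i"
  shows "digit b k i = 0"
proof -
  have "b ^ n \<le> b ^ i" using assms by (intro power_increasing) simp_all
  then have "k < b ^ i" using assms(2) by linarith
  then show ?thesis by (simp add: digit_def)
qed

lemma digit_support_subset:
  assumes "b > 1" "k < b ^ n"
  shows "digit_support b k \<subseteq> {..<n}"
proof
  fix i assume "i \<in> digit_support b k"
  then have "digit b k i \<noteq> 0" by (simp add: digit_support_def)
  then have "\<not> n \<le> i" using digit_ge[OF assms, of i] by auto
  then show "i \<in> {..<n}" by simp
qed

lemma less_power_self:
  assumes "b > 1"
  shows "k < b ^ k"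
proof -
  have "(2::nat) ^ k \<le> b ^ k" using assms by (intro power_mono) simp_all
  then show ?thesis using less_exp[of k] by linarith
qed

lemma finite_digit_support:
  assumes "b > 1"
  shows "finite (digit_support b k)"
  by (rule finite_subset[OF digit_support_subset[OF assms less_power_self[OF assms]]]) simp

lemma coeff_poly_of_nat:
  assumes "b > 1"
  shows "coeff (poly_of_nat b k) i = int (digit b k i)"
proof -
  have "coeff (poly_of_nat b k) i = (\<Sum>j\<in>digit_support b k. if j = i then int (digit b k j) else 0)"
    unfolding poly_of_nat_def coeff_sum by (intro sum.cong) auto
  also have "\<dots> = (if i \<in> digit_support b k then int (digit b k i) else 0)"
    using finite_digit_support[OF assms, of k] by (simp add: sum.delta)
  finally show ?thesis by (simp add: digit_support_def)
qed

lemma poly_of_nat_pCons: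
  assumes "b > 1"
  shows "poly_of_nat b k = pCons (int (k mod b)) (poly_of_nat b (k div b))"
  by (rule poly_eqI) (simp add: coeff_poly_of_nat[OF assms] coeff_pCons digit_0 digit_Suc split: nat.split)

lemma poly_of_nat_Fpolys:
  assumes "b > 1"
  shows "poly_of_nat b k \<in> Fpolys b"
  using assms unfolding Fpolys_def by (simp add: coeff_poly_of_nat) (simp add: digit_def)

lemma degree_poly_of_nat:
  assumes "b > 1" "k < b ^ n" "n > 0"
  shows "degree (poly_of_nat b k) < n"
proof -
  have "degree (poly_of_nat b k) \<le> n - 1"
    by (rule degree_le) (use assms digit_ge[OF assms(1,2)] in \<open>auto simp: coeff_poly_of_nat\<close>)
  then show ?thesis using assms by linarith
qed

lemma nat_of_poly_of_nat:
  assumes "b > 1"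
  shows "nat_of_poly b (poly_of_nat b k) = k"
proof -
  have "poly (poly_of_nat b k) (int b) = int k"
  proof (induction k rule: less_induct)
    case (less k)
    show ?case
    proof (cases "k = 0")
      case True
      then show ?thesis by (simp add: poly_of_nat_def digit_support_def digit_def)
    next
      case False
      then have "k div b < k" using assms by simp
      from less[OF this] have "poly (poly_of_nat b k) (int b) = int (k mod b) + int b * int (k div b)"
        by (subst poly_of_nat_pCons[OF assms]) simp
      also have "\<dots> = int (k mod b + b * (k div b))" by (simp only: of_nat_add of_nat_mult)
      finally show ?thesis by (simp only: mod_mult_div_eq)
    qed
  qed
  then show ?thesis by (simp add: nat_of_poly_def)
qed

lemma Fpolys_pCons:
  "pCons a q \<in> Fpolys b \<longleftrightarrow> a \<in> {0..<int b} \<and> q \<in> Fpolys b"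
proof
  assume *: "pCons a q \<in> Fpolys b"
  have "coeff (pCons a q) 0 \<in> {0..<int b}" "\<And>i. coeff (pCons a q) (Suc i) \<in> {0..<int b}"
    using * unfolding Fpolys_def by blast+
  then show "a \<in> {0..<int b} \<and> q \<in> Fpolys b" unfolding Fpolys_def by simp
next
  assume "a \<in> {0..<int b} \<and> q \<in> Fpolys b"
  then show "pCons a q \<in> Fpolys b" unfolding Fpolys_def by (auto simp: coeff_pCons split: nat.split)
qed

text \<open>Nonnegativity of the value is carried through the induction, since \<open>nat\<close> in
  \<open>nat_of_poly\<close> is additive on nonnegative integers only.\<close>

lemma poly_of_nat_of_poly:
  assumes "b > 1" "v \<in> Fpolys b"
  shows "poly_of_nat b (nat_of_poly b v) = v \<and> poly v (int b) \<ge> 0"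
  using assms(2)
proof (induction v)
  case 0
  then show ?case by (simp add: nat_of_poly_def poly_of_nat_def digit_support_def digit_def)
next
  case (pCons a q)
  have a: "0 \<le> a" "a < int b" and q: "q \<in> Fpolys b" using pCons.prems by (auto simp: Fpolys_pCons)
  have IH: "poly_of_nat b (nat_of_poly b q) = q" "poly q (int b) \<ge> 0" using pCons.IH q by auto
  have N: "nat_of_poly b (pCons a q) = nat a + b * nat_of_poly b q"
    using a IH(2) by (simp add: nat_of_poly_def nat_add_distrib nat_mult_distrib)
  have "nat a < b" using a by linarith
  then have "(nat a + b * nat_of_poly b q) mod b = nat a" "(nat a + b * nat_of_poly b q) div b = nat_of_poly b q"
    using assms(1) by simp_all
  then show ?case using poly_of_nat_pCons[OF assms(1), of "nat_of_poly b (pCons a q)"] N IH a by simp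
qed

lemma nat_of_poly_less:
  assumes b: "b > 1" and v: "v \<in> Fpolys b" "degree v < n"
  shows "nat_of_poly b v < b ^ n"
proof -
  \<comment> \<open>Vanishing coefficients replace the degree bound: removing the coefficient of a
    constant leaves 0, whose degree is again 0, so \<open>degree v < n\<close> would not pass from n
    = 1 to n = 0.\<close>
  have "poly v (int b) < int b ^ n" if "v \<in> Fpolys b" "\<forall>i\<ge>n. coeff v i = 0" for v
    using that
  proof (induction n arbitrary: v)
    case 0
    then have "v = 0" by (simp add: poly_eq_iff)
    then show ?case by simp
  next
    case (Suc n)
    obtain a q where v: "v = pCons a q" by (cases v) auto
    have a: "a < int b" and q: "q \<in> Fpolys b" using Suc.prems(1) by (auto simp: v Fpolys_pCons)
    have "\<forall>i\<ge>n. coeff q i = 0"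
    proof (intro allI impI)
      fix i assume "n \<le> i"
      then have "coeff v (Suc i) = 0" using Suc.prems(2) by simp
      then show "coeff q i = 0" by (simp add: v)
    qed
    from Suc.IH[OF q this] have "poly q (int b) + 1 \<le> int b ^ n" by simp
    then have "int b * (poly q (int b) + 1) \<le> int b * int b ^ n" by (intro mult_left_mono) auto
    then show ?case using a by (simp add: v algebra_simps)
  qed
  moreover have "\<forall>i\<ge>n. coeff v i = 0" using v(2) by (simp add: coeff_eq_0)
  ultimately have "poly v (int b) < int b ^ n" using v(1) by blast
  then show ?thesis
    using poly_of_nat_of_poly[OF b v(1)] unfolding nat_of_poly_def by (simp add: nat_less_iff)
qed

lemma poly_of_nat_0: "poly_of_nat b 0 = 0"
  by (simp add: poly_of_nat_def digit_support_def digit_def)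

lemma poly_of_nat_1: "b > 1 \<Longrightarrow> poly_of_nat b 1 = 1"
  by (subst poly_of_nat_pCons) (simp_all add: poly_of_nat_0)

section \<open>The cyclic group of nonzero residues\<close>

context irreducible_poly
begin

lemma nonzero_carrier: "carrier (units_of Q) = carrier Q - {0}"
proof -
  interpret comm_monoid Q by (rule comm_monoid_Q)
  have "u \<in> Units Q \<longleftrightarrow> u \<in> carrier Q \<and> u \<noteq> 0" for u
  proof
    assume "u \<in> Units Q"
    then obtain v where v: "u \<in> carrier Q" "v \<otimes>\<^bsub>Q\<^esub> u = \<one>\<^bsub>Q\<^esub>" unfolding Units_def by auto
    then have "u \<noteq> 0" by auto
    with v show "u \<in> carrier Q \<and> u \<noteq> 0" by blast
  next
    assume u: "u \<in> carrier Q \<and> u \<noteq> 0"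
    then obtain v where v: "res (u * v) = 1" using nonzero_unit by blast
    have "res v \<in> carrier Q" using residue_props by (simp add: carrier_Q)
    moreover have "u \<otimes>\<^bsub>Q\<^esub> res v = \<one>\<^bsub>Q\<^esub>" using v by simp
    moreover have "res v \<otimes>\<^bsub>Q\<^esub> u = \<one>\<^bsub>Q\<^esub>" using v by (simp add: mult.commute)
    ultimately show "u \<in> Units Q" unfolding Units_def using u by blast
  qed
  then show ?thesis by (auto simp: units_of_carrier)
qed

lemma carrier_image: "carrier Q = poly_of_nat b ` {..<b ^ n}"
proof
  show "carrier Q \<subseteq> poly_of_nat b ` {..<b ^ n}"
  proof
    fix v assume "v \<in> carrier Q"
    then have v: "v \<in> Fpolys b" "degree v < n" by (auto simp: carrier_Q)
    then have "v = poly_of_nat b (nat_of_poly b v)" "nat_of_poly b v < b ^ n"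
      using poly_of_nat_of_poly nat_of_poly_less b_gt1 by auto
    then show "v \<in> poly_of_nat b ` {..<b ^ n}" by blast
  qed
  show "poly_of_nat b ` {..<b ^ n} \<subseteq> carrier Q"
    using poly_of_nat_Fpolys[OF b_gt1] degree_poly_of_nat[OF b_gt1 _ n_pos] by (auto simp: carrier_Q)
qed

lemma inj_poly_of_nat: "inj (poly_of_nat b)"
  by (rule inj_on_inverseI[where g = "nat_of_poly b"]) (rule nat_of_poly_of_nat[OF b_gt1])

lemma card_carrier: "finite (carrier Q)" "card (carrier Q) = b ^ n"
  unfolding carrier_image using card_image[OF inj_on_subset[OF inj_poly_of_nat]] by simp_all

text \<open>Every unit is an integer power of the generator, and exponents reduce modulo the group
  order N = b^n - 1. Exponents below N thus reach all N units, and a surjection between finite sets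
  of equal size is injective.\<close>

lemma power_orbit:
  assumes g: "unit_group_generator b p g"
  defines "G \<equiv> \<lambda>a. res (g ^ a)"
  shows "bij_betw G {..<b ^ n - 1} (carrier Q - {0})" "G (b ^ n - 1) = 1"
proof -
  define N where "N = b ^ n - 1"
  interpret Qm: comm_monoid Q by (rule comm_monoid_Q)
  interpret U: comm_group "units_of Q" by (rule Qm.units_comm_group)
  have g': "res g \<in> carrier (units_of Q)"
    "generate (units_of Q) {res g} = carrier (units_of Q)"
    using g unfolding unit_group_generator_def by auto
  have pow: "res g [^]\<^bsub>units_of Q\<^esub> a = G a" for a :: nat
    by (induction a) (simp_all add: units_of_one units_of_mult G_def mult.commute)
  have fin: "finite (carrier (units_of Q))" and card: "card (carrier (units_of Q)) = N"
    using card_carrier zero_F n_pos unfolding nonzero_carrier N_def by (auto simp: carrier_Q)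
  have one: "G (N) = 1"
    using U.power_order_eq_one[OF fin g'(1)] unfolding card pow by (simp add: units_of_one)
  have pos: "N > 0" using one_less_power[OF b_gt1 n_pos] by (simp add: N_def)
  have closed: "G a \<in> carrier (units_of Q)" for a
    using U.nat_pow_closed[OF g'(1), of a] by (simp add: pow)
  have surj: "G ` {..<N} = carrier (units_of Q)"
  proof
    show "carrier (units_of Q) \<subseteq> G ` {..<N}"
    proof
      fix u assume "u \<in> carrier (units_of Q)"
      then obtain k :: int where k: "u = res g [^]\<^bsub>units_of Q\<^esub> k"
        using U.generate_pow[OF g'(1)] g'(2) by auto
      define a where "a = nat (k mod int (N))"
      define j where "j = k div int (N)"
      have kk: "k = int a + int (N) * j"
        unfolding a_def j_def using pos by simp
      have "u = (res g [^]\<^bsub>units_of Q\<^esub> int a) \<otimes>\<^bsub>units_of Q\<^esub> ((res g [^]\<^bsub>units_of Q\<^esub> int (N)) [^]\<^bsub>units_of Q\<^esub> j)"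
        unfolding k by (subst kk) (simp only: U.int_pow_mult[OF g'(1)] U.int_pow_pow[OF g'(1)])
      also have "res g [^]\<^bsub>units_of Q\<^esub> int (N) = \<one>\<^bsub>units_of Q\<^esub>"
        unfolding int_pow_int pow one by (simp add: units_of_one)
      finally have "u = G a" using closed by (simp add: int_pow_int pow)
      moreover have "a < N"
        unfolding a_def using pos by (simp add: nat_less_iff)
      ultimately show "u \<in> G ` {..<N}" by blast
    qed
  qed (use closed in blast)
  then have "inj_on G {..<N}"
    by (intro eq_card_imp_inj_on) (simp_all add: card)
  with surj show "bij_betw G {..<b ^ n - 1} (carrier Q - {0})"
    unfolding bij_betw_def nonzero_carrier N_def by simp
  show "G (b ^ n - 1) = 1" using one by (simp add: N_def)
qed

end

section \<open>Laurent expansions\<close>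

text \<open>Division of power series, where \<open>u\<close> is an inverse of the leading coefficient of the divisor with
  coefficients \<open>a\<close>.\<close>

function laurent_digits :: "int \<Rightarrow> int \<Rightarrow> nat \<Rightarrow> (nat \<Rightarrow> int) \<Rightarrow> (nat \<Rightarrow> int) \<Rightarrow> nat \<Rightarrow> int" where
  "laurent_digits b u n a c t =
     (u * (c t - (\<Sum>k<n. if n \<le> k + t then a k * laurent_digits b u n a c (k + t - n) else 0))) mod b"
  by auto
termination
  by (relation "Wellfounded.measure (\<lambda>(b, u, n, a, c, t). t)") auto

declare laurent_digits.simps [simp del]

context irreducible_poly
begin

definition is_laurent :: "int poly \<Rightarrow> (int \<Rightarrow> int) \<Rightarrow> bool" where
  "is_laurent f w \<longleftrightarrow> (\<forall>i. w i \<in> {0..<int b}) \<and> (\<exists>l. \<forall>i<l. w i = 0) \<and>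
     (\<forall>j. [(\<Sum>k\<le>degree p. coeff p k * w (int k + j)) = (if j \<le> 0 then coeff f (nat (- j)) else 0)] (mod int b))"

lemma is_laurentI:
  assumes "\<And>i. w i \<in> {0..<int b}" "\<exists>l. \<forall>i<l. w i = 0"
    "\<And>j. [(\<Sum>k\<le>degree p. coeff p k * w (int k + j)) = (if j \<le> 0 then coeff f (nat (- j)) else 0)] (mod int b)"
  shows "is_laurent f w"
  unfolding is_laurent_def by (intro conjI allI assms)

lemma laurent_cong:
  "is_laurent f w \<Longrightarrow> [(\<Sum>k\<le>degree p. coeff p k * w (int k + j)) = (if j \<le> 0 then coeff f (nat (- j)) else 0)] (mod int b)"
  unfolding is_laurent_def by blast

lemma lead_p: "coeff p n mod int b \<noteq> 0"
  using lead_coeff_Mp_nonzero[of p] p_nonzero deg_p by simp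

lemma laurent_unique:
  assumes "is_laurent f w" "is_laurent f w'"
  shows "w = w'"
proof -
  obtain l l' where l: "\<forall>i<l. w i = 0" "\<forall>i<l'. w' i = 0" using assms unfolding is_laurent_def by blast
  define l0 where "l0 = min l l'"
  have eq: "w (l0 + int t) = w' (l0 + int t)" for t
  proof (induction t rule: less_induct)
    case (less t)
    have IH: "w i = w' i" if "i < l0 + int t" for i
    proof (cases "i < l0")
      case True
      then show ?thesis using l by (simp add: l0_def)
    next
      case False
      then have "w (l0 + int (nat (i - l0))) = w' (l0 + int (nat (i - l0)))"
        using that by (intro less) linarith
      then show ?thesis using False by simp
    qed
    \<comment> \<open>In the equation with this index the leading coefficient of p meets the digit
      at l0 + t, and the other coefficients meet earlier digits, where both series agree.\<close>
    define j where "j = l0 + int t - int n"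
    have "[(\<Sum>k\<le>degree p. coeff p k * w (int k + j)) = (\<Sum>k\<le>degree p. coeff p k * w' (int k + j))] (mod int b)"
      by (rule cong_trans[OF laurent_cong[OF assms(1)] cong_sym[OF laurent_cong[OF assms(2)]]])
    moreover have "(\<Sum>k\<le>degree p. coeff p k * w (int k + j)) =
        coeff p n * w (l0 + int t) + (\<Sum>k<n. coeff p k * w' (int k + j))"
    proof -
      have "(\<Sum>k<n. coeff p k * w (int k + j)) = (\<Sum>k<n. coeff p k * w' (int k + j))"
        by (intro sum.cong refl arg_cong2[where f = "(*)"] IH) (simp add: j_def)
      then show ?thesis unfolding deg_p lessThan_Suc_atMost[symmetric] by (simp add: j_def)
    qed
    moreover have "(\<Sum>k\<le>degree p. coeff p k * w' (int k + j)) =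
        coeff p n * w' (l0 + int t) + (\<Sum>k<n. coeff p k * w' (int k + j))"
      unfolding deg_p lessThan_Suc_atMost[symmetric] by (simp add: j_def)
    ultimately have "[coeff p n * w (l0 + int t) = coeff p n * w' (l0 + int t)] (mod int b)"
      by (simp add: cong_add_rcancel)
    then have "int b dvd coeff p n * (w (l0 + int t) - w' (l0 + int t))"
      by (simp add: cong_iff_dvd_diff algebra_simps)
    then have "int b dvd w (l0 + int t) - w' (l0 + int t)"
      using lead_p prime_b prime_dvd_mult_iff[of "int b"] by (auto simp: dvd_eq_mod_eq_0)
    moreover have "w (l0 + int t) \<in> {0..<int b}" "w' (l0 + int t) \<in> {0..<int b}"
      using assms unfolding is_laurent_def by blast+
    ultimately show ?case
      by (simp add: mod_eq_dvd_iff[symmetric])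
  qed
  show ?thesis
  proof
    fix i
    show "w i = w' i"
    proof (cases "i < l0")
      case True
      then show ?thesis using l by (simp add: l0_def)
    next
      case False
      then show ?thesis using eq[of "nat (i - l0)"] by simp
    qed
  qed
qed

lemma laurent_exists: "\<exists>w. is_laurent f w"
proof -
  obtain u where u: "(u * coeff p n) mod int b = 1" using mod_inverse[OF lead_p] by blast
  \<comment> \<open>Starting this low is safe: if n + j < l, then -j exceeds the degree of f and
    both sides of the congruence vanish.\<close>
  define l where "l = - int (degree f)"
  \<comment> \<open>The right-hand side of the equation that determines digit t, which is the one
    with index j = t + l - n.\<close>
  define c where "c t = (let j = int t + l - int n in if j \<le> 0 then coeff f (nat (- j)) else 0)" for t
  define d where "d = laurent_digits (int b) u n (coeff p) c"
  define w where "w i = (if i < l then 0 else d (nat (i - l)))" for i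
  have range: "w i \<in> {0..<int b}" for i
    unfolding w_def d_def using b_gt1 by (subst laurent_digits.simps) simp
  have "[(\<Sum>k\<le>degree p. coeff p k * w (int k + j)) = (if j \<le> 0 then coeff f (nat (- j)) else 0)] (mod int b)" for j
  proof (cases "int n + j < l")
    case True
    have "(\<Sum>k\<le>degree p. coeff p k * w (int k + j)) = 0"
      by (rule sum.neutral) (use True in \<open>auto simp: deg_p w_def\<close>)
    moreover have "coeff f (nat (- j)) = 0"
      by (rule coeff_eq_0) (use True in \<open>simp add: l_def\<close>)
    ultimately show ?thesis by simp
  next
    case False
    define t where "t = nat (int n + j - l)"
    have j: "j = int t + l - int n" using False by (simp add: t_def)
    have ct: "c t = (if j \<le> 0 then coeff f (nat (- j)) else 0)" unfolding c_def Let_def j ..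
    define S where "S = (\<Sum>k<n. if n \<le> k + t then coeff p k * d (k + t - n) else 0)"
    have S: "(\<Sum>k<n. coeff p k * w (int k + j)) = S"
      unfolding S_def
    proof (intro sum.cong refl)
      fix k
      have "nat (int k + j - l) = k + t - n" by (simp add: j)
      then show "coeff p k * w (int k + j) = (if n \<le> k + t then coeff p k * d (k + t - n) else 0)"
        unfolding w_def by (auto simp: j)
    qed
    have "w (int n + j) = d t" unfolding w_def using False by (simp add: t_def)
    also have "d t = (u * (c t - S)) mod int b"
      unfolding d_def S_def by (subst laurent_digits.simps) simp
    finally have wn: "w (int n + j) = (u * (c t - S)) mod int b" .
    have "(\<Sum>k\<le>degree p. coeff p k * w (int k + j)) = coeff p n * w (int n + j) + S"
      unfolding deg_p lessThan_Suc_atMost[symmetric] using S by simp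
    moreover have "[coeff p n * ((u * (c t - S)) mod int b) = 1 * (c t - S)] (mod int b)"
    proof -
      have "[coeff p n * ((u * (c t - S)) mod int b) = (u * coeff p n) * (c t - S)] (mod int b)"
        by (simp add: cong_def mod_simps mult_ac)
      moreover have "[(u * coeff p n) * (c t - S) = 1 * (c t - S)] (mod int b)"
        by (intro cong_scalar_right) (use u b_gt1 in \<open>simp add: cong_def\<close>)
      ultimately show ?thesis by (rule cong_trans)
    qed
    then have "[coeff p n * ((u * (c t - S)) mod int b) + S = 1 * (c t - S) + S] (mod int b)"
      by (rule cong_add) simp
    ultimately show ?thesis by (simp add: wn ct)
  qed
  moreover have "\<exists>l. \<forall>i<l. w i = 0" by (rule exI[of _ l]) (simp add: w_def)
  ultimately have "is_laurent f w" by (intro is_laurentI range)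
  then show ?thesis by blast
qed

abbreviation lau :: "int poly \<Rightarrow> int \<Rightarrow> int" where
  "lau f \<equiv> laurent_quotient b f p"

lemma is_laurent_lau: "is_laurent f (lau f)"
proof -
  have "lau f = (THE w. is_laurent f w)"
    unfolding laurent_quotient_def is_laurent_def by (rule refl)
  moreover obtain w where w: "is_laurent f w" using laurent_exists[of f] by (rule exE)
  have "is_laurent f (THE w. is_laurent f w)"
    by (rule theI[of "is_laurent f", OF w]) (rule laurent_unique[OF _ w])
  ultimately show ?thesis by simp
qed

lemma lau_eqI: "is_laurent f w \<Longrightarrow> lau f = w"
  by (rule laurent_unique[OF is_laurent_lau])

lemma lau_range: "lau f i \<in> {0..<int b}"
  using is_laurent_lau[of f] unfolding is_laurent_def by blast

text \<open>By uniqueness of the expansion. Digits add modulo b without carries, which is the source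
  of the group structure of the nodes.\<close>

lemma lau_linear: "lau (f + smult c g) i = (lau f i + c * lau g i) mod int b"
proof -
  let ?w = "\<lambda>i. (lau f i + c * lau g i) mod int b"
  have f: "is_laurent f (lau f)" and g: "is_laurent g (lau g)" by (rule is_laurent_lau)+
  obtain l where l: "\<forall>i<l. lau f i = 0" using f unfolding is_laurent_def by blast
  obtain l' where l': "\<forall>i<l'. lau g i = 0" using g unfolding is_laurent_def by blast
  have zero: "\<exists>l. \<forall>i<l. ?w i = 0" by (rule exI[of _ "min l l'"]) (use l l' in simp)
  have "[(\<Sum>k\<le>degree p. coeff p k * ?w (int k + j)) =
      (if j \<le> 0 then coeff (f + smult c g) (nat (- j)) else 0)] (mod int b)" for j
  proof -
    let ?s = "\<lambda>w. \<Sum>k\<le>degree p. coeff p k * w (int k + j)"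
    let ?c = "\<lambda>f. if j \<le> 0 then coeff f (nat (- j)) else (0::int)"
    have "[?s ?w = ?s (\<lambda>i. lau f i + c * lau g i)] (mod int b)"
      by (intro cong_sum cong_mult cong_refl) (simp add: cong_def)
    also have "?s (\<lambda>i. lau f i + c * lau g i) = ?s (lau f) + c * ?s (lau g)"
      by (simp add: algebra_simps sum.distrib sum_distrib_left)
    also have "[\<dots> = ?c f + c * ?c g] (mod int b)"
      by (rule cong_add[OF laurent_cong[OF f] cong_mult[OF cong_refl laurent_cong[OF g]]])
    also have "?c f + c * ?c g = ?c (f + smult c g)" by simp
    finally show ?thesis .
  qed
  moreover have "?w i \<in> {0..<int b}" for i using b_gt1 by simp
  ultimately have "is_laurent (f + smult c g) ?w" by (intro is_laurentI zero)
  then show ?thesis by (simp add: lau_eqI)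
qed

lemma lau_Mp:
  assumes "Mp f = Mp g"
  shows "lau f = lau g"
proof -
  have fg: "[coeff g i = coeff f i] (mod int b)" for i
    using arg_cong[OF assms, of "\<lambda>h. coeff h i"] by (simp add: Mp_coeff M_def cong_def)
  then have "[(if j \<le> 0 then coeff g (nat (- j)) else 0) = (if j \<le> 0 then coeff f (nat (- j)) else 0)] (mod int b)" for j :: int
    by simp
  then have "[(\<Sum>k\<le>degree p. coeff p k * lau g (int k + j)) = (if j \<le> 0 then coeff f (nat (- j)) else 0)] (mod int b)" for j
    by (rule cong_trans[OF laurent_cong[OF is_laurent_lau]])
  moreover have "\<exists>l. \<forall>i<l. lau g i = 0" using is_laurent_lau[of g] unfolding is_laurent_def by blast
  ultimately have "is_laurent f (lau g)" by (intro is_laurentI lau_range)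
  then show ?thesis by (rule lau_eqI)
qed

text \<open>The quotient p h / p is the polynomial h, whose expansion has no negative powers of X;
  \<open>?w\<close> is h modulo b written as such a series.\<close>

lemma lau_multiple:
  assumes i: "i \<ge> 1"
  shows "lau (p * h) i = 0"
proof -
  let ?w = "\<lambda>i. if i \<le> 0 then coeff h (nat (- i)) mod int b else 0"
  have "[(\<Sum>k\<le>degree p. coeff p k * ?w (int k + j)) = (if j \<le> 0 then coeff (p * h) (nat (- j)) else 0)] (mod int b)" for j
  proof (cases "j \<le> 0")
    case False
    then show ?thesis by simp
  next
    case True
    define J where "J = nat (- j)"
    have j: "j = - int J" using True by (simp add: J_def)
    let ?g = "\<lambda>k. if k \<le> J then coeff p k * coeff h (J - k) else 0"
    have "[(\<Sum>k\<le>degree p. coeff p k * ?w (int k + j)) = (\<Sum>k\<le>degree p. ?g k)] (mod int b)"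
    proof (rule cong_sum)
      fix k
      have "nat (- (int k + j)) = J - k" by (simp add: j)
      then show "[coeff p k * ?w (int k + j) = ?g k] (mod int b)"
        by (auto simp: j cong_def mod_simps)
    qed
    also have "(\<Sum>k\<le>degree p. ?g k) = (\<Sum>k\<le>max (degree p) J. ?g k)"
      by (rule sum.mono_neutral_left) (auto simp: coeff_eq_0)
    also have "\<dots> = (\<Sum>k\<le>J. ?g k)"
      by (rule sum.mono_neutral_right) auto
    also have "\<dots> = coeff (p * h) J" by (simp add: coeff_mult)
    finally show ?thesis using True by (simp add: J_def)
  qed
  moreover have "\<exists>l. \<forall>i<l. ?w i = 0"
  proof (rule exI[of _ "- int (degree h)"], intro allI impI)
    fix i assume "i < - int (degree h)"
    then have "coeff h (nat (- i)) = 0" by (intro coeff_eq_0) linarith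
    then show "?w i = 0" by simp
  qed
  moreover have "?w i \<in> {0..<int b}" for i using b_gt1 by simp
  ultimately have "is_laurent (p * h) ?w" by (intro is_laurentI)
  then show ?thesis using i by (simp add: lau_eqI)
qed

text \<open>Changing f by a multiple of p changes only the polynomial part of f/p. Nodes therefore
  depend on residues alone, hence on exponents of g.\<close>

lemma lau_residue:
  assumes i: "i \<ge> 1" and "res f = res g"
  shows "lau f i = lau g i"
proof -
  have "p dvdm f - g" using assms by (simp add: residue_eq_iff)
  then obtain h where "Mp (f - g) = Mp (p * h)" unfolding dvdm_def by blast
  then have "Mp (g + Mp (f - g)) = Mp (g + Mp (p * h))" by (simp only:)
  then have "Mp f = Mp (g + smult 1 (p * h))" by simp
  then have "lau f = lau (g + smult 1 (p * h))" by (rule lau_Mp)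
  then have "lau f i = lau (g + smult 1 (p * h)) i" by simp
  also have "\<dots> = lau g i" unfolding lau_linear using lau_multiple[OF i] lau_range[of g i] by simp
  finally show ?thesis .
qed

end

section \<open>Walsh series\<close>

lemma digit_sum:
  assumes "\<And>t. t < n \<Longrightarrow> d t < b"
  shows "(\<Sum>t<n. d t * b ^ t) < b ^ n" "t < n \<Longrightarrow> digit b (\<Sum>t<n. d t * b ^ t) t = d t"
proof -
  have "(\<Sum>t<n. d t * b ^ t) < b ^ n \<and> (\<forall>t<n. digit b (\<Sum>t<n. d t * b ^ t) t = d t)"
    using assms
  proof (induction n arbitrary: d)
    case (Suc n)
    let ?S = "\<Sum>t<n. d (Suc t) * b ^ t"
    have S: "(\<Sum>t<Suc n. d t * b ^ t) = d 0 + b * ?S"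
      by (subst sum.lessThan_Suc_shift) (simp add: sum_distrib_left mult_ac)
    have d0: "d 0 < b" using Suc.prems by simp
    have IH: "?S < b ^ n" "\<And>t. t < n \<Longrightarrow> digit b ?S t = d (Suc t)"
      using Suc.IH[of "\<lambda>t. d (Suc t)"] Suc.prems by auto
    have "b * (?S + 1) \<le> b * b ^ n" using IH(1) by (intro mult_le_mono2) simp
    then have "d 0 + b * ?S < b ^ Suc n" using d0 by simp
    moreover have "digit b (d 0 + b * ?S) t = d t" if "t < Suc n" for t
      using that d0 IH(2) by (cases t) (simp_all add: digit_0 digit_Suc)
    ultimately show ?case unfolding S by blast
  qed simp
  then show "(\<Sum>t<n. d t * b ^ t) < b ^ n" "t < n \<Longrightarrow> digit b (\<Sum>t<n. d t * b ^ t) t = d t" by blast+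
qed

lemma digit_add_power:
  assumes "b > 1" "h < b ^ m" "c < b"
  shows "digit b (c * b ^ m + h) t = (if t = m then c else digit b h t)"
proof -
  consider "t < m" | "t = m" | "t > m" by linarith
  then show ?thesis
  proof cases
    case 1
    then obtain u where u: "m = t + Suc u" using less_iff_Suc_add by auto
    have e: "c * b ^ m + h = h + c * b ^ u * b * b ^ t" unfolding u by (simp add: power_add mult_ac)
    have "(c * b ^ m + h) div b ^ t = c * b ^ u * b + h div b ^ t"
      unfolding e by (subst div_mult_self1) (use assms(1) in simp_all)
    then show ?thesis using 1 by (simp add: digit_def)
  next
    case 2
    have "(c * b ^ m + h) div b ^ m = c" using assms by (simp add: div_mult_self1)
    then show ?thesis using 2 assms by (simp add: digit_def)
  next
    case 3
    have "c * b ^ m + h < Suc c * b ^ m" using assms by simp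
    also have "\<dots> \<le> b * b ^ m" using assms by (intro mult_le_mono1) simp
    finally have "c * b ^ m + h < b ^ Suc m" by simp
    then have "digit b (c * b ^ m + h) t = 0" using 3 by (intro digit_ge[OF assms(1), of _ "Suc m"]) simp_all
    moreover have "digit b h t = 0" using 3 assms by (intro digit_ge[OF assms(1,2)]) simp
    ultimately show ?thesis using 3 by simp
  qed
qed

lemma sum_block:
  fixes f :: "nat \<Rightarrow> 'a::comm_monoid_add"
  shows "(\<Sum>h<b ^ Suc m. f h) = (\<Sum>c<b. \<Sum>h<b ^ m. f (c * b ^ m + h))"
proof -
  have "(\<Sum>h<b ^ Suc m. f h) = (\<Sum>c<b. sum f {c * b ^ m..<c * b ^ m + b ^ m})"
    by (simp add: sum.nat_group)
  also have "\<dots> = (\<Sum>c<b. \<Sum>h<b ^ m. f (c * b ^ m + h))"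
  proof (rule sum.cong[OF refl])
    fix c
    show "sum f {c * b ^ m..<c * b ^ m + b ^ m} = (\<Sum>h<b ^ m. f (c * b ^ m + h))"
      using sum.shift_bounds_nat_ivl[of f 0 "c * b ^ m" "b ^ m"]
      by (simp add: add.commute lessThan_atLeast0)
  qed
  finally show ?thesis .
qed

text \<open>Splitting off the leading digit c of the index factors the sum into the sum over shorter
  indices and a geometric sum over c, equal to b or 0. Additivity is asked for only when a leading
  digit is added, where no carry occurs. The lemma serves both the regular grid and the lattice
  nodes.\<close>

lemma character_sum:
  assumes b: "b > 1" and L0: "b dvd F 0"
    and add: "\<And>i h c. i < m \<Longrightarrow> h < b ^ i \<Longrightarrow> c < b \<Longrightarrow> [F (c * b ^ i + h) = F h + c * F (b ^ i)] (mod b)"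
  shows "(\<Sum>h<b ^ m. zeta b ^ F h) = (if \<forall>i<m. b dvd F (b ^ i) then of_nat (b ^ m) else 0)"
  using add
proof (induction m)
  case 0
  then show ?case using L0 b by (simp add: zeta_power_eq_1_iff)
next
  case (Suc m)
  have b0: "b > 0" using b by simp
  have "(\<Sum>h<b ^ Suc m. zeta b ^ F h) = (\<Sum>c<b. \<Sum>h<b ^ m. zeta b ^ F h * zeta b ^ (c * F (b ^ m)))"
    unfolding sum_block
  proof (intro sum.cong refl)
    fix c h assume "c \<in> {..<b}" "h \<in> {..<b ^ m}"
    then have "[F (c * b ^ m + h) = F h + c * F (b ^ m)] (mod b)" by (intro Suc.prems) auto
    then have "zeta b ^ F (c * b ^ m + h) = zeta b ^ (F h + c * F (b ^ m))" by (rule zeta_power_cong[OF b0])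
    then show "zeta b ^ F (c * b ^ m + h) = zeta b ^ F h * zeta b ^ (c * F (b ^ m))" by (simp add: power_add)
  qed
  also have "\<dots> = (\<Sum>h<b ^ m. zeta b ^ F h) * (\<Sum>c<b. zeta b ^ (c * F (b ^ m)))"
    by (simp only: sum_distrib_right[symmetric] sum_distrib_left[symmetric])
  also have "(\<Sum>h<b ^ m. zeta b ^ F h) = (if \<forall>i<m. b dvd F (b ^ i) then of_nat (b ^ m) else 0)"
    by (rule Suc.IH) (use Suc.prems in auto)
  also have "(\<Sum>c<b. zeta b ^ (c * F (b ^ m))) = (if b dvd F (b ^ m) then of_nat b else 0)"
    by (rule sum_zeta_power[OF b0])
  finally show ?case by (auto simp: less_Suc_eq)
qed

lemma real_digit_nat_div:
  assumes "b > 1"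
  shows "real_digit b (real V / real b ^ n) i = (if i \<le> n then digit b V (n - i) else 0)"
proof (cases "i \<le> n")
  case True
  have "real b ^ n = real b ^ (n - i) * real b ^ i" using True by (simp flip: power_add)
  then have "real V / real b ^ n * real b ^ i = real V / real (b ^ (n - i))" using assms by simp
  then have "\<lfloor>real V / real b ^ n * real b ^ i\<rfloor> = int (V div b ^ (n - i))"
    by (simp only: floor_divide_of_nat_eq)
  then show ?thesis using True by (simp add: real_digit_def digit_def nat_mod_distrib flip: of_nat_mod zmod_int)
next
  case False
  then obtain u where u: "i = n + Suc u" using less_iff_Suc_add[of n i] by auto
  have "real V / real b ^ n * real b ^ i = real (V * b ^ u * b)"
    using assms by (simp add: u power_add)
  then have "\<lfloor>real V / real b ^ n * real b ^ i\<rfloor> = int (V * b ^ u * b)" by linarith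
  then show ?thesis using False by (simp add: real_digit_def)
qed

lemma wal_zeta: "wal b k x = zeta b ^ (\<Sum>i\<in>digit_support b k. real_digit b x (i + 1) * digit b k i)"
  unfolding wal_def zeta_power by simp

lemma wal_0 [simp]: "wal b 0 x = 1"
  by (simp add: wal_zeta digit_support_def digit_def)

lemma norm_wal [simp]: "norm (wal b k x) = 1"
  by (simp add: wal_zeta norm_power)

section \<open>Decay and summability of the Walsh weights\<close>

lemma r_walsh_nonneg [simp]: "r_walsh b \<alpha> k \<ge> 0"
  by (simp add: r_walsh_def)

lemma r_walsh_pos: "b > 0 \<Longrightarrow> r_walsh b \<alpha> k > 0"
  by (simp add: r_walsh_def)

lemma r_walsh_le_1: "b > 0 \<Longrightarrow> r_walsh b \<alpha> k \<le> 1"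
  by (simp add: r_walsh_def)

lemma leading_positions_add_power:
  assumes b: "b > 1" and h: "h < b ^ a" and c: "0 < c" "c < b"
  shows "leading_positions b (c * b ^ a + h) = a # leading_positions b h"
proof -
  have S: "digit_support b (c * b ^ a + h) = insert a (digit_support b h)"
    unfolding digit_support_def using digit_add_power[OF b h c(2)] c(1) digit_ge[OF b h, of a] by auto
  have sub: "digit_support b h \<subseteq> {..<a}" by (rule digit_support_subset[OF b h])
  have fin: "finite (digit_support b h)" by (rule finite_digit_support[OF b])
  let ?l = "sorted_list_of_set (digit_support b h) @ [a]"
  have "sorted ?l" "distinct ?l" using fin sub by (auto simp: sorted_append less_imp_le)
  then have "sorted_list_of_set (set ?l) = ?l" by (rule sorted_list_of_set.idem_if_sorted_distinct)
  moreover have "set ?l = insert a (digit_support b h)" using fin by simp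
  ultimately have "sorted_list_of_set (insert a (digit_support b h)) = ?l" by (simp only:)
  then show ?thesis unfolding leading_positions_def S by simp
qed

text \<open>The new leading digit takes one of the available factors and leaves one fewer for the
  digits of h.\<close>

lemma r_walsh_add_power:
  assumes "b > 1" "h < b ^ a" "0 < c" "c < b"
  shows "r_walsh b (Suc \<alpha>) (c * b ^ a + h) = r_walsh b \<alpha> h / real b ^ (a + 1)"
  unfolding r_walsh_def leading_positions_add_power[OF assms] by (simp add: power_add)

lemma r_walsh_0_arg [simp]: "r_walsh b \<alpha> 0 = 1"
  by (simp add: r_walsh_def leading_positions_def digit_support_def digit_def)

lemma sum_r_walsh_Suc:
  assumes b: "b > 1"
  shows "(\<Sum>k<b ^ Suc a. r_walsh b (Suc \<alpha>) k) =
    (\<Sum>k<b ^ a. r_walsh b (Suc \<alpha>) k) + real (b - 1) / real b ^ (a + 1) * (\<Sum>k<b ^ a. r_walsh b \<alpha> k)"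
proof -
  have "(\<Sum>k<b ^ Suc a. r_walsh b (Suc \<alpha>) k) = (\<Sum>c<b. \<Sum>h<b ^ a. r_walsh b (Suc \<alpha>) (c * b ^ a + h))"
    by (rule sum_block)
  also have "\<dots> = (\<Sum>h<b ^ a. r_walsh b (Suc \<alpha>) h) + (\<Sum>c\<in>{1..<b}. \<Sum>h<b ^ a. r_walsh b (Suc \<alpha>) (c * b ^ a + h))"
    using b by (simp add: lessThan_atLeast0 sum.atLeast_Suc_lessThan)
  also have "(\<Sum>c\<in>{1..<b}. \<Sum>h<b ^ a. r_walsh b (Suc \<alpha>) (c * b ^ a + h)) =
      (\<Sum>c\<in>{1..<b}. \<Sum>h<b ^ a. r_walsh b \<alpha> h / real b ^ (a + 1))"
    by (intro sum.cong refl r_walsh_add_power b) auto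
  also have "\<dots> = real (b - 1) / real b ^ (a + 1) * (\<Sum>k<b ^ a. r_walsh b \<alpha> k)"
    by (simp add: sum_divide_distrib[symmetric])
  finally show ?thesis .
qed

text \<open>With one factor secured, the block of indices with leading position a adds at most (b -
  1)/b.\<close>

lemma sum_r_walsh_linear:
  assumes b: "b > 1"
  shows "(\<Sum>k<b ^ a. r_walsh b (Suc \<alpha>) k) \<le> 1 + real a"
proof (induction a)
  case (Suc a)
  have "(\<Sum>k<b ^ a. r_walsh b \<alpha> k) \<le> (\<Sum>k<b ^ a. 1)"
    by (intro sum_mono r_walsh_le_1) (use b in simp)
  then have "real (b - 1) / real b ^ (a + 1) * (\<Sum>k<b ^ a. r_walsh b \<alpha> k) \<le> real (b - 1) / real b ^ (a + 1) * real b ^ a"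
    by (intro mult_left_mono) simp_all
  also have "\<dots> = real (b - 1) / real b" using b by simp
  also have "\<dots> \<le> 1" using b by simp
  finally show ?case unfolding sum_r_walsh_Suc[OF b] using Suc by simp
qed simp

text \<open>With two factors secured, the block at a adds at most (a + 1)/2^a, which is exactly the
  increment of the right-hand side; at a = 0 both sides are 1. Boundedness of the sums under
  \<alpha> > 1 comes from here.\<close>

lemma sum_r_walsh_bound:
  assumes b: "b > 1"
  shows "(\<Sum>k<b ^ a. r_walsh b (Suc (Suc \<alpha>)) k) \<le> 5 - 2 * (real a + 2) / 2 ^ a"
proof (induction a)
  case (Suc a)
  have "real (b - 1) / real b ^ (a + 1) \<le> real b / real b ^ (a + 1)"
    by (intro divide_right_mono) simp_all
  also have "\<dots> = 1 / real b ^ a" using b by simp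
  also have "\<dots> \<le> 1 / 2 ^ a"
    using b by (intro divide_left_mono power_mono) simp_all
  finally have "real (b - 1) / real b ^ (a + 1) * (\<Sum>k<b ^ a. r_walsh b (Suc \<alpha>) k) \<le> 1 / 2 ^ a * (1 + real a)"
    by (intro mult_mono sum_r_walsh_linear b) (simp_all add: sum_nonneg)
  moreover have "2 * (real a + 2) / 2 ^ a - 1 / 2 ^ a * (1 + real a) = 2 * (real (Suc a) + 2) / 2 ^ Suc a"
    by (simp add: field_simps)
  ultimately show ?case unfolding sum_r_walsh_Suc[OF b] using Suc by linarith
qed simp

lemma summable_r_walsh:
  assumes b: "b > 1" and \<alpha>: "\<alpha> > 1"
  shows "summable (r_walsh b \<alpha>)"
proof (rule summableI_nonneg_bounded)
  obtain \<beta> where \<beta>: "\<alpha> = Suc (Suc \<beta>)" using \<alpha> by (metis One_nat_def Suc_lessE less_imp_Suc_add)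
  fix N
  have "(\<Sum>k<N. r_walsh b \<alpha> k) \<le> (\<Sum>k<b ^ N. r_walsh b \<alpha> k)"
    by (rule sum_mono2) (use less_power_self[OF b, of N] in auto)
  also have "\<dots> \<le> 5 - 2 * (real N + 2) / 2 ^ N" unfolding \<beta> by (rule sum_r_walsh_bound[OF b])
  also have "\<dots> \<le> 5" by simp
  finally show "(\<Sum>k<N. r_walsh b \<alpha> k) \<le> 5" .
qed simp

section \<open>Integrals of Walsh functions and of Walsh series\<close>

lemma wal_cell:
  assumes b: "b > 1" and k: "k < b ^ a" and x: "0 \<le> x"
  shows "wal b k x = wal b k (real (nat \<lfloor>x * real b ^ a\<rfloor>) / real b ^ a)"
proof -
  let ?J = "nat \<lfloor>x * real b ^ a\<rfloor>"
  have J: "int ?J = \<lfloor>x * real b ^ a\<rfloor>" using x by simp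
  have "real_digit b x (i + 1) = real_digit b (real ?J / real b ^ a) (i + 1)" if i: "i \<in> digit_support b k" for i
  proof -
    have ia: "i + 1 \<le> a" using subsetD[OF digit_support_subset[OF b k] i] by simp
    define u where "u = a - (i + 1)"
    have e: "a = (i + 1) + u" using ia by (simp add: u_def)
    have "x * real b ^ (i + 1) = x * real b ^ a / real_of_int (int b ^ u)"
      unfolding e power_add using b by simp
    then have "\<lfloor>x * real b ^ (i + 1)\<rfloor> = \<lfloor>x * real b ^ a / real_of_int (int b ^ u)\<rfloor>" by (rule arg_cong)
    also have "\<dots> = \<lfloor>x * real b ^ a\<rfloor> div (int b ^ u)" by (rule floor_divide_real_eq_div) simp
    also have "\<dots> = int (?J div b ^ u)" by (simp only: zdiv_int of_nat_power J)
    finally have "real_digit b x (i + 1) = nat (int (?J div b ^ u) mod int b)"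
      unfolding real_digit_def by (rule arg_cong)
    also have "\<dots> = ?J div b ^ u mod b" by (simp only: zmod_int[symmetric] nat_int)
    finally show ?thesis unfolding real_digit_nat_div[OF b] using ia by (simp add: digit_def u_def)
  qed
  then show ?thesis unfolding wal_zeta
    by (intro arg_cong[where f = "\<lambda>e. zeta b ^ e"] sum.cong refl arg_cong2[where f = "(*)"])
qed

lemma sum_wal_grid:
  assumes b: "b > 1" and k: "k < b ^ a"
  shows "(\<Sum>j<b ^ a. wal b k (real j / real b ^ a)) = (if k = 0 then of_nat (b ^ a) else 0)"
proof -
  \<comment> \<open>Digit i + 1 of j/b^a is digit a - 1 - i of j, so the exponent pairs the digits
    of k with those of j in reverse order. Hence F at b^i picks out digit a - 1 - i of k, and all
    these values vanish modulo b only for k = 0.\<close>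
  define F where "F j = (\<Sum>i\<in>digit_support b k. digit b j (a - Suc i) * digit b k i)" for j
  have sub: "digit_support b k \<subseteq> {..<a}" by (rule digit_support_subset[OF b k])
  have fin: "finite (digit_support b k)" by (rule finite_digit_support[OF b])
  have wal: "wal b k (real j / real b ^ a) = zeta b ^ F j" for j
    unfolding wal_zeta F_def real_digit_nat_div[OF b]
    by (intro arg_cong[where f = "\<lambda>e. zeta b ^ e"] sum.cong refl) (use sub in auto)
  have add: "F (c * b ^ i + h) = F h + c * F (b ^ i)" if "h < b ^ i" "c < b" for i h c
  proof -
    have p: "digit b (b ^ i) t = (if t = i then 1 else 0)" for t
      using digit_add_power[OF b, of 0 i 1 t] b by (simp add: digit_def)
    have "digit b h i = 0" using digit_ge[OF b that(1)] by simp
    then have "digit b (c * b ^ i + h) t = digit b h t + c * digit b (b ^ i) t" for t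
      unfolding p digit_add_power[OF b that] by simp
    then show ?thesis unfolding F_def by (simp add: algebra_simps sum.distrib sum_distrib_left)
  qed
  have Fp: "F (b ^ i) = digit b k (a - Suc i)" if "i < a" for i
  proof -
    have p: "digit b (b ^ i) t = (if t = i then 1 else 0)" for t
      using digit_add_power[OF b, of 0 i 1 t] b by (simp add: digit_def)
    have "F (b ^ i) = (\<Sum>j\<in>digit_support b k. if j = a - Suc i then digit b k j else 0)"
      unfolding F_def p by (intro sum.cong refl) (use sub that in auto)
    also have "\<dots> = digit b k (a - Suc i)"
      using fin by (simp add: digit_support_def)
    finally show ?thesis .
  qed
  have F0: "F 0 = 0" by (simp add: F_def digit_def)
  have "(\<Sum>j<b ^ a. zeta b ^ F j) = (if \<forall>i<a. b dvd F (b ^ i) then of_nat (b ^ a) else 0)"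
    by (rule character_sum[OF b]) (simp_all add: F0 add)
  also have "(\<forall>i<a. b dvd F (b ^ i)) \<longleftrightarrow> k = 0"
  proof
    assume *: "\<forall>i<a. b dvd F (b ^ i)"
    have "digit b k i = 0" for i
    proof (cases "i < a")
      case True
      then have "b dvd digit b k i" using *[rule_format, of "a - Suc i"] Fp[of "a - Suc i"] by simp
      moreover have "digit b k i < b" using b by (simp add: digit_def)
      ultimately show ?thesis using dvd_imp_le by fastforce
    qed (use digit_ge[OF b k] in simp)
    then have "poly_of_nat b k = 0" by (simp add: poly_of_nat_def digit_support_def)
    then show "k = 0" using nat_of_poly_of_nat[OF b, of k] nat_of_poly_of_nat[OF b, of 0] poly_of_nat_0 by simp
  next
    assume "k = 0"
    then show "\<forall>i<a. b dvd F (b ^ i)" using Fp by (simp add: digit_def)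
  qed
  finally show ?thesis by (simp add: wal)
qed

text \<open>For k < b^a, \<open>wal b k\<close> is a step function on the cells of length b^-a, so
  integrability and the value follow from the sum over the grid.\<close>

lemma has_integral_wal:
  assumes b: "b > 1"
  shows "has_bochner_integral lborel (\<lambda>x. indicator {0..<1} x *\<^sub>R wal b k x) (if k = 0 then 1 else 0)"
proof -
  \<comment> \<open>Any a with k < b^a serves, and a = k is one.\<close>
  define a where "a = k"
  have k: "k < b ^ a" unfolding a_def by (rule less_power_self[OF b])
  define N where "N = real b ^ a"
  have N: "N > 0" using b by (simp add: N_def)
  let ?I = "\<lambda>j. {real j / N..<(real j + 1) / N}"
  have eq: "indicator {0..<1} x *\<^sub>R wal b k x = (\<Sum>j<b ^ a. indicator (?I j) x *\<^sub>R wal b k (real j / N))" for x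
  proof (cases "0 \<le> x \<and> x < 1")
    case True
    define J where "J = nat \<lfloor>x * N\<rfloor>"
    have J: "real J \<le> x * N" "x * N < real J + 1" unfolding J_def using True N by simp_all
    have "x * N < N" using True N by simp
    then have "real J < real b ^ a" using J(1) unfolding N_def by linarith
    then have JN: "J < b ^ a" unfolding of_nat_power[symmetric] of_nat_less_iff .
    have iff: "x \<in> ?I j \<longleftrightarrow> j = J" for j
    proof
      assume "x \<in> ?I j"
      then have "real j \<le> x * N" "x * N < real j + 1" using N by (simp_all add: field_simps)
      then show "j = J" using J by linarith
    next
      assume "j = J"
      then show "x \<in> ?I j" using J N by (simp add: field_simps)
    qed
    have "(\<Sum>j<b ^ a. indicator (?I j) x *\<^sub>R wal b k (real j / N)) = (\<Sum>j<b ^ a. if j = J then wal b k (real j / N) else 0)"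
    proof (rule sum.cong[OF refl])
      fix j
      have "indicator (?I j) x = (if j = J then 1 else 0 :: real)" unfolding indicator_def iff by simp
      then show "indicator (?I j) x *\<^sub>R wal b k (real j / N) = (if j = J then wal b k (real j / N) else 0)"
        by (cases "j = J") (simp_all only: if_True if_False simp_thms scaleR_one scaleR_zero_left)
    qed
    also have "\<dots> = wal b k (real J / N)" using JN by simp
    also have "\<dots> = wal b k x" using wal_cell[OF b k, of x] True by (simp add: J_def N_def)
    finally show ?thesis using True by simp
  next
    case False
    have nin: "x \<notin> ?I j" if "j < b ^ a" for j
    proof
      assume "x \<in> ?I j"
      then have j: "real j / N \<le> x" "x < (real j + 1) / N" by auto
      have "0 \<le> real j / N" using N by simp
      moreover have "(real j + 1) / N \<le> 1"
      proof -
        have "real (Suc j) \<le> real (b ^ a)" using that by (simp only: of_nat_le_iff Suc_le_eq)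
        then show ?thesis using N by (simp add: N_def)
      qed
      ultimately show False using False j by linarith
    qed
    have "indicator (?I j) x = (0::real)" if "j < b ^ a" for j
      by (rule indicator_simps(2)[OF nin[OF that]])
    then have "(\<Sum>j<b ^ a. indicator (?I j) x *\<^sub>R wal b k (real j / N)) = 0"
      by (intro sum.neutral ballI) (simp only: lessThan_iff scaleR_zero_left)
    moreover have "indicator {0..<1} x = (0::real)" using False by (simp add: indicator_def)
    ultimately show ?thesis by (simp only: scaleR_zero_left)
  qed
  have "has_bochner_integral lborel (\<lambda>x. \<Sum>j<b ^ a. indicator (?I j) x *\<^sub>R wal b k (real j / N))
      (\<Sum>j<b ^ a. measure lborel (?I j) *\<^sub>R wal b k (real j / N))"
    by (intro has_bochner_integral_sum has_bochner_integral_indicator) (use N in \<open>simp_all add: divide_right_mono\<close>)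
  moreover have "measure lborel (?I j) = 1 / N" for j
    using N by (simp add: divide_right_mono diff_divide_distrib[symmetric])
  moreover have "(\<Sum>j<b ^ a. (1 / N) *\<^sub>R wal b k (real j / N)) = (if k = 0 then 1 else 0)"
    unfolding scaleR_sum_right[symmetric] N_def sum_wal_grid[OF b k] using b by (simp add: scaleR_conv_of_real)
  ultimately show ?thesis by (simp add: eq)
qed

lemma indicator_unit_cube:
  assumes "x \<in> space (\<Pi>\<^sub>M j\<in>{1..d}. lborel)"
  shows "indicator (unit_cube d) x = (\<Prod>j\<in>{1..d}. indicator {0..<1} (x j) :: real)"
proof -
  have "x \<in> extensional {1..d}" using assms by (auto simp: space_PiM PiE_def)
  then have "x \<in> unit_cube d \<longleftrightarrow> (\<forall>j\<in>{1..d}. x j \<in> {0..<1})" by (auto simp: unit_cube_def PiE_def Pi_def)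
  then show ?thesis by (auto simp: indicator_def prod_zero_iff)
qed

lemma integral_wal_vec:
  assumes b: "b > 1" and k: "k \<in> freqs d"
  shows "integrable (\<Pi>\<^sub>M j\<in>{1..d}. lborel) (\<lambda>x. indicator (unit_cube d) x *\<^sub>R wal_vec b d k x)"
    and "(\<integral>x. indicator (unit_cube d) x *\<^sub>R wal_vec b d k x \<partial>(\<Pi>\<^sub>M j\<in>{1..d}. lborel)) =
      (if k = (\<lambda>j\<in>{1..d}. 0) then 1 else 0)"
proof -
  interpret product_sigma_finite "\<lambda>_::nat. lborel :: real measure"
    by standard
  let ?M = "\<Pi>\<^sub>M j\<in>{1..d}. (lborel :: real measure)"
  let ?f = "\<lambda>j x. indicator {0..<1} x *\<^sub>R wal b (k j) x"
  have eq: "indicator (unit_cube d) x *\<^sub>R wal_vec b d k x = (\<Prod>j\<in>{1..d}. ?f j (x j))" if "x \<in> space ?M" for x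
    unfolding indicator_unit_cube[OF that] wal_vec_def scaleR_conv_of_real by (simp add: prod.distrib)
  have int: "integrable lborel (?f j)" and val: "integral\<^sup>L lborel (?f j) = (if k j = 0 then 1 else 0)" for j
    using has_integral_wal[OF b, of "k j"] by (auto simp: has_bochner_integral_iff)
  show "integrable ?M (\<lambda>x. indicator (unit_cube d) x *\<^sub>R wal_vec b d k x)"
    by (subst Bochner_Integration.integrable_cong[OF refl eq]) (auto intro!: product_integrable_prod int)
  have "(\<integral>x. indicator (unit_cube d) x *\<^sub>R wal_vec b d k x \<partial>?M) = (\<integral>x. (\<Prod>j\<in>{1..d}. ?f j (x j)) \<partial>?M)"
    by (rule Bochner_Integration.integral_cong[OF refl eq])
  also have "\<dots> = (\<Prod>j\<in>{1..d}. integral\<^sup>L lborel (?f j))"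
    by (rule product_integral_prod) (auto intro: int)
  also have "\<dots> = (\<Prod>j\<in>{1..d}. if k j = 0 then 1 else 0)"
    by (simp only: val)
  also have "\<dots> = (if k = (\<lambda>j\<in>{1..d}. 0) then 1 else 0)"
  proof (cases "\<forall>j\<in>{1..d}. k j = 0")
    case True
    then have "k = (\<lambda>j\<in>{1..d}. 0)" using k by (auto simp: freqs_def PiE_def extensional_def fun_eq_iff)
    then show ?thesis by simp
  next
    case False
    then obtain j where j: "j \<in> {1..d}" "k j \<noteq> 0" by blast
    then have "k \<noteq> (\<lambda>j\<in>{1..d}. 0)" by auto
    moreover have "(\<Prod>j\<in>{1..d}. if k j = 0 then 1 else 0 :: complex) = 0"
      by (rule prod_zero) (use j in auto)
    ultimately show ?thesis by simp
  qed
  finally show "(\<integral>x. indicator (unit_cube d) x *\<^sub>R wal_vec b d k x \<partial>?M) = (if k = (\<lambda>j\<in>{1..d}. 0) then 1 else 0)" .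
qed

lemma norm_wal_vec [simp]: "norm (wal_vec b d k x) = 1"
  by (simp add: wal_vec_def prod_norm[symmetric])

lemma zero_freqs: "(\<lambda>j\<in>{1..d}. 0) \<in> freqs d"
  by (auto simp: freqs_def)

lemma countable_freqs: "countable (freqs d)"
  unfolding freqs_def by (rule countable_PiE) auto

lemma infinite_freqs:
  assumes "d \<ge> 1"
  shows "infinite (freqs d)"
proof -
  have "inj (\<lambda>k. \<lambda>j\<in>{1..d}. k :: nat)"
    by (rule injI) (use assms in \<open>auto simp: fun_eq_iff restrict_def split: if_splits\<close>)
  moreover have "range (\<lambda>k. \<lambda>j\<in>{1..d}. k :: nat) \<subseteq> freqs d" by (auto simp: freqs_def)
  ultimately show ?thesis using range_inj_infinite infinite_super by blast
qed

text \<open>Integration term by term along an enumeration of the frequencies, justified by the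
  absolute summability of the coefficients; every nonzero frequency integrates to 0.\<close>

lemma integral_walsh_series:
  assumes b: "b > 1" and d: "d \<ge> 1" and c: "(\<lambda>k. norm (c k)) summable_on freqs d"
    and f: "\<And>x. x \<in> unit_cube d \<Longrightarrow> ((\<lambda>k. c k * wal_vec b d k x) has_sum f x) (freqs d)"
  shows "set_lebesgue_integral (\<Pi>\<^sub>M j\<in>{1..d}. lborel) (unit_cube d) f = c (\<lambda>j\<in>{1..d}. 0)"
proof -
  let ?M = "\<Pi>\<^sub>M j\<in>{1..d}. (lborel :: real measure)" and ?z = "\<lambda>j\<in>{1..d}. 0 :: nat"
  define e where "e = from_nat_into (freqs d)"
  have e: "bij_betw e UNIV (freqs d)"
    unfolding e_def by (rule bij_betw_from_nat_into[OF countable_freqs infinite_freqs[OF d]])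
  have ef: "e n \<in> freqs d" for n using e by (auto simp: bij_betw_def)
  have sc: "summable (\<lambda>n. norm (c (e n)))"
    using c summable_on_reindex_bij_betw[OF e, of "\<lambda>k. norm (c k)"] summable_on_imp_summable by blast
  define g where "g n x = c (e n) * (indicator (unit_cube d) x *\<^sub>R wal_vec b d (e n) x)" for n x
  have int: "integrable ?M (g n)" for n
    unfolding g_def by (intro integrable_mult_right integral_wal_vec b ef)
  \<comment> \<open>All Walsh functions have modulus 1, so frequency 0 can stand in for
    \<open>e n\<close>, and all norms become multiples of one function.\<close>
  have ng: "norm (g n x) = norm (c (e n)) * norm (indicator (unit_cube d) x *\<^sub>R wal_vec b d ?z x)" for n x
    by (simp add: g_def norm_mult)
  have "summable (\<lambda>n. norm (g n x))" for x
    unfolding ng by (intro summable_mult2 sc)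
  then have s1: "AE x in ?M. summable (\<lambda>n. norm (g n x))" by simp
  have s2: "summable (\<lambda>n. \<integral>x. norm (g n x) \<partial>?M)"
    unfolding ng by (simp only: integral_mult_right_zero) (intro summable_mult2 sc)
  have "indicator (unit_cube d) x *\<^sub>R f x = (\<Sum>n. g n x)" for x
  proof (cases "x \<in> unit_cube d")
    case True
    have "((\<lambda>n. c (e n) * wal_vec b d (e n) x) has_sum f x) UNIV"
      using f[OF True] has_sum_reindex_bij_betw[OF e, of "\<lambda>k. c k * wal_vec b d k x"] by blast
    then have "(\<lambda>n. c (e n) * wal_vec b d (e n) x) sums f x" by (rule has_sum_imp_sums)
    then show ?thesis using True by (simp add: g_def sums_unique)
  qed (simp add: g_def)
  then have "set_lebesgue_integral ?M (unit_cube d) f = (\<integral>x. (\<Sum>n. g n x) \<partial>?M)"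
    unfolding set_lebesgue_integral_def by simp
  also have "\<dots> = (\<Sum>n. integral\<^sup>L ?M (g n))"
    by (rule integral_suminf[OF int s1 s2])
  also have "\<dots> = (\<Sum>n. c (e n) * (if e n = ?z then 1 else 0))"
    unfolding g_def by (simp only: integral_mult_right_zero integral_wal_vec(2)[OF b ef])
  also have "\<dots> = c ?z"
  proof -
    have "?z \<in> range e" using bij_betw_imp_surj_on[OF e] zero_freqs by simp
    then obtain n0 where n0: "?z = e n0" by (rule imageE)
    have "e n = ?z \<longleftrightarrow> n = n0" for n
      unfolding n0 using bij_betw_imp_inj_on[OF e] by (simp add: inj_eq)
    then have "c (e n) * (if e n = ?z then 1 else 0) = (if n = n0 then c ?z else 0)" for n
      by (cases "n = n0") (simp_all only: n0 if_True if_False mult_1_right mult_zero_right simp_thms)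
    then show ?thesis using sums_single[of n0 "\<lambda>_. c ?z"] by (simp add: sums_iff)
  qed
  finally show ?thesis .
qed

section \<open>Weighted Walsh kernels and the quadrature error\<close>

definition wt :: "nat \<Rightarrow> nat \<Rightarrow> real \<Rightarrow> nat \<Rightarrow> real" where
  "wt b \<alpha> g k = (if k = 0 then 1 else g * r_walsh b \<alpha> k)"

text \<open>\<open>wt\<close> is 1 at frequency 0, so the product over the nonzero components
  becomes one over all of them, and sums over \<open>freqs\<close> factor.\<close>

lemma r_vec_wt: "r_vec b \<alpha> \<gamma> d k = (\<Prod>j\<in>{1..d}. wt b \<alpha> (\<gamma> j) (k j))"
  unfolding r_vec_def wt_def by (subst prod.inter_filter) (auto intro!: prod.cong)

lemma r_vec_pos:
  assumes "b > 1" "\<And>j. j \<ge> 1 \<Longrightarrow> \<gamma> j > 0"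
  shows "r_vec b \<alpha> \<gamma> d k > 0"
  unfolding r_vec_def using assms by (intro prod_pos mult_pos_pos r_walsh_pos) auto

lemma wt_series:
  fixes g y :: real
  assumes b: "b > 1" and \<alpha>: "\<alpha> > 1"
  defines "f \<equiv> \<lambda>k. of_real (wt b \<alpha> g k) * wal b k y"
  shows "summable (\<lambda>k. norm (f k))" and "(\<Sum>k. f k) = 1 + of_real g * omega b \<alpha> y"
proof -
  have "summable (\<lambda>k. (1 + \<bar>g\<bar>) * r_walsh b \<alpha> k)"
    by (intro summable_mult summable_r_walsh b \<alpha>)
  moreover have "norm (norm (f k)) \<le> (1 + \<bar>g\<bar>) * r_walsh b \<alpha> k" for k
  proof (cases "k = 0")
    case False
    then show ?thesis by (simp add: f_def wt_def norm_mult abs_mult mult_right_mono)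
  qed (simp add: f_def wt_def)
  ultimately show s: "summable (\<lambda>k. norm (f k))" by (rule summable_comparison_test'[where N = 0])
  then have "summable f" by (rule summable_norm_cancel)
  then have "(\<Sum>k. f k) = f 0 + (\<Sum>k. f (Suc k))" by (simp add: suminf_split_head)
  also have "f 0 = 1" by (simp add: f_def wt_def)
  also have "(\<Sum>k. f (Suc k)) = (\<Sum>k. of_real g * (of_real (r_walsh b \<alpha> (Suc k)) * wal b (Suc k) y))"
    by (simp add: f_def wt_def mult.assoc)
  also have "\<dots> = of_real g * omega b \<alpha> y"
    unfolding omega_def
  proof (rule suminf_mult)
    have "summable (\<lambda>k. norm (of_real (r_walsh b \<alpha> k) * wal b k y))"
      using summable_r_walsh[OF b \<alpha>] by (simp add: norm_mult)
    then have "summable (\<lambda>k. of_real (r_walsh b \<alpha> k) * wal b k y)" by (rule summable_norm_cancel)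
    then show "summable (\<lambda>k. of_real (r_walsh b \<alpha> (Suc k)) * wal b (Suc k) y)"
      by (subst summable_Suc_iff[where f = "\<lambda>k. of_real (r_walsh b \<alpha> k) * wal b k y"])
  qed
  finally show "(\<Sum>k. f k) = 1 + of_real g * omega b \<alpha> y" .
qed

text \<open>The product of d absolutely convergent one-dimensional series is multiplied out;
  frequency 0 of each series is the 1 in its factor.\<close>

lemma vec_series:
  fixes \<gamma> :: "nat \<Rightarrow> real" and d :: nat
  assumes b: "b > 1" and \<alpha>: "\<alpha> > 1"
  defines "F \<equiv> \<lambda>x k. of_real (r_vec b \<alpha> \<gamma> d k) * wal_vec b d k x"
  shows "(\<lambda>k. norm (F x k)) summable_on freqs d"
    and "(F x has_sum (\<Prod>j\<in>{1..d}. 1 + of_real (\<gamma> j) * omega b \<alpha> (x j))) (freqs d)"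
proof -
  let ?f = "\<lambda>j k. of_real (wt b \<alpha> (\<gamma> j) k) * wal b k (x j)"
  have F: "F x = (\<lambda>k. \<Prod>j\<in>{1..d}. ?f j (k j))"
    by (simp add: F_def fun_eq_iff r_vec_wt wal_vec_def prod.distrib)
  have s: "summable (\<lambda>k. norm (?f j k))" for j by (rule wt_series(1)[OF b \<alpha>])
  have abs: "Infinite_Sum.abs_summable_on (?f j) UNIV" for j
    unfolding abs_summable_equivalent abs_summable_on_nat_iff' by (rule s)
  have "Infinite_Sum.abs_summable_on (\<lambda>k. \<Prod>j\<in>{1..d}. ?f j (k j)) (Pi\<^sub>E {1..d} (\<lambda>_. UNIV))"
    unfolding abs_summable_equivalent
    by (rule abs_summable_on_prod_PiE) (simp_all add: abs[unfolded abs_summable_equivalent])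
  then show sum: "(\<lambda>k. norm (F x k)) summable_on freqs d"
    unfolding F freqs_def .
  have "infsum (F x) (freqs d) = (\<Prod>j\<in>{1..d}. infsum (?f j) UNIV)"
    unfolding F freqs_def by (rule infsum_prod_PiE_abs) (simp_all add: abs)
  also have "\<dots> = (\<Prod>j\<in>{1..d}. 1 + of_real (\<gamma> j) * omega b \<alpha> (x j))"
  proof (rule prod.cong[OF refl])
    fix j
    have "?f j sums (1 + of_real (\<gamma> j) * omega b \<alpha> (x j))"
      using summable_sums[OF summable_norm_cancel[OF s[of j]]] wt_series(2)[OF b \<alpha>, of "\<gamma> j" "x j"] by (simp only:)
    then show "infsum (?f j) UNIV = 1 + of_real (\<gamma> j) * omega b \<alpha> (x j)"
      by (intro infsumI norm_summable_imp_has_sum s)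
  qed
  finally have "infsum (F x) (freqs d) = (\<Prod>j\<in>{1..d}. 1 + of_real (\<gamma> j) * omega b \<alpha> (x j))" .
  then show "(F x has_sum (\<Prod>j\<in>{1..d}. 1 + of_real (\<gamma> j) * omega b \<alpha> (x j))) (freqs d)"
    using has_sum_infsum[OF abs_summable_summable[OF sum]] by simp
qed

lemma has_sum_sum_nat:
  fixes f :: "nat \<Rightarrow> 'a \<Rightarrow> 'b::topological_comm_monoid_add"
  assumes "\<And>h. h < N \<Longrightarrow> (f h has_sum S h) A"
  shows "((\<lambda>k. \<Sum>h<N. f h k) has_sum (\<Sum>h<N. S h)) A"
  using assms
proof (induction N)
  case 0
  show ?case by (simp add: has_sum_0)
next
  case (Suc N)
  then show ?case by (simp add: has_sum_add)
qed

text \<open>For a rule whose averages of Walsh functions are nonnegative, the worst function in the unit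
  ball is the one with the largest admissible coefficients.\<close>

lemma sup_quadrature_error:
  fixes X :: "nat \<Rightarrow> nat \<Rightarrow> real"
  assumes b: "b > 1" and \<alpha>: "\<alpha> > 1" and d: "d \<ge> 1" and \<gamma>: "\<And>j. j \<ge> 1 \<Longrightarrow> \<gamma> j > 0"
    and N: "N > 0" and X: "\<And>h. h < N \<Longrightarrow> X h \<in> unit_cube d"
    and A: "\<And>k. k \<in> freqs d \<Longrightarrow> 0 \<le> A k \<and> A k \<le> 1 \<and>
      (\<Sum>h<N. wal_vec b d k (X h)) = of_nat N * of_real (A k)"
  shows "(SUP f\<in>walsh_unit_ball b \<alpha> \<gamma> d.
      norm (set_lebesgue_integral (\<Pi>\<^sub>M j\<in>{1..d}. lborel) (unit_cube d) f - (1 / of_nat N) * (\<Sum>h<N. f (X h)))) =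
    Re (\<Sum>h<N. \<Prod>j\<in>{1..d}. 1 + of_real (\<gamma> j) * omega b \<alpha> (X h j)) / real N - 1"
proof -
  define z where "z = (\<lambda>j\<in>{1..d}. 0 :: nat)"
  have z: "z \<in> freqs d" unfolding z_def by (rule zero_freqs)
  define R where "R = r_vec b \<alpha> \<gamma> d"
  have R: "R k > 0" for k unfolding R_def by (rule r_vec_pos[OF b \<gamma>])
  have Rz: "R z = 1" by (simp add: R_def r_vec_wt wt_def z_def)
  have "wal_vec b d z x = 1" for x by (simp add: wal_vec_def z_def)
  then have "complex_of_real (real N) * 1 = of_real (real N) * of_real (A z)" using A[OF z] by simp
  then have Az: "A z = 1" using N by simp
  define err where "err f = norm (set_lebesgue_integral (\<Pi>\<^sub>M j\<in>{1..d}. lborel) (unit_cube d) f - (1 / of_nat N) * (\<Sum>h<N. f (X h)))"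
    for f :: "(nat \<Rightarrow> real) \<Rightarrow> complex"
  \<comment> \<open>The largest possible contribution of frequency k to the error; frequency 0 is
    integrated exactly.\<close>
  define t where "t k = (if k = z then 0 else R k * A k)" for k
  \<comment> \<open>At every point the terms of the Walsh series with coefficients
    \<open>R k\<close> have norm \<open>R k\<close>; the origin is taken.\<close>
  have sR: "R summable_on freqs d"
  proof -
    have "(\<lambda>k. norm (complex_of_real (R k) * wal_vec b d k (\<lambda>_. 0))) = R"
      using R by (simp add: fun_eq_iff norm_mult less_imp_le)
    then show ?thesis using vec_series(1)[OF b \<alpha>, of \<gamma> d "\<lambda>_. 0"] unfolding R_def by (simp only:)
  qed
  have sRA: "(\<lambda>k. R k * A k) summable_on freqs d"
    by (rule summable_on_comparison_test[OF sR]) (use A R in \<open>simp_all add: mult_left_le less_imp_le\<close>)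
  have st: "t summable_on freqs d"
    by (rule summable_on_comparison_test[OF sRA]) (use A R Az Rz in \<open>simp_all add: t_def less_imp_le\<close>)
  \<comment> \<open>Averaging over the nodes replaces each Walsh function by \<open>A k\<close>,
    while the integral is the coefficient at \<open>z\<close>; by \<open>A z = 1\<close> these two
    terms cancel.\<close>
  have diff: "((\<lambda>k. if k = z then 0 else c k * of_real (A k)) has_sum
      ((1 / of_nat N) * (\<Sum>h<N. f (X h)) - set_lebesgue_integral (\<Pi>\<^sub>M j\<in>{1..d}. lborel) (unit_cube d) f)) (freqs d)"
    if c: "(\<lambda>k. norm (c k)) summable_on freqs d"
      and f: "\<forall>x\<in>unit_cube d. ((\<lambda>k. c k * wal_vec b d k x) has_sum f x) (freqs d)" for c f
  proof -
    have I: "set_lebesgue_integral (\<Pi>\<^sub>M j\<in>{1..d}. lborel) (unit_cube d) f = c z"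
      unfolding z_def using integral_walsh_series[OF b d c] f by blast
    have "((\<lambda>k. \<Sum>h<N. c k * wal_vec b d k (X h)) has_sum (\<Sum>h<N. f (X h))) (freqs d)"
      by (rule has_sum_sum_nat) (use f X in blast)
    then have "((\<lambda>k. (1 / of_nat N) * (\<Sum>h<N. c k * wal_vec b d k (X h))) has_sum ((1 / of_nat N) * (\<Sum>h<N. f (X h)))) (freqs d)"
      by (rule has_sum_cmult_right)
    moreover have "((\<lambda>k. if k = z then - c z else 0) has_sum - c z) (freqs d)"
      by (rule has_sum_finite_neutralI[where B = "{z}"]) (use z in auto)
    ultimately have "((\<lambda>k. (1 / of_nat N) * (\<Sum>h<N. c k * wal_vec b d k (X h)) + (if k = z then - c z else 0))
        has_sum ((1 / of_nat N) * (\<Sum>h<N. f (X h)) + - c z)) (freqs d)"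
      by (rule has_sum_add)
    also have "?this \<longleftrightarrow> ((\<lambda>k. if k = z then 0 else c k * of_real (A k)) has_sum
        ((1 / of_nat N) * (\<Sum>h<N. f (X h)) + - c z)) (freqs d)"
    proof (rule has_sum_cong)
      fix k assume k: "k \<in> freqs d"
      have "(1 / of_nat N) * (\<Sum>h<N. c k * wal_vec b d k (X h)) = c k * of_real (A k)"
        unfolding sum_distrib_left[symmetric] using A[OF k] N by simp
      then show "(1 / of_nat N) * (\<Sum>h<N. c k * wal_vec b d k (X h)) + (if k = z then - c z else 0) =
          (if k = z then 0 else c k * of_real (A k))"
        using Az by simp
    qed
    finally show ?thesis unfolding I by simp
  qed
  have upper: "err f \<le> infsum t (freqs d)" if ball: "f \<in> walsh_unit_ball b \<alpha> \<gamma> d" for f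
  proof -
    obtain c where c: "(\<lambda>k. norm (c k)) summable_on freqs d"
      "\<forall>x\<in>unit_cube d. ((\<lambda>k. c k * wal_vec b d k x) has_sum f x) (freqs d)"
      "\<forall>k\<in>freqs d. norm (c k) / r_vec b \<alpha> \<gamma> d k \<le> 1"
      using ball unfolding walsh_unit_ball_def by blast
    have cR: "norm (c k) \<le> R k" if "k \<in> freqs d" for k
      using c(3) that R[of k] unfolding R_def[symmetric] by (auto simp: divide_le_eq)
    let ?g = "\<lambda>k. if k = z then 0 else c k * complex_of_real (A k)"
    have gt: "norm (?g k) \<le> t k" if "k \<in> freqs d" for k
      using A[OF that] cR[OF that] R[of k] by (auto simp: t_def norm_mult intro!: mult_right_mono)
    have sg: "(\<lambda>k. norm (?g k)) summable_on freqs d"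
      by (rule summable_on_comparison_test[OF st gt]) simp_all
    have "err f = norm (infsum ?g (freqs d))"
      unfolding err_def using infsumI[OF diff[OF c(1,2)]] by (simp add: norm_minus_commute)
    also have "\<dots> \<le> infsum (\<lambda>k. norm (?g k)) (freqs d)" by (rule norm_infsum_bound[OF sg])
    also have "\<dots> \<le> infsum t (freqs d)" by (rule infsum_mono[OF sg st gt])
    finally show ?thesis .
  qed
  \<comment> \<open>The extremal function: its coefficients are the \<open>R k\<close> themselves,
    and \<open>vec_series\<close> gives it this closed form.\<close>
  define f where "f x = (\<Prod>j\<in>{1..d}. 1 + of_real (\<gamma> j) * omega b \<alpha> (x j))" for x
  have f1: "(\<lambda>k. norm (complex_of_real (R k))) summable_on freqs d" using sR R by (simp add: less_imp_le)
  have f2: "((\<lambda>k. of_real (R k) * wal_vec b d k x) has_sum f x) (freqs d)" for x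
    unfolding f_def R_def by (rule vec_series(2)[OF b \<alpha>])
  have ball: "f \<in> walsh_unit_ball b \<alpha> \<gamma> d"
    unfolding walsh_unit_ball_def
  proof (rule CollectI, rule exI[of _ "\<lambda>k. complex_of_real (R k)"], intro conjI ballI f1 f2)
    fix k
    show "norm (complex_of_real (R k)) / r_vec b \<alpha> \<gamma> d k \<le> 1"
      unfolding R_def[symmetric] using R[of k] by simp
  qed
  have If: "set_lebesgue_integral (\<Pi>\<^sub>M j\<in>{1..d}. lborel) (unit_cube d) f = 1"
    using integral_walsh_series[OF b d f1 f2] Rz unfolding z_def by simp
  \<comment> \<open>For these coefficients all terms are nonnegative, so the bound in
    \<open>upper\<close> is met without cancellation.\<close>
  have "((\<lambda>k. complex_of_real (t k)) has_sum ((1 / of_nat N) * (\<Sum>h<N. f (X h)) - 1)) (freqs d)"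
  proof -
    have "(\<lambda>k. complex_of_real (t k)) = (\<lambda>k. if k = z then 0 else of_real (R k) * of_real (A k))"
      by (simp add: t_def fun_eq_iff)
    then show ?thesis using diff[OF f1, of f] f2 If by simp
  qed
  moreover have "((\<lambda>k. complex_of_real (t k)) has_sum of_real (infsum t (freqs d))) (freqs d)"
    by (intro has_sum_of_real has_sum_infsum st)
  ultimately have e: "(1 / of_nat N) * (\<Sum>h<N. f (X h)) - 1 = complex_of_real (infsum t (freqs d))"
    by (rule has_sum_unique)
  have tn: "infsum t (freqs d) \<ge> 0"
    by (rule infsum_nonneg) (use A R in \<open>simp add: t_def less_imp_le\<close>)
  have attained: "err f = infsum t (freqs d)"
  proof -
    have "err f = norm (- ((1 / of_nat N) * (\<Sum>h<N. f (X h)) - 1))" unfolding err_def If by simp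
    then show ?thesis unfolding e norm_minus_cancel using tn by simp
  qed
  have "(SUP f\<in>walsh_unit_ball b \<alpha> \<gamma> d. err f) = infsum t (freqs d)"
  proof (rule cSup_eq_maximum)
    show "infsum t (freqs d) \<in> err ` walsh_unit_ball b \<alpha> \<gamma> d"
      unfolding attained[symmetric] by (rule imageI[OF ball])
  qed (use upper in blast)
  also have "infsum t (freqs d) = Re ((1 / of_nat N) * (\<Sum>h<N. f (X h)) - 1)" unfolding e by simp
  also have "\<dots> = Re (\<Sum>h<N. f (X h)) / real N - 1"
    by (simp add: Re_divide_of_nat)
  finally show ?thesis unfolding err_def f_def .
qed

section \<open>Worst-case error of polynomial lattice rules\<close>

context irreducible_poly
begin

text \<open>The integer $b^n v_n(f/p)$.\<close>

definition node_code :: "int poly \<Rightarrow> nat" where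
  "node_code f = (\<Sum>t<n. nat (lau f (int (n - t))) * b ^ t)"

lemma nat_lau_less: "nat (lau f i) < b"
  using lau_range[of f i] by auto

lemma node_code_less: "node_code f < b ^ n"
  unfolding node_code_def by (rule digit_sum(1)) (rule nat_lau_less)

lemma digit_node_code: "t < n \<Longrightarrow> digit b (node_code f) t = nat (lau f (int (n - t)))"
  unfolding node_code_def by (rule digit_sum(2)) (rule nat_lau_less)

lemma v_trunc_node_code: "v_trunc b n (lau f) = real (node_code f) / real b ^ n"
proof -
  have "real (node_code f) / real b ^ n = (\<Sum>t<n. real_of_int (lau f (int (n - t))) * real b ^ t / real b ^ n)"
    unfolding node_code_def of_nat_sum sum_divide_distrib
    by (intro sum.cong refl) (use lau_range in \<open>simp add: of_nat_nat\<close>)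
  also have "\<dots> = (\<Sum>i=1..n. real_of_int (lau f (int i)) / real b ^ i)"
  proof (rule sum.reindex_bij_witness[where i = "\<lambda>i. n - i" and j = "\<lambda>t. n - t"])
    fix t assume t: "t \<in> {..<n}"
    then have "real b ^ n = real b ^ t * real b ^ (n - t)" by (simp flip: power_add)
    then show "real_of_int (lau f (int (n - t))) / real b ^ (n - t) =
        real_of_int (lau f (int (n - t))) * real b ^ t / real b ^ n"
      using b_gt1 by simp
  qed auto
  finally show ?thesis unfolding v_trunc_def ..
qed

lemma node_code_cong: "res f = res f' \<Longrightarrow> node_code f = node_code f'"
  unfolding node_code_def
  by (intro sum.cong refl arg_cong2[where f = "(*)"] arg_cong[where f = nat] lau_residue) auto

lemma node_code_res [simp]: "node_code (res f) = node_code f"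
  by (rule node_code_cong) (use residue_mult_left[of f 1] in simp)

definition point :: "int poly \<Rightarrow> real" where
  "point f = real (node_code f) / real b ^ n"

lemma point_range: "point f \<in> {0..<1}"
proof -
  have "real (node_code f) < real (b ^ n)" using node_code_less by (simp only: of_nat_less_iff)
  then show ?thesis unfolding point_def using b_gt1 by simp
qed

lemma real_digit_point: "real_digit b (point f) (i + 1) = (if i < n then nat (lau f (int (i + 1))) else 0)"
  unfolding point_def real_digit_nat_div[OF b_gt1] using digit_node_code[of "n - (i + 1)" f] by auto

lemma lattice_node_point: "lattice_node b n d q p h = (\<lambda>j\<in>{1..d}. point (poly_of_nat b h * q j))"
  unfolding lattice_node_def v_trunc_node_code point_def ..

lemma poly_of_nat_add_power:
  assumes "h < b ^ i" "c < b"
  shows "poly_of_nat b (c * b ^ i + h) = poly_of_nat b h + smult (int c) (poly_of_nat b (b ^ i))"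
proof (rule poly_eqI)
  fix t
  have p: "digit b (b ^ i) t = (if t = i then 1 else 0)"
    using digit_add_power[OF b_gt1, of 0 i 1 t] b_gt1 by (simp add: digit_def)
  have "digit b h i = 0" by (rule digit_ge[OF b_gt1 assms(1)]) simp
  then show "coeff (poly_of_nat b (c * b ^ i + h)) t =
      coeff (poly_of_nat b h + smult (int c) (poly_of_nat b (b ^ i))) t"
    by (simp add: coeff_poly_of_nat[OF b_gt1] digit_add_power[OF b_gt1 assms] p)
qed

lemma real_digit_point_add:
  assumes "h < b ^ l" "c < b"
  shows "[real_digit b (point (poly_of_nat b (c * b ^ l + h) * q)) (i + 1) =
    real_digit b (point (poly_of_nat b h * q)) (i + 1) + c * real_digit b (point (poly_of_nat b (b ^ l) * q)) (i + 1)] (mod b)"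
proof (cases "i < n")
  case True
  let ?u = "lau (poly_of_nat b h * q) (int (i + 1))" and ?v = "lau (poly_of_nat b (b ^ l) * q) (int (i + 1))"
  have e: "poly_of_nat b (c * b ^ l + h) * q = poly_of_nat b h * q + smult (int c) (poly_of_nat b (b ^ l) * q)"
    unfolding poly_of_nat_add_power[OF assms] by (simp add: distrib_right)
  have r: "?u \<ge> 0" "?v \<ge> 0" using lau_range by simp_all
  have "int (nat ((?u + int c * ?v) mod int b)) = (?u + int c * ?v) mod int b" using b_gt1 by simp
  also have "\<dots> = int ((nat ?u + c * nat ?v) mod b)" using r by (simp add: zmod_int)
  finally have "nat ((?u + int c * ?v) mod int b) = (nat ?u + c * nat ?v) mod b" by (simp only: of_nat_eq_iff)
  then show ?thesis unfolding real_digit_point e lau_linear using True by (simp add: cong_def)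
next
  case False
  then show ?thesis unfolding real_digit_point by simp
qed

text \<open>The digits of the nodes depend additively modulo b on the digits of h, so the Walsh
  function is a character in h and its average is 1 or 0.\<close>

lemma walsh_average:
  assumes k: "k \<in> freqs d"
  shows "\<exists>A. 0 \<le> A \<and> A \<le> 1 \<and>
    (\<Sum>h<b ^ m. wal_vec b d k (lattice_node b n d q p h)) = of_nat (b ^ m) * complex_of_real A"
proof -
  define D where "D h j i = real_digit b (point (poly_of_nat b h * q j)) (i + 1)" for h j i
  define F where "F h = (\<Sum>j\<in>{1..d}. \<Sum>i\<in>digit_support b (k j). D h j i * digit b (k j) i)" for h
  have wal: "wal_vec b d k (lattice_node b n d q p h) = zeta b ^ F h" for h
  proof -
    have "wal_vec b d k (lattice_node b n d q p h) =
        (\<Prod>j\<in>{1..d}. zeta b ^ (\<Sum>i\<in>digit_support b (k j). D h j i * digit b (k j) i))"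
      unfolding wal_vec_def lattice_node_point wal_zeta D_def by (intro prod.cong refl) simp
    then show ?thesis by (simp only: F_def power_sum)
  qed
  have D0: "D 0 j i = 0" for j i
  proof -
    have "lau (p * 0) (int (i + 1)) = 0" by (rule lau_multiple) simp
    then show ?thesis unfolding D_def real_digit_point poly_of_nat_0 by simp
  qed
  have "(\<Sum>h<b ^ m. zeta b ^ F h) = (if \<forall>i<m. b dvd F (b ^ i) then of_nat (b ^ m) else 0)"
  proof (rule character_sum[OF b_gt1])
    show "b dvd F 0" by (simp add: F_def D0)
  next
    fix l h c assume h: "h < b ^ l" "c < b"
    have "F h + c * F (b ^ l) = (\<Sum>j\<in>{1..d}. \<Sum>i\<in>digit_support b (k j). (D h j i + c * D (b ^ l) j i) * digit b (k j) i)"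
      unfolding F_def by (simp add: algebra_simps sum.distrib sum_distrib_left)
    moreover have "[F (c * b ^ l + h) = \<dots>] (mod b)"
      unfolding F_def D_def by (intro cong_sum cong_mult cong_refl real_digit_point_add h)
    ultimately show "[F (c * b ^ l + h) = F h + c * F (b ^ l)] (mod b)" by (simp only:)
  qed
  then have "(\<Sum>h<b ^ m. wal_vec b d k (lattice_node b n d q p h)) \<in> {of_nat (b ^ m) * complex_of_real 1, of_nat (b ^ m) * complex_of_real 0}"
    unfolding wal by simp
  then show ?thesis
    by (elim insertE emptyE) (rule exI[of _ 1], simp, rule exI[of _ 0], simp)
qed

theorem worst_case_error_formula:
  assumes \<alpha>: "\<alpha> > 1" and d: "d \<ge> 1" and \<gamma>: "\<And>j. j \<ge> 1 \<Longrightarrow> \<gamma> j > 0"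
  shows "worst_case_error b \<alpha> n m \<gamma> d q p =
    Re (\<Sum>h<b ^ m. \<Prod>j\<in>{1..d}. 1 + of_real (\<gamma> j) * omega b \<alpha> (point (poly_of_nat b h * q j))) / real (b ^ m) - 1"
proof -
  let ?X = "lattice_node b n d q p"
  have "\<forall>k\<in>freqs d. \<exists>a. 0 \<le> a \<and> a \<le> 1 \<and>
      (\<Sum>h<b ^ m. wal_vec b d k (?X h)) = of_nat (b ^ m) * complex_of_real a"
    by (intro ballI walsh_average)
  then obtain A where A: "\<forall>k\<in>freqs d. 0 \<le> A k \<and> A k \<le> 1 \<and>
      (\<Sum>h<b ^ m. wal_vec b d k (?X h)) = of_nat (b ^ m) * complex_of_real (A k)"
    by (rule bchoice[THEN exE])
  have X: "?X h \<in> unit_cube d" for h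
    unfolding lattice_node_point unit_cube_def using point_range by auto
  have "worst_case_error b \<alpha> n m \<gamma> d q p =
      Re (\<Sum>h<b ^ m. \<Prod>j\<in>{1..d}. 1 + of_real (\<gamma> j) * omega b \<alpha> (?X h j)) / real (b ^ m) - 1"
    unfolding worst_case_error_def
    by (rule sup_quadrature_error[OF b_gt1 \<alpha> d \<gamma> _ X A[rule_format]]) (use b_gt1 in simp_all)
  also have "(\<Sum>h<b ^ m. \<Prod>j\<in>{1..d}. 1 + of_real (\<gamma> j) * omega b \<alpha> (?X h j)) =
      (\<Sum>h<b ^ m. \<Prod>j\<in>{1..d}. 1 + of_real (\<gamma> j) * omega b \<alpha> (point (poly_of_nat b h * q j)))"
    unfolding lattice_node_point by (intro sum.cong prod.cong refl) simp
  finally show ?thesis .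
qed

end

section \<open>From the program to the lattice rule\<close>

locale cbc_instance = irreducible_poly b p n for b :: nat and p :: "int poly" and n :: nat +
  fixes g :: "int poly" and \<alpha> s m :: nat and \<gamma> :: "nat \<Rightarrow> real" and M :: machine
  assumes g: "unit_group_generator b p g" and \<alpha>: "\<alpha> > 1" and m: "m \<ge> 1" and n: "n = \<alpha> * m"
    and \<gamma>: "\<And>j. j \<ge> 1 \<Longrightarrow> \<gamma> j > 0"
    and M: "cells M = working_cells (b ^ n)" "100 * (b ^ n + s) \<le> word M" "npoly M = b ^ n" "nweights M = s"
      "mulgen M = (\<lambda>w. nat_of_poly b (res (g * poly_of_nat b w)))"
      "veval M = (\<lambda>w. nat \<lfloor>real (b ^ n) * v_trunc b n (lau (poly_of_nat b w))\<rfloor>)"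
      "omegaeval M = (\<lambda>v. omega b \<alpha> (real v / real (b ^ n)))" "weights M = \<gamma>"
begin

lemma veval_node_code: "veval M w = node_code (poly_of_nat b w)"
proof -
  have "real (b ^ n) * v_trunc b n (lau (poly_of_nat b w)) = real (node_code (poly_of_nat b w))"
    unfolding v_trunc_node_code using b_gt1 by simp
  then show ?thesis unfolding M(6) by simp
qed

sublocale cbc_run M b \<alpha> s m "b ^ n"
proof
  show "mulgen M w < b ^ n" for w
    unfolding M(5) by (rule nat_of_poly_less[OF b_gt1]) (rule residue_props)+
  show "veval M w < b ^ n" for w
    unfolding veval_node_code by (rule node_code_less)
qed (use b_gt1 \<alpha> m n M in auto)

lemma poly_orbit: "poly_of_nat b (orbit a) = res (g ^ a)"
proof (induction a)
  case 0
  show ?case using poly_of_nat_1[OF b_gt1] by (simp add: orbit_def)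
next
  case (Suc a)
  have "orbit (Suc a) = nat_of_poly b (res (g * poly_of_nat b (orbit a)))"
    by (simp add: orbit_def M(5))
  then have "poly_of_nat b (orbit (Suc a)) = res (g * poly_of_nat b (orbit a))"
    using poly_of_nat_of_poly[OF b_gt1 residue_props(1)] by simp
  then show ?case using Suc by simp
qed

lemma res_power_mod: "res (g ^ (a mod (b ^ n - 1))) = res (g ^ a)"
proof -
  define N where "N = b ^ n - 1"
  have N1: "res (g ^ N) = 1" unfolding N_def by (rule power_orbit(2)[OF g])
  have "res (g ^ (N * k)) = 1" for k
  proof (induction k)
    case (Suc k)
    have "res (g ^ (N * Suc k)) = res (res (g ^ N) * res (g ^ (N * k)))" by (simp add: power_add)
    then show ?case unfolding N1 Suc by simp
  qed simp
  then have "res (g ^ (a mod N)) = res (res (g ^ (N * (a div N))) * g ^ (a mod N))" by simp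
  also have "\<dots> = res (g ^ a)" by (simp only: residue_mult_left power_add[symmetric] mult_div_mod_eq)
  finally show ?thesis by (simp only: N_def)
qed

lemma om_point: "om (a mod Mo) = omega b \<alpha> (point (g ^ a))"
proof -
  have "om (a mod Mo) = omega b \<alpha> (real (node_code (poly_of_nat b (orbit (a mod Mo)))) / real (b ^ n))"
    unfolding om_def M(7) veval_node_code ..
  also have "node_code (poly_of_nat b (orbit (a mod Mo))) = node_code (g ^ a)"
    unfolding poly_orbit res_power_mod by simp
  finally show ?thesis by (simp add: point_def)
qed

text \<open>Adding exponents modulo b^n - 1 multiplies residues, which makes the sum over the nodes
  a cyclic correlation.\<close>

lemma om_point_mult:
  "om ((a + z) mod Mo) = omega b \<alpha> (point (poly_of_nat b (orbit a) * poly_of_nat b (orbit z)))"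
proof -
  have "res (g ^ (a + z)) = res (poly_of_nat b (orbit a) * poly_of_nat b (orbit z))"
    unfolding poly_orbit by (simp add: power_add)
  then have "point (g ^ (a + z)) = point (poly_of_nat b (orbit a) * poly_of_nat b (orbit z))"
    unfolding point_def using node_code_cong by metis
  then show ?thesis by (simp only: om_point)
qed

text \<open>The exponent map onto the nonzero residues, followed by the inverse of the
  encoding.\<close>

lemma bij_orbit: "bij_betw orbit {..<Mo} {1..<b ^ n}"
proof -
  have 1: "bij_betw (\<lambda>a. poly_of_nat b (orbit a)) {..<Mo} (carrier Q - {0})"
    unfolding poly_orbit by (rule power_orbit(1)[OF g])
  have "carrier Q - {0} = poly_of_nat b ` ({..<b ^ n} - {0})"
    unfolding carrier_image image_set_diff[OF inj_poly_of_nat] by (simp add: poly_of_nat_0)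
  also have "{..<b ^ n} - {0} = {1..<b ^ n}" by auto
  finally have "bij_betw (poly_of_nat b) {1..<b ^ n} (carrier Q - {0})"
    using inj_on_subset[OF inj_poly_of_nat subset_UNIV] unfolding bij_betw_def by blast
  then have inv: "bij_betw (the_inv_into {1..<b ^ n} (poly_of_nat b)) (carrier Q - {0}) {1..<b ^ n}"
    by (rule bij_betw_the_inv_into)
  have "the_inv_into {1..<b ^ n} (poly_of_nat b) (poly_of_nat b (orbit a)) = orbit a" if "a < Mo" for a
  proof (rule the_inv_into_f_f)
    show "inj_on (poly_of_nat b) {1..<b ^ n}" by (rule inj_on_subset[OF inj_poly_of_nat subset_UNIV])
    have "poly_of_nat b (orbit a) \<noteq> 0" using bij_betwE[OF 1] that by auto
    then have "orbit a \<noteq> 0" using poly_of_nat_0 by metis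
    then show "orbit a \<in> {1..<b ^ n}" using orbit_less[of a] by simp
  qed
  with bij_betw_trans[OF 1 inv] show ?thesis
    by (subst bij_betw_cong[of _ orbit "the_inv_into {1..<b ^ n} (poly_of_nat b) \<circ> (\<lambda>a. poly_of_nat b (orbit a))"]) simp_all
qed

lemma search_set_orbit: "v \<in> search_set b n \<longleftrightarrow> (\<exists>z<Mo. v = poly_of_nat b (orbit z))"
proof -
  have "search_set b n = carrier Q - {0}" unfolding search_set_def by (auto simp: carrier_Q)
  also have "\<dots> = (\<lambda>z. res (g ^ z)) ` {..<Mo}"
    using bij_betw_imp_surj_on[OF power_orbit(1)[OF g]] by simp
  finally show ?thesis unfolding poly_orbit by auto
qed

definition gen_vector :: "(nat \<Rightarrow> nat) \<Rightarrow> nat \<Rightarrow> int poly" where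
  "gen_vector zs d = poly_of_nat b (orbit (zs (d - 1)))"

text \<open>The counterpart of \<open>partial_prod\<close> indexed by the polynomial h instead of
  its exponent. The range stops before d, so d components correspond to \<open>Suc d\<close>
  here.\<close>

definition prefix_prod :: "(nat \<Rightarrow> nat) \<Rightarrow> nat \<Rightarrow> nat \<Rightarrow> complex" where
  "prefix_prod zs d h =
     (\<Prod>j\<in>{1..<d}. 1 + of_real (\<gamma> j) * omega b \<alpha> (point (poly_of_nat b h * gen_vector zs j)))"

lemma b_m: "b ^ m > 0" "b ^ m \<le> b ^ n"
  using b_gt1 \<alpha> by (simp_all add: n power_increasing)

lemma partial_prod_prefix:
  "partial_prod zs d a = (if orbit a < b ^ m then prefix_prod zs (Suc d) (orbit a) else 0)"
proof -
  have "prefix_prod zs (Suc d) (orbit a) =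
      (\<Prod>j<d. 1 + of_real (\<gamma> (Suc j)) * omega b \<alpha> (point (poly_of_nat b (orbit a) * gen_vector zs (Suc j))))"
    unfolding prefix_prod_def lessThan_atLeast0 One_nat_def by (rule prod.shift_bounds_Suc_ivl)
  then have "(\<Prod>j<d. 1 + of_real (weights M (j + 1)) * om ((a + zs j) mod Mo)) = prefix_prod zs (Suc d) (orbit a)"
    unfolding om_point_mult M(8) gen_vector_def by simp
  moreover have "start_prod a = (if orbit a < b ^ m then 1 else 0)"
  proof (cases "orbit a < b ^ m")
    case False
    then have "orbit a div b ^ m \<ge> 1" using b_m by (simp add: Suc_le_eq div_greater_zero_iff)
    then show ?thesis using False by (simp add: start_prod_def)
  qed (simp add: start_prod_def)
  ultimately show ?thesis unfolding partial_prod_def by simp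
qed

text \<open>Extending the summand by 0 from 1 <= h < b^m to all nonzero codes below b^n makes the
  index range the image of \<open>orbit\<close>, so the sum can run over exponents.\<close>

lemma corr_lattice:
  "(\<Sum>h\<in>{1..<b ^ m}. prefix_prod zs (Suc d) h * omega b \<alpha> (point (poly_of_nat b h * poly_of_nat b (orbit z)))) =
    corr (partial_prod zs d) z"
proof -
  let ?f = "\<lambda>h. if h < b ^ m then prefix_prod zs (Suc d) h * omega b \<alpha> (point (poly_of_nat b h * poly_of_nat b (orbit z))) else 0"
  have "corr (partial_prod zs d) z = (\<Sum>a<Mo. ?f (orbit a))"
    unfolding corr_def partial_prod_prefix om_point_mult by (intro sum.cong refl) simp
  also have "\<dots> = (\<Sum>h\<in>{1..<b ^ n}. ?f h)"
    by (rule sum.reindex_bij_betw[OF bij_orbit])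
  also have "\<dots> = (\<Sum>h\<in>{1..<b ^ m}. ?f h)"
    by (rule sum.mono_neutral_right) (use b_m in auto)
  finally show ?thesis by simp
qed

text \<open>The term h = 0 is split off because 0 is no power of g. It and the sum of the previous
  products are the same for every z, so only the correlation distinguishes the candidates.\<close>

lemma worst_case_error_gen_vector:
  assumes d: "d \<ge> 1" and q: "\<And>j. j \<in> {1..<d} \<Longrightarrow> q j = gen_vector zs j" "q d = poly_of_nat b (orbit z)"
  shows "worst_case_error b \<alpha> n m \<gamma> d q p =
    (Re (\<Sum>h<b ^ m. prefix_prod zs d h) +
     \<gamma> d * (Re (prefix_prod zs d 0 * omega b \<alpha> (point 0)) + Re (corr (partial_prod zs (d - 1)) z))) / real (b ^ m) - 1"
proof -
  let ?O = "\<lambda>h. omega b \<alpha> (point (poly_of_nat b h * poly_of_nat b (orbit z)))"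
  have I: "{1..d} = insert d {1..<d}" using d by auto
  have "(\<Sum>h<b ^ m. \<Prod>j\<in>{1..d}. 1 + of_real (\<gamma> j) * omega b \<alpha> (point (poly_of_nat b h * q j))) =
      (\<Sum>h<b ^ m. prefix_prod zs d h + of_real (\<gamma> d) * (prefix_prod zs d h * ?O h))"
  proof (intro sum.cong refl)
    fix h
    have "(\<Prod>j\<in>{1..<d}. 1 + of_real (\<gamma> j) * omega b \<alpha> (point (poly_of_nat b h * q j))) = prefix_prod zs d h"
      unfolding prefix_prod_def by (intro prod.cong refl) (simp add: q(1))
    then show "(\<Prod>j\<in>{1..d}. 1 + of_real (\<gamma> j) * omega b \<alpha> (point (poly_of_nat b h * q j))) =
        prefix_prod zs d h + of_real (\<gamma> d) * (prefix_prod zs d h * ?O h)"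
      unfolding I by (simp add: q(2) algebra_simps)
  qed
  also have "\<dots> = (\<Sum>h<b ^ m. prefix_prod zs d h) + of_real (\<gamma> d) * (\<Sum>h<b ^ m. prefix_prod zs d h * ?O h)"
    by (simp only: sum.distrib sum_distrib_left)
  also have "(\<Sum>h<b ^ m. prefix_prod zs d h * ?O h) =
      prefix_prod zs d 0 * omega b \<alpha> (point 0) + corr (partial_prod zs (d - 1)) z"
  proof -
    have J: "{..<b ^ m} = insert 0 {1..<b ^ m}" using b_m(1) by auto
    have D: "Suc (d - 1) = d" using d by simp
    show ?thesis using corr_lattice[of zs "d - 1" z] unfolding D J by (simp add: poly_of_nat_0)
  qed
  finally have eq: "(\<Sum>h<b ^ m. \<Prod>j\<in>{1..d}. 1 + of_real (\<gamma> j) * omega b \<alpha> (point (poly_of_nat b h * q j))) =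
      (\<Sum>h<b ^ m. prefix_prod zs d h) +
      of_real (\<gamma> d) * (prefix_prod zs d 0 * omega b \<alpha> (point 0) + corr (partial_prod zs (d - 1)) z)" .
  have re: "Re (x + of_real c * (u + v)) = Re x + c * (Re u + Re v)" for x u v c
    by (simp add: algebra_simps)
  have "worst_case_error b \<alpha> n m \<gamma> d q p =
      Re (\<Sum>h<b ^ m. \<Prod>j\<in>{1..d}. 1 + of_real (\<gamma> j) * omega b \<alpha> (point (poly_of_nat b h * q j))) / real (b ^ m) - 1"
    by (rule worst_case_error_formula) (use \<alpha> d \<gamma> in simp_all)
  then show ?thesis by (simp only: eq re)
qed

text \<open>By \<open>worst_case_error_gen_vector\<close> the two errors differ only in the
  correlation, and the positive weight preserves its order.\<close>

lemma cbc_vector_greedy: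
  assumes greedy: "greedy zs s" and q: "\<And>d. d \<in> {1..s} \<Longrightarrow> q d = gen_vector zs d"
  shows "cbc_vector b \<alpha> n m \<gamma> s p q"
  unfolding cbc_vector_def
proof (intro ballI conjI)
  fix d assume d: "d \<in> {1..s}"
  have zd: "zs (d - 1) < Mo" and opt: "\<And>z. z < Mo \<Longrightarrow>
      Re (corr (partial_prod zs (d - 1)) (zs (d - 1))) \<le> Re (corr (partial_prod zs (d - 1)) z)"
    using greedy d unfolding greedy_def by auto
  show "q d \<in> search_set b n"
    unfolding search_set_orbit q[OF d] gen_vector_def using zd by blast
  fix v assume "v \<in> search_set b n"
  then obtain z where z: "z < Mo" "v = poly_of_nat b (orbit z)" unfolding search_set_orbit by blast
  have d1: "d \<ge> 1" using d by simp
  have 1: "worst_case_error b \<alpha> n m \<gamma> d q p =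
    (Re (\<Sum>h<b ^ m. prefix_prod zs d h) + \<gamma> d * (Re (prefix_prod zs d 0 * omega b \<alpha> (point 0)) +
      Re (corr (partial_prod zs (d - 1)) (zs (d - 1))))) / real (b ^ m) - 1"
    by (rule worst_case_error_gen_vector[OF d1]) (use q d in \<open>auto simp: gen_vector_def\<close>)
  have 2: "worst_case_error b \<alpha> n m \<gamma> d (q(d := v)) p =
    (Re (\<Sum>h<b ^ m. prefix_prod zs d h) + \<gamma> d * (Re (prefix_prod zs d 0 * omega b \<alpha> (point 0)) +
      Re (corr (partial_prod zs (d - 1)) z))) / real (b ^ m) - 1"
    by (rule worst_case_error_gen_vector[OF d1]) (use q d z in auto)
  show "worst_case_error b \<alpha> n m \<gamma> d q p \<le> worst_case_error b \<alpha> n m \<gamma> d (q(d := v)) p"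
    unfolding 1 2 using \<gamma>[OF d1] opt[OF z(1)]
    by (intro diff_right_mono divide_right_mono add_left_mono mult_left_mono) simp_all
qed

end

theorem mainTheorem4:
  shows "\<exists>(prog :: com) (C :: nat).
    \<forall>(b :: nat) (\<alpha> :: nat) (s :: nat) (m :: nat) (n :: nat) (N :: nat) (\<gamma> :: nat \<Rightarrow> real)
      (p :: int poly) (g :: int poly) (c\<^sub>\<omega> :: nat) (c\<^sub>g :: nat) (c\<^sub>v :: nat) (ct\<^sub>v :: nat).
      prime b \<and> \<alpha> > 1 \<and> s \<ge> 1 \<and> m \<ge> 1 \<and> n = \<alpha> * m \<and> N = b ^ m \<and>
      (\<forall>j\<ge>1. \<gamma> j > 0) \<and>
      p \<in> Fpolys b \<and> poly_mod.irreducible_m (int b) p \<and> degree p = n \<and>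
      unit_group_generator b p g \<and>
      ct\<^sub>v = c\<^sub>g + c\<^sub>v
      \<longrightarrow>
      (\<exists>(A :: cell set) (t :: nat) (\<tau> :: store).
        exec (cbc_machine b \<alpha> n s \<gamma> p g c\<^sub>\<omega> c\<^sub>g c\<^sub>v (C * (b ^ n + s)) A) prog
          (initial_store b \<alpha> s m) t \<tau> \<and>
        length (out \<tau>) = s \<and>
        (\<forall>d<s. out \<tau> ! d < b ^ n) \<and>
        cbc_vector b \<alpha> n m \<gamma> s p (\<lambda>d. poly_of_nat b (out \<tau> ! (d - 1))) \<and>
        real t \<le> real C * (real s * real (b ^ n) * ln (real (b ^ n))
                            + real (b ^ n) * (real c\<^sub>\<omega> + real ct\<^sub>v)) \<and>
        finite A \<and> card A \<le> C * b ^ n \<and> b ^ n = N ^ \<alpha>)"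
\<comment> \<open>The constant 40000 of the running time also covers the 100 of the word bound and
  the 76 of the memory bound.\<close>
proof (rule exI[of _ cbc_prog], rule exI[of _ 40000], intro allI impI, elim conjE)
  fix b \<alpha> s m n N :: nat and \<gamma> :: "nat \<Rightarrow> real" and p g :: "int poly" and c\<^sub>\<omega> c\<^sub>g c\<^sub>v ct\<^sub>v :: nat
  assume b: "prime b" and \<alpha>: "\<alpha> > 1" and s: "s \<ge> 1" and m: "m \<ge> 1" and n: "n = \<alpha> * m" and N: "N = b ^ m"
    and \<gamma>: "\<forall>j\<ge>1. \<gamma> j > 0" and p: "p \<in> Fpolys b" "poly_mod.irreducible_m (int b) p" "degree p = n"
    and g: "unit_group_generator b p g" and ct: "ct\<^sub>v = c\<^sub>g + c\<^sub>v"
  define A where "A = working_cells (b ^ n)"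
  define mach where "mach = cbc_machine b \<alpha> n s \<gamma> p g c\<^sub>\<omega> c\<^sub>g c\<^sub>v (40000 * (b ^ n + s)) A"
  interpret cbc_instance b p n g \<alpha> s m \<gamma> mach
  proof
    show "n > 0" using \<alpha> m n by simp
    show "\<gamma> j > 0" if "j \<ge> 1" for j using \<gamma> that by blast
  qed (use b p g \<alpha> m n in \<open>simp_all add: mach_def cbc_machine_def A_def\<close>)
  have "run mach cbc_prog (initial_store b \<alpha> s m) (\<lambda>t \<tau>.
      real t \<le> 40000 * (real s * real (b ^ n) * ln (real (b ^ n))) +
        real (b ^ n) * real (mulgen_cost mach + veval_cost mach + omegaeval_cost mach) \<and>
      (\<exists>zs. greedy zs s \<and> out \<tau> = map (\<lambda>j. orbit (zs j)) [0..<s]))"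
    by (rule run_cbc[OF s]) (simp_all add: initial_store_def)
  then obtain t \<tau> zs where ex: "exec mach cbc_prog (initial_store b \<alpha> s m) t \<tau>"
    and t: "real t \<le> 40000 * (real s * real (b ^ n) * ln (real (b ^ n))) +
        real (b ^ n) * real (mulgen_cost mach + veval_cost mach + omegaeval_cost mach)"
    and zs: "greedy zs s" and out: "out \<tau> = map (\<lambda>j. orbit (zs j)) [0..<s]"
    unfolding run_def by blast
  note exec = ex[unfolded mach_def]
  have length: "length (out \<tau>) = s" by (simp add: out)
  have less: "\<forall>d<s. out \<tau> ! d < b ^ n" using orbit_less by (simp add: out)
  have vector: "cbc_vector b \<alpha> n m \<gamma> s p (\<lambda>d. poly_of_nat b (out \<tau> ! (d - 1)))"
    by (rule cbc_vector_greedy[OF zs]) (auto simp: out gen_vector_def)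
  have cost: "real t \<le> real 40000 * (real s * real (b ^ n) * ln (real (b ^ n)) + real (b ^ n) * (real c\<^sub>\<omega> + real ct\<^sub>v))"
  proof -
    have "real (mulgen_cost mach + veval_cost mach + omegaeval_cost mach) = real c\<^sub>\<omega> + real ct\<^sub>v"
      by (simp add: mach_def cbc_machine_def ct)
    with t have "real t \<le> 40000 * (real s * real (b ^ n) * ln (real (b ^ n))) + real (b ^ n) * (real c\<^sub>\<omega> + real ct\<^sub>v)"
      by (simp only:)
    also have "\<dots> \<le> 40000 * (real s * real (b ^ n) * ln (real (b ^ n))) + 40000 * (real (b ^ n) * (real c\<^sub>\<omega> + real ct\<^sub>v))"
      by simp
    finally show ?thesis by (simp only: distrib_left of_nat_numeral)
  qed
  have finite: "finite A" unfolding A_def by (rule finite_working_cells)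
  have card: "card A \<le> 40000 * b ^ n"
    using card_working_cells[of "b ^ n"] by (simp add: A_def)
  have power: "b ^ n = N ^ \<alpha>" by (simp only: n N power_mult[symmetric] mult.commute)
  show "\<exists>A t \<tau>. exec (cbc_machine b \<alpha> n s \<gamma> p g c\<^sub>\<omega> c\<^sub>g c\<^sub>v (40000 * (b ^ n + s)) A) cbc_prog
      (initial_store b \<alpha> s m) t \<tau> \<and> length (out \<tau>) = s \<and> (\<forall>d<s. out \<tau> ! d < b ^ n) \<and>
      cbc_vector b \<alpha> n m \<gamma> s p (\<lambda>d. poly_of_nat b (out \<tau> ! (d - 1))) \<and>
      real t \<le> real 40000 * (real s * real (b ^ n) * ln (real (b ^ n)) + real (b ^ n) * (real c\<^sub>\<omega> + real ct\<^sub>v)) \<and>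
      finite A \<and> card A \<le> 40000 * b ^ n \<and> b ^ n = N ^ \<alpha>"
    by (intro exI conjI) (fact exec length less vector cost finite card power)+
qed

end
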